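(* Let $n\ge1$, $\lambda,x\in\mathbb{R}^n$, $d=n^2$, and let $\Psi_\lambda(x)$ be the $SO(n+1,n)$ Whittaker wave function defined in the context. Write $\mathrm{i}=\sqrt{-1}$. Then $$\Psi_\lambda(x)=\frac{e^{-\mathrm{i}\sum_k\lambda_kx_k}}{(2\pi\mathrm{i})^d}\int_C e^{H(x,\gamma)}\,\Gamma(\gamma_n+2\mathrm{i}\lambda_n)\Gamma(\gamma_n)\,d\gamma_n\prod_{k=1}^{n-1}\Gamma(\gamma_{k,k+1}+\delta_{k,k+1}+2\mathrm{i}\lambda_k)\,\Gamma(\gamma_k-\gamma_{k+1})\,d\gamma_k$$ $$\times\prod_{1\le k<l\le n}\Gamma(\xi_{k,l}+\mathrm{i}(\lambda_k-\lambda_l))\,\Gamma(\eta_{k,l}+\mathrm{i}(\lambda_k+\lambda_l))\,\Gamma(\gamma_{k,l}-\gamma_{k+1,l})\,\Gamma(\delta_{k,l}-\delta_{k+1,l})\,d\gamma_{k,l}\,d\delta_{k,l}.$$ The integration variables are $\gamma_{k,l},\delta_{k,l}$ ($1\le k<l\le n$) and $\gamma_1,\dots,\gamma_n$; $\gamma_{k,l}=\delta_{k,l}=0$ by convention unless $1\le k<l\le n$, and $\gamma_{n+1}=0$; $$H(x,\gamma)=\sum_{j=2}^n(\gamma_{1,j}+\delta_{1,j})(x_j-x_{j-1})-\gamma_1x_n,$$ $$\xi_{k,l}=-\gamma_{k+1,l+1}-\delta_{k+1,l+1}+\gamma_{k+1,l}+\delta_{k,l},\qquad \eta_{k,l}=\gamma_{k,l+1}+\delta_{k,l+1}-\gamma_{k+1,l}-\delta_{k,l}\qquad(1\le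 k<l<n),$$ $$\xi_{k,n}=\gamma_{k+1,n}+\delta_{k,n}-\gamma_{k+1},\qquad \eta_{k,n}=-\gamma_{k+1,n}-\delta_{k,n}+\gamma_k\qquad(1\le k<n).$$ The integration cycle $C$ is a deformation of the imaginary plane $\operatorname{Re}\gamma_{k,l}=\operatorname{Re}\delta_{k,l}=\operatorname{Re}\gamma_k=0$ (each variable running from $-\mathrm{i}\infty$ to $+\mathrm{i}\infty$) into the nonempty domain $D\subset\mathbb{C}^d$ of analyticity of the integrand, which is described by the relations $\operatorname{Re}\gamma_{k,l}>0$, $\operatorname{Re}\delta_{k,l}>0$, $\operatorname{Re}\xi_{k,l}>0$, $\operatorname{Re}\eta_{k,l}>0$ for $1\le k<l\le n$ and $\operatorname{Re}\gamma_k>0$ for $k=1,\dots,n$.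
   Context: Let $e_{a,b}$ be the $(2n+1)\times(2n+1)$ matrix units and $\hat k=2n+2-k$. $SO(n+1,n)\subset SL(2n+1,\mathbb{R})$ is the group preserving $\sum_{i=1}^{n}(x_iy_{\hat i}+x_{\hat i}y_i)+x_{n+1}y_{n+1}$. Chevalley generators: $e_i=e_{i,i+1}-e_{2n+1-i,2n+2-i}$, $f_i=e_{i+1,i}-e_{2n+2-i,2n+1-i}$ for $1\le i\le n-1$; $e_n=\sqrt2(e_{n,n+1}-e_{n+1,n+2})$, $f_n=\sqrt2(e_{n+1,n}-e_{n+2,n+1})$. For variables $t_{i,j},s_{i,j}$ ($1\le i<j\le n$), $t_i$ ($1\le i\le n$), abbreviated $\mathbf t$, put $X(\mathbf t)=R_nR_{n-1}\cdots R_1$ with $R_n=\exp(t_ne_n)$ and, for $i<n$, $$R_i=\exp(s_{i,i+1}e_i)\exp(s_{i,i+2}e_{i+1})\cdots\exp(s_{i,n}e_{n-1})\exp(t_ie_n)\exp(t_{i,n}e_{n-1})\cdots\exp(t_{i,i+2}e_{i+1})\exp(t_{i,i+1}e_i).$$ Let $\bar w_0$ be the matrix obtained from this product by replacing each factor $\exp(c\,e_j)$ by $\exp(e_j)\exp(-f_j)\exp(e_j)$ (a lift of the longest Weyl group element). For $T=e_{n+1,n+1}+\sum_{k=1}^n(T_ke_{k,k}+T_k^{-1}e_{\hat k,\hat k})$ with $T_k>0$ and $\nu\in\mathbb{C}^n$ put $\chi_\nu(T)=\prod_kT_k^{\nu_k}$. Let $\rho_k=n+\frac12-k$, $(\rho,x)=\sum_k\rho_kx_k$.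 Right Whittaker vector: for $Y\in SO(n+1,n)$ lower triangular unipotent, $T=e_{n+1,n+1}+\sum_{k=1}^n(T_ke_{k,k}+T_k^{-1}e_{\hat k,\hat k})$ with all $T_k>0$, and all coordinates of $\mathbf t$ positive, $v^R_\mu(Y\,T\,X(\mathbf t))=\chi_\mu(T)\exp(-\sum_{i<j}(t_{i,j}+s_{i,j})-\sum_it_i)$. Left Whittaker vector: if all coordinates of $\mathbf t$ are positive there is a unique factorization $X(-\mathbf t)\bar w_0=Y\,T\,X(\mathbf p)$ with $Y$ lower triangular unipotent, $T=e_{n+1,n+1}+\sum_{k=1}^n(T_ke_{k,k}+T_k^{-1}e_{\hat k,\hat k})$ with all $T_k>0$, and positive coordinates $\mathbf p=(p_{i,j},q_{i,j},p_i)$ (in place of $t_{i,j},s_{i,j},t_i$ respectively); put $v^L_\nu(X(\mathbf t))=\chi_\nu(T)\exp(-\sum_{i<j}(p_{i,j}+q_{i,j})-\sum_ip_i)$. With $\mu=\mathrm{i}\lambda-\rho$ and $h(x)=\sum_{k=1}^nx_k(e_{k,k}-e_{\hat k,\hat k})$, $$\Psi_\lambda(x)=e^{-(\rho,x)}\int_{\mathbf t>0}\overline{v^L_\mu(X(\mathbf t))}\;v^R_\mu\big(X(\mathbf t)e^{-h(x)}\big)\prod_{i<j}t_{i,j}^{\,j-i}s_{i,j}^{\,2n+1-i-j}\frac{dt_{i,j}}{t_{i,j}}\frac{ds_{i,j}}{s_{i,j}}\prod_{i=1}^nt_i^{\,2n+1-2i}\frac{dt_i}{t_i}.$$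
   Formalization: For n≥3 the listed relations allow poles of the integrand, so D here also requires Re(γ_{k,l}−γ_{k+1,l})>0 and Re(δ_{k,l}−δ_{k+1,l})>0 for 1≤k<l≤n; C is any vertical plane through a real point of this D. *)

theory Defs
  imports "HOL-Analysis.Analysis" "Jordan_Normal_Form.Determinant"
begin

text \<open>Vectors such as \<open>\<lambda>, x, \<nu> \<in> K\<^sup>n\<close> and torus parameters \<open>T\<^sub>1, \<dots>, T\<^sub>n\<close> are functions on
  \<^typ>\<open>nat\<close> of which only the values at \<open>1, \<dots>, n\<close> are ever used. Matrices are those of
  Jordan_Normal_Form, whose rows and columns are numbered from 0; indices \<open>a, b\<close> in the comments
  are 1-based.\<close>

definition hat :: "nat \<Rightarrow> nat \<Rightarrow> nat" where
  "hat n k = 2 * n + 2 - k"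

definition unit_mat :: "nat \<Rightarrow> nat \<Rightarrow> nat \<Rightarrow> real mat" where
  "unit_mat n a b = Matrix.mat (2 * n + 1) (2 * n + 1)
     (\<lambda>(r, c). if r + 1 = a \<and> c + 1 = b then 1 else 0)"

definition chev_e :: "nat \<Rightarrow> nat \<Rightarrow> real mat" where
  "chev_e n i =
     (if i < n then unit_mat n i (i + 1) - unit_mat n (2 * n + 1 - i) (2 * n + 2 - i)
      else sqrt 2 \<cdot>\<^sub>m (unit_mat n n (n + 1) - unit_mat n (n + 1) (n + 2)))"

definition chev_f :: "nat \<Rightarrow> nat \<Rightarrow> real mat" where
  "chev_f n i =
     (if i < n then unit_mat n (i + 1) i - unit_mat n (2 * n + 2 - i) (2 * n + 1 - i)
      else sqrt 2 \<cdot>\<^sub>m (unit_mat n (n + 1) n - unit_mat n (n + 2) (n + 1)))"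

text \<open>Exponential series of a square matrix, summed entrywise.\<close>

definition mat_exp :: "real mat \<Rightarrow> real mat" where
  "mat_exp A = Matrix.mat (dim_row A) (dim_col A)
     (\<lambda>(r, c). \<Sum>m. (A ^\<^sub>m m) $$ (r, c) / fact m)"

definition split_form :: "nat \<Rightarrow> real Matrix.vec \<Rightarrow> real Matrix.vec \<Rightarrow> real" where
  "split_form n x y =
     (\<Sum>i = 1..n. vec_index x (i - 1) * vec_index y (hat n i - 1)
                + vec_index x (hat n i - 1) * vec_index y (i - 1))
     + vec_index x n * vec_index y n"

definition SO_split :: "nat \<Rightarrow> real mat set" where
  "SO_split n = {g \<in> carrier_mat (2 * n + 1) (2 * n + 1).
     Determinant.det g = 1 \<and>
     (\<forall>x \<in> carrier_vec (2 * n + 1). \<forall>y \<in> carrier_vec (2 * n + 1).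
        split_form n (g *\<^sub>v x) (g *\<^sub>v y) = split_form n x y)}"

definition lower_unipotent :: "nat \<Rightarrow> real mat \<Rightarrow> bool" where
  "lower_unipotent n Y \<longleftrightarrow> Y \<in> carrier_mat (2 * n + 1) (2 * n + 1) \<and>
     (\<forall>r < 2 * n + 1. Y $$ (r, r) = 1) \<and>
     (\<forall>c < 2 * n + 1. \<forall>r < c. Y $$ (r, c) = 0)"

text \<open>The torus element with diagonal \<open>T\<^sub>1, \<dots>, T\<^sub>n, 1, 1/T\<^sub>n, \<dots>, 1/T\<^sub>1\<close>, and the Cartan element
  \<open>h(x)\<close> with diagonal \<open>x\<^sub>1, \<dots>, x\<^sub>n, 0, -x\<^sub>n, \<dots>, -x\<^sub>1\<close>.\<close>

definition torus :: "nat \<Rightarrow> (nat \<Rightarrow> real) \<Rightarrow> real mat" where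
  "torus n T = mat_diag (2 * n + 1)
     (\<lambda>r. if r < n then T (r + 1) else if r = n then 1 else inverse (T (hat n (r + 1))))"

definition cartan :: "nat \<Rightarrow> (nat \<Rightarrow> real) \<Rightarrow> real mat" where
  "cartan n x = mat_diag (2 * n + 1)
     (\<lambda>r. if r < n then x (r + 1) else if r = n then 0 else - x (hat n (r + 1)))"

text \<open>Names of the \<open>d = n\<^sup>2\<close> coordinates. For the matrix variables \<open>DblA i j\<close>, \<open>DblB i j\<close>, \<open>Sgl i\<close>
  stand for \<open>t\<^sub>i\<^sub>,\<^sub>j\<close>, \<open>s\<^sub>i\<^sub>,\<^sub>j\<close>, \<open>t\<^sub>i\<close>; for the Mellin-Barnes variables \<open>DblA k l\<close>, \<open>DblB k l\<close>, \<open>Sgl k\<close>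
  stand for \<open>\<gamma>\<^sub>k\<^sub>,\<^sub>l\<close>, \<open>\<delta>\<^sub>k\<^sub>,\<^sub>l\<close>, \<open>\<gamma>\<^sub>k\<close>.\<close>

datatype coord = DblA nat nat | DblB nat nat | Sgl nat

definition pairs :: "nat \<Rightarrow> (nat \<times> nat) set" where
  "pairs n = {(i, j). 1 \<le> i \<and> i < j \<and> j \<le> n}"

definition coords :: "nat \<Rightarrow> coord set" where
  "coords n = (\<lambda>(i, j). DblA i j) ` pairs n \<union> (\<lambda>(i, j). DblB i j) ` pairs n \<union> Sgl ` {1..n}"

definition positive :: "nat \<Rightarrow> (coord \<Rightarrow> real) \<Rightarrow> bool" where
  "positive n t \<longleftrightarrow> (\<forall>a \<in> coords n. 0 < t a)"

definition coord_measure :: "nat \<Rightarrow> (coord \<Rightarrow> real) measure" where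
  "coord_measure n = Pi\<^sub>M (coords n) (\<lambda>_. lborel)"

text \<open>The factors \<open>exp(t\<^sub>a e\<^sub>j)\<close> of \<open>R\<^sub>i\<close>, and of \<open>R\<^sub>n R\<^sub>n\<^sub>-\<^sub>1 \<dots> R\<^sub>1\<close>, from left to right, recorded as
  pairs \<open>(j, a)\<close>.\<close>

definition row_word :: "nat \<Rightarrow> nat \<Rightarrow> (nat \<times> coord) list" where
  "row_word n i = map (\<lambda>j. (j - 1, DblB i j)) [i + 1..<n + 1] @ [(n, Sgl i)]
     @ map (\<lambda>j. (j - 1, DblA i j)) (rev [i + 1..<n + 1])"

definition word :: "nat \<Rightarrow> (nat \<times> coord) list" where
  "word n = concat (map (row_word n) (rev [1..<n + 1]))"

definition mat_prod :: "nat \<Rightarrow> real mat list \<Rightarrow> real mat" where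
  "mat_prod n Ms = foldr (*) Ms (1\<^sub>m (2 * n + 1))"

definition X_mat :: "nat \<Rightarrow> (coord \<Rightarrow> real) \<Rightarrow> real mat" where
  "X_mat n t = mat_prod n (map (\<lambda>(j, a). mat_exp (t a \<cdot>\<^sub>m chev_e n j)) (word n))"

definition w0_bar :: "nat \<Rightarrow> real mat" where
  "w0_bar n = mat_prod n
     (map (\<lambda>(j, a). mat_exp (chev_e n j) * mat_exp (- chev_f n j) * mat_exp (chev_e n j)) (word n))"

definition chi :: "nat \<Rightarrow> (nat \<Rightarrow> complex) \<Rightarrow> (nat \<Rightarrow> real) \<Rightarrow> complex" where
  "chi n \<nu> T = (\<Prod>k = 1..n. complex_of_real (T k) powr \<nu> k)"

definition char_exp :: "nat \<Rightarrow> (coord \<Rightarrow> real) \<Rightarrow> complex" where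
  "char_exp n t = complex_of_real (exp (
     - (\<Sum>(i, j)\<in>pairs n. t (DblA i j) + t (DblB i j)) - (\<Sum>i = 1..n. t (Sgl i))))"

text \<open>Both Whittaker vectors are functions of a group element, given through its (unique)
  factorization.\<close>

definition whittaker_R :: "nat \<Rightarrow> (nat \<Rightarrow> complex) \<Rightarrow> real mat \<Rightarrow> complex" where
  "whittaker_R n \<mu> g = (THE v. \<exists>Y T t.
     Y \<in> SO_split n \<and> lower_unipotent n Y \<and> (\<forall>k \<in> {1..n}. 0 < T k) \<and> positive n t \<and>
     g = Y * torus n T * X_mat n t \<and> v = chi n \<mu> T * char_exp n t)"

definition whittaker_L :: "nat \<Rightarrow> (nat \<Rightarrow> complex) \<Rightarrow> real mat \<Rightarrow> complex" where
  "whittaker_L n \<nu> g = (THE v. \<exists>t Y T p.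
     positive n t \<and> g = X_mat n t \<and>
     lower_unipotent n Y \<and> (\<forall>k \<in> {1..n}. 0 < T k) \<and> positive n p \<and>
     X_mat n (\<lambda>a. - t a) * w0_bar n = Y * torus n T * X_mat n p \<and>
     v = chi n \<nu> T * char_exp n p)"

definition rho :: "nat \<Rightarrow> nat \<Rightarrow> real" where
  "rho n k = real n + 1 / 2 - real k"

definition mu :: "nat \<Rightarrow> (nat \<Rightarrow> real) \<Rightarrow> nat \<Rightarrow> complex" where
  "mu n lam k = \<i> * complex_of_real (lam k) - complex_of_real (rho n k)"

definition psi_integrand ::
  "nat \<Rightarrow> (nat \<Rightarrow> real) \<Rightarrow> (nat \<Rightarrow> real) \<Rightarrow> (coord \<Rightarrow> real) \<Rightarrow> complex" where
  "psi_integrand n lam x t =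
     cnj (whittaker_L n (mu n lam) (X_mat n t))
     * whittaker_R n (mu n lam) (X_mat n t * mat_exp (- cartan n x))
     * complex_of_real
         ((\<Prod>(i, j)\<in>pairs n. t (DblA i j) ^ (j - i) * t (DblB i j) ^ (2 * n + 1 - i - j)
                              / (t (DblA i j) * t (DblB i j)))
          * (\<Prod>i = 1..n. t (Sgl i) ^ (2 * n + 1 - 2 * i) / t (Sgl i)))"

definition Psi :: "nat \<Rightarrow> (nat \<Rightarrow> real) \<Rightarrow> (nat \<Rightarrow> real) \<Rightarrow> complex" where
  "Psi n lam x = complex_of_real (exp (- (\<Sum>k = 1..n. rho n k * x k)))
     * set_lebesgue_integral (coord_measure n) {t. positive n t} (psi_integrand n lam x)"


text \<open>Mellin-Barnes variables with the stated conventions for indices out of range.\<close>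

definition gam2 :: "nat \<Rightarrow> (coord \<Rightarrow> complex) \<Rightarrow> nat \<Rightarrow> nat \<Rightarrow> complex" where
  "gam2 n \<gamma> k l = (if (k, l) \<in> pairs n then \<gamma> (DblA k l) else 0)"

definition del2 :: "nat \<Rightarrow> (coord \<Rightarrow> complex) \<Rightarrow> nat \<Rightarrow> nat \<Rightarrow> complex" where
  "del2 n \<gamma> k l = (if (k, l) \<in> pairs n then \<gamma> (DblB k l) else 0)"

definition gam1 :: "nat \<Rightarrow> (coord \<Rightarrow> complex) \<Rightarrow> nat \<Rightarrow> complex" where
  "gam1 n \<gamma> k = (if k \<in> {1..n} then \<gamma> (Sgl k) else 0)"

definition xi :: "nat \<Rightarrow> (coord \<Rightarrow> complex) \<Rightarrow> nat \<Rightarrow> nat \<Rightarrow> complex" where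
  "xi n \<gamma> k l =
     (if l < n then - gam2 n \<gamma> (k + 1) (l + 1) - del2 n \<gamma> (k + 1) (l + 1)
                    + gam2 n \<gamma> (k + 1) l + del2 n \<gamma> k l
      else gam2 n \<gamma> (k + 1) n + del2 n \<gamma> k n - gam1 n \<gamma> (k + 1))"

definition eta :: "nat \<Rightarrow> (coord \<Rightarrow> complex) \<Rightarrow> nat \<Rightarrow> nat \<Rightarrow> complex" where
  "eta n \<gamma> k l =
     (if l < n then gam2 n \<gamma> k (l + 1) + del2 n \<gamma> k (l + 1)
                    - gam2 n \<gamma> (k + 1) l - del2 n \<gamma> k l
      else - gam2 n \<gamma> (k + 1) n - del2 n \<gamma> k n + gam1 n \<gamma> k)"

definition mb_H :: "nat \<Rightarrow> (nat \<Rightarrow> real) \<Rightarrow> (coord \<Rightarrow> complex) \<Rightarrow> complex" where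
  "mb_H n x \<gamma> =
     (\<Sum>j = 2..n. (gam2 n \<gamma> 1 j + del2 n \<gamma> 1 j) * complex_of_real (x j - x (j - 1)))
     - gam1 n \<gamma> 1 * complex_of_real (x n)"

definition mb_integrand ::
  "nat \<Rightarrow> (nat \<Rightarrow> real) \<Rightarrow> (nat \<Rightarrow> real) \<Rightarrow> (coord \<Rightarrow> complex) \<Rightarrow> complex" where
  "mb_integrand n lam x \<gamma> =
     exp (mb_H n x \<gamma>)
     * Gamma (gam1 n \<gamma> n + 2 * \<i> * complex_of_real (lam n)) * Gamma (gam1 n \<gamma> n)
     * (\<Prod>k = 1..<n.
          Gamma (gam2 n \<gamma> k (k + 1) + del2 n \<gamma> k (k + 1) + 2 * \<i> * complex_of_real (lam k))
          * Gamma (gam1 n \<gamma> k - gam1 n \<gamma> (k + 1)))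
     * (\<Prod>(k, l)\<in>pairs n.
          Gamma (xi n \<gamma> k l + \<i> * complex_of_real (lam k - lam l))
          * Gamma (eta n \<gamma> k l + \<i> * complex_of_real (lam k + lam l))
          * Gamma (gam2 n \<gamma> k l - gam2 n \<gamma> (k + 1) l)
          * Gamma (del2 n \<gamma> k l - del2 n \<gamma> (k + 1) l))"

text \<open>The domain of analyticity of the integrand into which the cycle is deformed. The last two
  inequalities keep the arguments of \<open>\<Gamma>(\<gamma>\<^sub>k\<^sub>,\<^sub>l - \<gamma>\<^sub>k\<^sub>+\<^sub>1\<^sub>,\<^sub>l)\<close> and \<open>\<Gamma>(\<delta>\<^sub>k\<^sub>,\<^sub>l - \<delta>\<^sub>k\<^sub>+\<^sub>1\<^sub>,\<^sub>l)\<close> away from the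
  poles of the Gamma function. For \<open>n \<ge> 3\<close> they do not follow from the other five, and without
  them the set would contain poles of the integrand, so that the integral over a vertical plane
  would depend on the plane. Every other Gamma factor has an argument with positive real part as
  a consequence of the first five.\<close>

definition mb_domain :: "nat \<Rightarrow> (coord \<Rightarrow> complex) set" where
  "mb_domain n = {\<gamma>.
     (\<forall>(k, l)\<in>pairs n. 0 < Re (gam2 n \<gamma> k l) \<and> 0 < Re (del2 n \<gamma> k l)
        \<and> 0 < Re (xi n \<gamma> k l) \<and> 0 < Re (eta n \<gamma> k l)) \<and>
     (\<forall>k \<in> {1..n}. 0 < Re (gam1 n \<gamma> k)) \<and>
     (\<forall>(k, l)\<in>pairs n. 0 < Re (gam2 n \<gamma> k l - gam2 n \<gamma> (k + 1) l)
        \<and> 0 < Re (del2 n \<gamma> k l - del2 n \<gamma> (k + 1) l))}"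

text \<open>The cycle is the translate \<open>c + \<i> \<real>\<^sup>d\<close> of the imaginary plane, each variable running upwards.
  With \<open>\<gamma> = c + \<i> y\<close> each of the \<open>d\<close> differentials contributes a factor \<open>\<i>\<close>.\<close>

definition vertical :: "(coord \<Rightarrow> real) \<Rightarrow> (coord \<Rightarrow> real) \<Rightarrow> coord \<Rightarrow> complex" where
  "vertical c y = (\<lambda>a. complex_of_real (c a) + \<i> * complex_of_real (y a))"

definition cycle_integral ::
  "nat \<Rightarrow> (coord \<Rightarrow> real) \<Rightarrow> ((coord \<Rightarrow> complex) \<Rightarrow> complex) \<Rightarrow> complex" where
  "cycle_integral n c F =
     \<i> ^ card (coords n) * lebesgue_integral (coord_measure n) (\<lambda>y. F (vertical c y))"

definition cycle_integrable ::
  "nat \<Rightarrow> (coord \<Rightarrow> real) \<Rightarrow> ((coord \<Rightarrow> complex) \<Rightarrow> complex) \<Rightarrow> bool" where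
  "cycle_integrable n c F \<longleftrightarrow> integrable (coord_measure n) (\<lambda>y. F (vertical c y))"

end

theory Submission
  imports Defs "HOL-Probability.Characteristic_Functions" "HOL-Probability.Sinc_Integral"
begin

text \<open>Write \<open>X(\<^bold>t) = Z R\<^sub>1\<close>, where \<open>Z = R\<^sub>n \<dots> R\<^sub>2\<close> lies in the next smaller orthogonal group. The first
  row of \<open>X(-\<^bold>t) w\<^sub>0 = Y T X(\<^bold>p)\<close> involves only \<open>R\<^sub>1\<close> and determines \<open>T\<^sub>1\<close> and the first row of
  \<open>\<^bold>p\<close>. What remains is the same problem for \<open>Z\<close>, except that its coordinates are rescaled by
  the torus element with entries \<open>t\<^sub>1\<^sub>,\<^sub>l / s\<^sub>1\<^sub>,\<^sub>l\<close>. Hence \<open>T\<close> is monomial in \<open>\<^bold>t\<close>, the sum of all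
  coordinates of \<open>\<^bold>p\<close> is a sum of \<open>d\<close> Laurent monomials, and these monomials are related to \<open>\<^bold>t\<close>
  by a unimodular triangular change of the logarithmic coordinates.

  The wave function thus becomes the integral of \<open>T\<^sup>-\<^sup>i\<^sup>\<lambda>\<close> times \<open>2d\<close> factors \<open>exp (- monomial)\<close>. The
  \<open>d\<close> factors that come from the right vector are replaced by the Mellin integral
  \<open>exp (-u) = 1/(2\<pi>) \<integral> \<Gamma>(c + iy) u\<^sup>-\<^sup>c\<^sup>-\<^sup>i\<^sup>y dy\<close>. The joint integrand is dominated by a product of
  integrable functions of single coordinates, so Fubini applies, and the integral over \<open>\<^bold>t\<close> is
  then a product of \<open>d\<close> Gamma integrals.\<close>

section \<open>Measure-preserving maps and Mellin transforms\<close>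

text \<open>Both iterated integrals factorize because of one bilinear identity. Let u_a be the Gamma
  arguments introduced by Mellin inversion and M_b the logarithms of the monomials in the left
  exponent. Then sum u_a tau_a + i sum lambda_k log T_k = - sum z_b M_b for all tau, and the z_b
  determined by this are exactly the remaining Gamma arguments of the Mellin-Barnes integrand. Along
  a vertical plane the real parts of u_a and z_b are constant, which is what makes the domination
  possible; \<open>mb_domain\<close> ensures that they are positive.

  The shift by rho in mu leaves no trace: the given measure, written in logarithmic coordinates, is
  T^rho, and exp (- (rho, x)) compensates the right vector.

  The single coordinates of p are in general not monomial in t. Their denominators cancel only when
  the two coordinates of one column are added, so the factorization is followed through the sum of
  each row. Row vectors are used throughout because the first basis row is fixed by Z, while a first
  column would see every factor.\<close>

interpretation lborel_prod: product_sigma_finite "\<lambda>_::'i. lborel :: real measure"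
  by standard

section \<open>Exponential substitution and triangular shears on product spaces\<close>

lemma nn_integral_exp_substitution:
  fixes f :: "real \<Rightarrow> ennreal"
  assumes f[measurable]: "f \<in> borel_measurable borel"
  shows "(\<integral>\<^sup>+x. f x * indicator {0<..} x \<partial>lborel) = (\<integral>\<^sup>+x. f (exp x) * exp x \<partial>lborel)"
proof -
  \<comment> \<open>The \<open>+ 1\<close> keeps every exhausting interval nondegenerate, as the
    substitution rule on a closed interval requires.\<close>
  have ex: "\<exists>k::nat. x \<in> {- real (k + 1)..real (k + 1)}" for x
  proof -
    obtain k where "\<bar>x\<bar> \<le> real k" using real_arch_simple by blast
    then show ?thesis by (intro exI[of _ k]) auto
  qed
  have A: "{0<..} = (\<Union>k::nat. {exp (- real (k + 1))..exp (real (k + 1))})"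
  proof safe
    fix x :: real assume x: "0 < x"
    obtain k where "ln x \<in> {- real (k + 1)..real (k + 1)}" using ex by blast
    then have "exp (- real (k + 1)) \<le> exp (ln x) \<and> exp (ln x) \<le> exp (real (k + 1))"
      unfolding exp_le_cancel_iff by simp
    with x show "x \<in> (\<Union>k::nat. {exp (- real (k + 1))..exp (real (k + 1))})"
      by (intro UN_I[of k]) auto
  qed (auto intro: less_le_trans[OF exp_gt_zero])
  have B: "UNIV = (\<Union>k::nat. {- real (k + 1)..real (k + 1)})"
    using ex by blast
  have "(\<integral>\<^sup>+x. f x * indicator {0<..} x \<partial>lborel) = emeasure (density lborel f) {0<..}"
    by (simp add: emeasure_density)
  also have "\<dots> = (SUP k::nat. emeasure (density lborel f) {exp (- real (k + 1))..exp (real (k + 1))})"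
    unfolding A by (rule SUP_emeasure_incseq[symmetric]) (auto simp: incseq_def intro: order_trans[rotated])
  also have "\<dots> = (SUP k::nat. emeasure (density lborel (\<lambda>x. f (exp x) * exp x)) {- real (k + 1)..real (k + 1)})"
  proof (rule SUP_cong[OF refl])
    fix k :: nat
    show "emeasure (density lborel f) {exp (- real (k + 1))..exp (real (k + 1))}
      = emeasure (density lborel (\<lambda>x. f (exp x) * exp x)) {- real (k + 1)..real (k + 1)}"
      using nn_integral_substitution_aux[OF f, of "- real (k + 1)" "real (k + 1)" exp exp]
      by (simp add: emeasure_density continuous_on_exp DERIV_exp)
  qed
  also have "\<dots> = emeasure (density lborel (\<lambda>x. f (exp x) * exp x)) UNIV"
    unfolding B by (rule SUP_emeasure_incseq) (auto simp: incseq_def)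
  also have "\<dots> = (\<integral>\<^sup>+x. f (exp x) * exp x \<partial>lborel)"
    by (simp add: emeasure_density)
  finally show ?thesis .
qed

text \<open>Both sides give every box the product of the one-dimensional masses, and boxes determine
  a finite product of sigma-finite measures.\<close>

lemma distr_exp_lborel_PiM:
  assumes I: "finite I"
  shows "distr (density (Pi\<^sub>M I (\<lambda>_. lborel)) (\<lambda>y. \<Prod>a\<in>I. ennreal (exp (y a))))
           (Pi\<^sub>M I (\<lambda>_. lborel)) (\<lambda>y. \<lambda>a\<in>I. exp (y a))
       = density (Pi\<^sub>M I (\<lambda>_. lborel)) (\<lambda>t. \<Prod>a\<in>I. indicator {0<..} (t a))" (is "?L = ?R")
proof -
  have "sigma_finite_measure (density lborel (indicator {0::real<..}))"
    using sigma_finite_measure.sigma_finite_iff_density_finite[OF sigma_finite_lborel, of "indicator {0::real<..}"]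
    by (simp split: split_indicator)
  then interpret P: product_sigma_finite "\<lambda>_::'a. density lborel (indicator {0::real<..})"
    by (intro product_sigma_finite.intro)
  have em: "emeasure (density lborel (indicator {0::real<..})) A
      = (\<integral>\<^sup>+x. indicator A (exp x) * ennreal (exp x) \<partial>lborel)" if [measurable]: "A \<in> sets borel" for A
    by (subst nn_integral_exp_substitution[symmetric])
       (auto simp: emeasure_density intro!: nn_integral_cong simp: mult.commute)
  have "?L = Pi\<^sub>M I (\<lambda>_. density lborel (indicator {0::real<..}))"
  proof (rule P.PiM_eqI[OF I])
    show "sets ?L = sets (Pi\<^sub>M I (\<lambda>_. density lborel (indicator {0::real<..})))"
      by (simp cong: sets_PiM_cong)
    fix A :: "'a \<Rightarrow> real set"
    assume "\<And>i. i \<in> I \<Longrightarrow> A i \<in> sets (density lborel (indicator {0<..}))"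
    then have A[measurable]: "\<And>i. i \<in> I \<Longrightarrow> A i \<in> sets borel" by simp
    have "emeasure ?L (Pi\<^sub>E I A) = (\<integral>\<^sup>+y. (\<Prod>a\<in>I. ennreal (exp (y a))) * indicator (Pi\<^sub>E I A) (\<lambda>a\<in>I. exp (y a)) \<partial>Pi\<^sub>M I (\<lambda>_. lborel))"
    proof -
      have S[measurable]: "Pi\<^sub>E I A \<in> sets (Pi\<^sub>M I (\<lambda>_. lborel))"
        using I by (intro sets_PiM_I_finite) auto
      have "emeasure ?L (Pi\<^sub>E I A) = (\<integral>\<^sup>+y. indicator (Pi\<^sub>E I A) y \<partial>?L)"
        by simp
      also have "\<dots> = (\<integral>\<^sup>+y. indicator (Pi\<^sub>E I A) (\<lambda>a\<in>I. exp (y a)) \<partial>density (Pi\<^sub>M I (\<lambda>_. lborel)) (\<lambda>y. \<Prod>a\<in>I. ennreal (exp (y a))))"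
        by (subst nn_integral_distr) simp_all
      also have "\<dots> = (\<integral>\<^sup>+y. (\<Prod>a\<in>I. ennreal (exp (y a))) * indicator (Pi\<^sub>E I A) (\<lambda>a\<in>I. exp (y a)) \<partial>Pi\<^sub>M I (\<lambda>_. lborel))"
        by (subst nn_integral_density) simp_all
      finally show ?thesis .
    qed
    also have "\<dots> = (\<integral>\<^sup>+y. (\<Prod>a\<in>I. indicator (A a) (exp (y a)) * ennreal (exp (y a))) \<partial>Pi\<^sub>M I (\<lambda>_. lborel))"
      by (rule nn_integral_cong) (use I in \<open>auto simp: prod.distrib indicator_def PiE_iff prod_eq_1_iff\<close>)
    also have "\<dots> = (\<Prod>a\<in>I. emeasure (density lborel (indicator {0<..})) (A a))"
      by (subst lborel_prod.product_nn_integral_prod[OF I]) (auto simp: em intro!: prod.cong)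
    finally show "emeasure ?L (Pi\<^sub>E I A) = (\<Prod>a\<in>I. emeasure (density lborel (indicator {0<..})) (A a))" .
  qed
  also have "\<dots> = ?R"
  proof (rule P.PiM_eqI[OF I, symmetric])
    show "sets ?R = sets (Pi\<^sub>M I (\<lambda>_. density lborel (indicator {0::real<..})))"
      by (simp cong: sets_PiM_cong)
    fix A :: "'a \<Rightarrow> real set"
    assume "\<And>i. i \<in> I \<Longrightarrow> A i \<in> sets (density lborel (indicator {0<..}))"
    then have A[measurable]: "\<And>i. i \<in> I \<Longrightarrow> A i \<in> sets borel" by simp
    have "emeasure ?R (Pi\<^sub>E I A) = (\<integral>\<^sup>+y. (\<Prod>a\<in>I. indicator {0<..} (y a)) * indicator (Pi\<^sub>E I A) y \<partial>Pi\<^sub>M I (\<lambda>_. lborel))"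
      using I by (subst emeasure_density) (auto simp: sets_PiM_I_finite)
    also have "\<dots> = (\<integral>\<^sup>+y. (\<Prod>a\<in>I. indicator {0<..} (y a) * indicator (A a) (y a)) \<partial>Pi\<^sub>M I (\<lambda>_. lborel))"
      by (rule nn_integral_cong) (use I in \<open>auto simp: prod.distrib indicator_def space_PiM PiE_iff\<close>)
    also have "\<dots> = (\<Prod>a\<in>I. emeasure (density lborel (indicator {0<..})) (A a))"
      by (subst lborel_prod.product_nn_integral_prod[OF I]) (auto simp: emeasure_density intro!: prod.cong)
    finally show "emeasure ?R (Pi\<^sub>E I A) = (\<Prod>a\<in>I. emeasure (density lborel (indicator {0<..})) (A a))" .
  qed
  finally show ?thesis .
qed

text \<open>By \<open>dep\<close> the function \<open>g a\<close> sees only coordinates of rank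
  below \<open>r a\<close>. A coordinate of maximal rank therefore occurs in no \<open>g a\<close>
  and can be integrated first; there the map is affine with slope of modulus 1, which preserves
  Lebesgue measure.\<close>

lemma distr_triangular_shear:
  fixes \<sigma> :: "'i \<Rightarrow> real" and g :: "'i \<Rightarrow> ('i \<Rightarrow> real) \<Rightarrow> real" and r :: "'i \<Rightarrow> nat"
  assumes I: "finite I"
    and \<sigma>: "\<And>a. a \<in> I \<Longrightarrow> \<bar>\<sigma> a\<bar> = 1"
    and g: "\<And>a. a \<in> I \<Longrightarrow> g a \<in> borel_measurable (Pi\<^sub>M I (\<lambda>_. lborel))"
    and dep: "\<And>a b y v. a \<in> I \<Longrightarrow> b \<in> I \<Longrightarrow> r a \<le> r b \<Longrightarrow> g a (y(b := v)) = g a y"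
  shows "distr (Pi\<^sub>M I (\<lambda>_. lborel)) (Pi\<^sub>M I (\<lambda>_. lborel)) (\<lambda>y. \<lambda>a\<in>I. \<sigma> a * y a + g a y)
       = Pi\<^sub>M I (\<lambda>_. lborel)"
proof -
  have "(\<integral>\<^sup>+y. f (\<lambda>a\<in>I. \<sigma> a * y a + g a y) \<partial>Pi\<^sub>M I (\<lambda>_. lborel)) = (\<integral>\<^sup>+y. f y \<partial>Pi\<^sub>M I (\<lambda>_. lborel))"
    if "f \<in> borel_measurable (Pi\<^sub>M I (\<lambda>_. lborel))" for f
    using I \<sigma> g dep that
  proof (induction I arbitrary: f rule: finite_ranking_induct[where f = r])
    case empty
    then show ?case by (simp add: PiM_empty nn_integral_count_space_finite)
  next
    case (insert x S)
    show ?case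
    proof (cases "x \<in> S")
      case True
      then have "insert x S = S" by auto
      then show ?thesis using insert.IH[of f] insert.prems by auto
    next
      case False
      note f[measurable] = insert.prems(4)
      have [measurable]: "g a \<in> borel_measurable (Pi\<^sub>M (insert x S) (\<lambda>_. lborel))" if "a \<in> insert x S" for a
        using insert.prems(2) that .
      have gx: "g a (y(x := v)) = g a y" if "a \<in> insert x S" for a y v
        by (rule insert.prems(3)) (use insert.hyps(2) that in auto)
      \<comment> \<open>The functions \<open>g a\<close> ignore the coordinate \<open>x\<close>;
        filling in 0 there transports their measurability to the smaller product.\<close>
      have upd: "(\<lambda>y. y(x := 0)) \<in> measurable (Pi\<^sub>M S (\<lambda>_. lborel)) (Pi\<^sub>M (insert x S) (\<lambda>_. lborel :: real measure))"
        by (rule measurable_compose[OF _ measurable_add_dim, where f="\<lambda>y. (y, 0)", simplified]) simp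
      have gS: "g a \<in> borel_measurable (Pi\<^sub>M S (\<lambda>_. lborel))" if "a \<in> insert x S" for a
        using measurable_compose[OF upd insert.prems(2)[OF that]] unfolding gx[OF that] .
      let ?T = "\<lambda>J y. \<lambda>a\<in>J. \<sigma> a * y a + g a y"
      have T: "?T (insert x S) (y(x := z)) = (?T S y)(x := \<sigma> x * z + g x y)" for y z
        using False by (auto simp: fun_eq_iff gx)
      have [measurable]: "?T S \<in> measurable (Pi\<^sub>M S (\<lambda>_. lborel)) (Pi\<^sub>M S (\<lambda>_. lborel))"
        using gS by (auto intro!: measurable_restrict borel_measurable_add borel_measurable_times
          measurable_component_singleton[THEN measurable_compose])
      have [measurable]: "?T (insert x S) \<in> measurable (Pi\<^sub>M (insert x S) (\<lambda>_. lborel)) (Pi\<^sub>M (insert x S) (\<lambda>_. lborel))"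
        by (intro measurable_restrict) measurable
      have inner: "(\<integral>\<^sup>+z. f (y(x := \<sigma> x * z + c)) \<partial>lborel) = (\<integral>\<^sup>+z. f (y(x := z)) \<partial>lborel)"
        if y: "y \<in> space (Pi\<^sub>M S (\<lambda>_. lborel))" for y :: "'i \<Rightarrow> real" and c
      proof -
        have m: "(\<lambda>z. f (y(x := z))) \<in> borel_measurable borel"
          using measurable_comp[OF measurable_component_update f, OF y False]
          unfolding comp_def measurable_lborel2 .
        have "\<sigma> x \<noteq> 0" using insert.prems(1)[of x] by auto
        from nn_integral_real_affine[OF m this, of c] show ?thesis
          using insert.prems(1)[of x] by (simp add: add.commute)
      qed
      have hm: "(\<lambda>y. \<integral>\<^sup>+z. f (y(x := z)) \<partial>lborel) \<in> borel_measurable (Pi\<^sub>M S (\<lambda>_. lborel))"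
        using measurable_compose[OF measurable_add_dim f] 
        by (intro lborel.borel_measurable_nn_integral) (simp add: case_prod_beta')
      have "(\<integral>\<^sup>+y. f (?T (insert x S) y) \<partial>Pi\<^sub>M (insert x S) (\<lambda>_. lborel))
          = (\<integral>\<^sup>+y. \<integral>\<^sup>+z. f ((?T S y)(x := \<sigma> x * z + g x y)) \<partial>lborel \<partial>Pi\<^sub>M S (\<lambda>_. lborel))"
        using insert.hyps(1) False
        by (subst lborel_prod.product_nn_integral_insert) (simp_all only: T, measurable)
      also have "\<dots> = (\<integral>\<^sup>+y. (\<integral>\<^sup>+z. f ((?T S y)(x := z)) \<partial>lborel) \<partial>Pi\<^sub>M S (\<lambda>_. lborel))"
        by (intro nn_integral_cong inner) (auto simp: space_PiM)
      also have "\<dots> = (\<integral>\<^sup>+y. (\<integral>\<^sup>+z. f (y(x := z)) \<partial>lborel) \<partial>Pi\<^sub>M S (\<lambda>_. lborel))"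
        by (rule insert.IH[OF insert.prems(1) gS insert.prems(3) hm]) simp_all
      also have "\<dots> = (\<integral>\<^sup>+y. f y \<partial>Pi\<^sub>M (insert x S) (\<lambda>_. lborel))"
        using insert.hyps(1) False by (subst lborel_prod.product_nn_integral_insert) simp_all
      finally show ?thesis .
    qed
  qed
  note nn = this
  have m: "(\<lambda>y. \<lambda>a\<in>I. \<sigma> a * y a + g a y) \<in> measurable (Pi\<^sub>M I (\<lambda>_. lborel)) (Pi\<^sub>M I (\<lambda>_. lborel))"
    using g by (auto intro!: measurable_restrict borel_measurable_add borel_measurable_times
      measurable_component_singleton[THEN measurable_compose])
  show ?thesis
  proof (rule measure_eqI)
    fix A assume "A \<in> sets (distr (Pi\<^sub>M I (\<lambda>_. lborel)) (Pi\<^sub>M I (\<lambda>_. lborel)) (\<lambda>y. \<lambda>a\<in>I. \<sigma> a * y a + g a y))"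
    then have A: "A \<in> sets (Pi\<^sub>M I (\<lambda>_. lborel))" by simp
    show "emeasure (distr (Pi\<^sub>M I (\<lambda>_. lborel)) (Pi\<^sub>M I (\<lambda>_. lborel)) (\<lambda>y. \<lambda>a\<in>I. \<sigma> a * y a + g a y)) A
        = emeasure (Pi\<^sub>M I (\<lambda>_. lborel)) A"
    proof -
      have "emeasure (distr (Pi\<^sub>M I (\<lambda>_. lborel)) (Pi\<^sub>M I (\<lambda>_. lborel)) (\<lambda>y. \<lambda>a\<in>I. \<sigma> a * y a + g a y)) A
          = (\<integral>\<^sup>+y. indicator A y \<partial>distr (Pi\<^sub>M I (\<lambda>_. lborel)) (Pi\<^sub>M I (\<lambda>_. lborel)) (\<lambda>y. \<lambda>a\<in>I. \<sigma> a * y a + g a y))"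
        using A by simp
      also have "\<dots> = (\<integral>\<^sup>+y. indicator A y \<partial>Pi\<^sub>M I (\<lambda>_. lborel))"
        using A by (simp add: nn_integral_distr[OF m] nn del: nn_integral_indicator)
      finally show ?thesis using A by simp
    qed
  qed simp
qed

section \<open>Gamma integrals over the real line and decay on vertical lines\<close>

lemma distr_exp_lborel:
  "distr (density lborel (\<lambda>x. ennreal (exp x))) borel exp
     = density lborel (\<lambda>x. ennreal (indicator {0::real<..} x))" (is "?L = ?R")
proof (rule measure_eqI)
  fix A assume "A \<in> sets ?L"
  then have A[measurable]: "A \<in> sets borel" by simp
  have "emeasure ?L A = (\<integral>\<^sup>+x. indicator A x \<partial>?L)" by simp
  also have "\<dots> = (\<integral>\<^sup>+x. indicator A (exp x) * ennreal (exp x) \<partial>lborel)"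
    by (simp add: nn_integral_distr nn_integral_density mult.commute del: nn_integral_indicator)
  also have "\<dots> = (\<integral>\<^sup>+x. indicator A x * indicator {0<..} x \<partial>lborel)"
    by (rule nn_integral_exp_substitution[symmetric]) simp
  also have "\<dots> = emeasure ?R A"
    by (simp add: emeasure_density mult.commute ennreal_indicator)
  finally show "emeasure ?L A = emeasure ?R A" .
qed simp

text \<open>Euler's integral after t = exp x. In this form powers of t become exponentials linear in
  x, so that products of such integrands can be regrouped by a linear identity between
  exponents.\<close>

lemma Gamma_log_integral:
  fixes z :: complex
  assumes z: "0 < Re z"
  shows "integrable lborel (\<lambda>x. exp (z * of_real x) * of_real (exp (- exp x)))" (is ?A)
    and "(LINT x|lborel. exp (z * of_real x) * of_real (exp (- exp x))) = Gamma z" (is ?B)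
proof -
  define h where "h t = indicator {0<..} t *\<^sub>R (complex_of_real t powr (z - 1) / of_real (exp t))" for t :: real
  have h[measurable]: "h \<in> borel_measurable borel"
    unfolding h_def by (intro borel_measurable_continuous_on_indicator continuous_intros) auto
  have ih: "indicator {0<..} t *\<^sub>R h t = h t" for t
    by (simp add: h_def indicator_def)
  have "integrable lebesgue h"
    using absolutely_integrable_Gamma_integral'[OF z] unfolding h_def set_integrable_def .
  then have i: "integrable lborel h"
    by (subst (asm) integrable_completion) simp_all
  have "(h has_integral Gamma z) UNIV"
    using Gamma_integral_complex'[OF z] unfolding h_def
    by (subst (asm) has_integral_restrict_UNIV[symmetric]) (erule has_integral_eq[rotated], simp)
  then have v: "integral\<^sup>L lborel h = Gamma z"
    using has_integral_integral_lborel[OF i] has_integral_unique by blast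
  have eq: "exp x *\<^sub>R h (exp x) = exp (z * of_real x) * of_real (exp (- exp x))" for x
    by (simp add: h_def powr_def scaleR_conv_of_real exp_minus field_simps exp_diff exp_of_real Ln_of_real
         flip: exp_of_real)
  have "integrable (density lborel (\<lambda>x. ennreal (indicator {0<..} x))) h"
    using i by (subst integrable_density) (simp_all add: ih)
  then have "integrable (density lborel (\<lambda>x. ennreal (exp x))) (\<lambda>x. h (exp x))"
    unfolding distr_exp_lborel[symmetric] by (subst (asm) integrable_distr_eq) simp_all
  then show ?A
    by (subst (asm) integrable_density) (simp_all add: eq)
  have "Gamma z = integral\<^sup>L (density lborel (\<lambda>x. ennreal (indicator {0<..} x))) h"
    using v by (subst integral_density) (simp_all add: ih)
  also have "\<dots> = (LINT x|density lborel (\<lambda>x. ennreal (exp x)). h (exp x))"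
    unfolding distr_exp_lborel[symmetric] by (subst integral_distr) simp_all
  also have "\<dots> = (LINT x|lborel. exp x *\<^sub>R h (exp x))"
    by (subst integral_density) simp_all
  finally show ?B by (simp add: eq)
qed

lemma norm_Gamma_integrand:
  "norm (exp (z * of_real x) * of_real (exp (- exp x))) = exp (Re z * x) * exp (- exp x)" for z :: complex
  by (simp add: norm_mult)

lemma Gamma_log_integral_real:
  fixes c :: real
  assumes c: "0 < c"
  shows "integrable lborel (\<lambda>x. exp (c * x) * exp (- exp x))"
    and "(LINT x|lborel. exp (c * x) * exp (- exp x)) = Gamma c"
proof -
  have eq: "exp (of_real c * of_real x) * of_real (exp (- exp x)) = complex_of_real (exp (c * x) * exp (- exp x))" for x
    by (simp flip: exp_of_real)
  have i: "integrable lborel (\<lambda>x. complex_of_real (exp (c * x) * exp (- exp x)))"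
    using Gamma_log_integral(1)[of "of_real c"] c by (simp only: eq Re_complex_of_real)
  then show "integrable lborel (\<lambda>x. exp (c * x) * exp (- exp x))"
    by (simp only: complex_of_real_integrable_eq)
  have "complex_of_real (LINT x|lborel. exp (c * x) * exp (- exp x)) = of_real (Gamma c)"
    using Gamma_log_integral(2)[of "of_real c"] c
    by (simp only: eq Re_complex_of_real integral_complex_of_real Gamma_complex_of_real)
  then show "(LINT x|lborel. exp (c * x) * exp (- exp x)) = Gamma c" by (simp only: of_real_eq_iff)
qed

lemma norm_Gamma_le:
  fixes z :: complex
  assumes "0 < Re z"
  shows "norm (Gamma z) \<le> Gamma (Re z)"
proof -
  have "norm (Gamma z) \<le> (LINT x|lborel. norm (exp (z * of_real x) * complex_of_real (exp (- exp x))))"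
    unfolding Gamma_log_integral(2)[OF assms, symmetric] by (rule integral_norm_bound)
  then show ?thesis
    by (simp only: norm_Gamma_integrand Gamma_log_integral_real(2)[OF assms])
qed

text \<open>The functional equation used twice gives z (z + 1) Gamma z = Gamma (z + 2), and the
  right side is bounded on the line by its value on the real axis. The resulting quadratic decay is
  enough for integrability.\<close>

lemma integrable_Gamma_vertical:
  fixes c :: real
  assumes c: "0 < c"
  shows "integrable lborel (\<lambda>y. Gamma (Complex c y))"
proof (rule Bochner_Integration.integrable_bound)
  \<comment> \<open>From |z + 1| >= |z| and |z|^2 = c^2 + y^2 >= min (c^2) 1 * (1 + y^2).\<close>
  define K where "K = Gamma (c + 2) / min (c\<^sup>2) 1"
  show "integrable lborel (\<lambda>y. K * inverse (1 + y\<^sup>2))"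
    using integrable_inverse_1_plus_square by (simp add: set_integrable_def)
  have "continuous_on UNIV (\<lambda>y. Gamma (Complex c y))"
    unfolding Complex_eq using c
    by (intro continuous_on_compose2[OF continuous_on_Gamma[of "{z. 0 < Re z}"]] continuous_intros)
       (auto elim!: nonpos_Ints_cases)
  then show "(\<lambda>y. Gamma (Complex c y)) \<in> borel_measurable lborel"
    by (simp add: borel_measurable_continuous_onI)
  show "AE y in lborel. norm (Gamma (Complex c y)) \<le> norm (K * inverse (1 + y\<^sup>2))"
  proof (rule AE_I2)
    fix y
    define z where "z = Complex c y"
    have z: "z \<noteq> 0" "z + 1 \<noteq> 0" "Re z = c" using c by (auto simp: z_def complex_eq_iff)
    have "z * ((z + 1) * Gamma z) = Gamma (z + 2)"
    proof -
      have "z \<notin> \<int>\<^sub>\<le>\<^sub>0" "z + 1 \<notin> \<int>\<^sub>\<le>\<^sub>0" using z c by (auto elim!: nonpos_Ints_cases simp: complex_eq_iff)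
      then have "Gamma (z + 1) = z * Gamma z" "Gamma (z + 1 + 1) = (z + 1) * Gamma (z + 1)"
        using Gamma_plus1[of z] Gamma_plus1[of "z + 1"] z by simp_all
      then show ?thesis by (simp add: add.assoc mult_ac)
    qed
    then have "norm z * norm (z + 1) * norm (Gamma z) = norm (Gamma (z + 2))"
      by (metis mult.assoc norm_mult)
    also have "\<dots> \<le> Gamma (c + 2)" using norm_Gamma_le[of "z + 2"] c z by simp
    finally have 1: "norm z * norm (z + 1) * norm (Gamma z) \<le> Gamma (c + 2)" .
    have "min (c\<^sup>2) 1 * (1 + y\<^sup>2) = min (c\<^sup>2) 1 + min (c\<^sup>2) 1 * y\<^sup>2" by (simp add: algebra_simps)
    also have "\<dots> \<le> c\<^sup>2 + 1 * y\<^sup>2" by (intro add_mono mult_right_mono) auto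
    also have "\<dots> = norm z * norm z" by (simp add: z_def norm_complex_def)
    also have "\<dots> \<le> norm z * norm (z + 1)"
    proof (rule mult_left_mono)
      show "norm z \<le> norm (z + 1)"
        unfolding norm_complex_def using c by (auto simp: z_def intro!: power_mono)
    qed simp
    finally have "min (c\<^sup>2) 1 * (1 + y\<^sup>2) * norm (Gamma z) \<le> Gamma (c + 2)"
      using 1 by (meson mult_right_mono norm_ge_zero order_trans)
    moreover have "0 < min (c\<^sup>2) 1" using c by simp
    moreover have "0 < 1 + y\<^sup>2" by (simp add: add_pos_nonneg)
    ultimately have "norm (Gamma z) \<le> Gamma (c + 2) / (min (c\<^sup>2) 1 * (1 + y\<^sup>2))"
      by (subst pos_le_divide_eq) (simp_all only: mult_pos_pos mult.commute)
    then have "norm (Gamma z) \<le> K * inverse (1 + y\<^sup>2)"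
      by (simp add: K_def divide_inverse)
    then show "norm (Gamma (Complex c y)) \<le> norm (K * inverse (1 + y\<^sup>2))"
      unfolding z_def by (metis abs_ge_self order_trans real_norm_def)
  qed
qed

section \<open>Fourier inversion and the Mellin transform of the exponential\<close>

lemma gaussian_char:
  fixes t \<epsilon> :: real
  assumes \<epsilon>: "0 < \<epsilon>"
  shows "(LINT y|lborel. iexp (y * t) * of_real (exp (- ((\<epsilon> * y)\<^sup>2 / 2))))
       = of_real (2 * pi * (1 / \<epsilon>) * std_normal_density (t / \<epsilon>))"
proof -
  have "char std_normal_distribution (t / \<epsilon>) = (LINT w|lborel. std_normal_density w *\<^sub>R iexp (t / \<epsilon> * w))"
    unfolding char_def by (subst integral_density) (auto simp: normal_density_nonneg)
  also have "\<dots> = \<epsilon> *\<^sub>R (LINT y|lborel. std_normal_density (0 + \<epsilon> * y) *\<^sub>R iexp (t / \<epsilon> * (0 + \<epsilon> * y)))"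
    using lborel_integral_real_affine[of \<epsilon> "\<lambda>w. std_normal_density w *\<^sub>R iexp (t / \<epsilon> * w)" 0] \<epsilon> by simp
  also have "\<dots> = of_real (\<epsilon> / sqrt (2 * pi)) * (LINT y|lborel. iexp (y * t) * of_real (exp (- ((\<epsilon> * y)\<^sup>2 / 2))))"
    using \<epsilon> by (subst integral_mult_right_zero[symmetric], subst integral_scaleR_right[symmetric])
       (auto simp: std_normal_density_def scaleR_conv_of_real mult_ac intro!: Bochner_Integration.integral_cong)
  finally have "of_real (\<epsilon> / sqrt (2 * pi)) * (LINT y|lborel. iexp (y * t) * of_real (exp (- ((\<epsilon> * y)\<^sup>2 / 2))))
      = complex_of_real (exp (- (t / \<epsilon>)\<^sup>2 / 2))"
    unfolding char_std_normal_distribution by simp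
  then have "(LINT y|lborel. iexp (y * t) * of_real (exp (- ((\<epsilon> * y)\<^sup>2 / 2))))
      = complex_of_real (exp (- (t / \<epsilon>)\<^sup>2 / 2) * (sqrt (2 * pi) / \<epsilon>))"
    using \<epsilon> by (simp add: field_simps)
  also have "exp (- (t / \<epsilon>)\<^sup>2 / 2) * (sqrt (2 * pi) / \<epsilon>) = 2 * pi * (1 / \<epsilon>) * std_normal_density (t / \<epsilon>)"
  proof -
    have "sqrt (2 * pi) = 2 * pi / sqrt (2 * pi)" by (subst real_div_sqrt) simp_all
    then have "exp (- (t / \<epsilon>)\<^sup>2 / 2) * (sqrt (2 * pi) / \<epsilon>) = exp (- (t / \<epsilon>)\<^sup>2 / 2) * (2 * pi / sqrt (2 * pi) / \<epsilon>)"
      by (simp only:)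
    then show ?thesis by (simp add: std_normal_density_def mult.commute)
  qed
  finally show ?thesis .
qed

lemma integrable_gaussian:
  fixes \<epsilon> :: real
  assumes \<epsilon>: "0 < \<epsilon>"
  shows "integrable lborel (\<lambda>y. exp (- ((\<epsilon> * y)\<^sup>2 / 2)))"
proof -
  have "integrable lborel (\<lambda>y. std_normal_density (0 + \<epsilon> * y))"
    using \<epsilon> by (intro lborel_integrable_real_affine) auto
  then have "integrable lborel (\<lambda>y. sqrt (2 * pi) * std_normal_density (0 + \<epsilon> * y))"
    by simp
  then show ?thesis by (simp add: std_normal_density_def)
qed

text \<open>The Gaussian factor makes the double integral absolutely convergent, so Fubini applies
  before anything is known about the integrability of \<open>F\<close>. The inner integral is then
  \<open>gaussian_char\<close>, and z = x + epsilon u turns the result into an average of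
  \<open>f\<close> around \<open>x\<close>.\<close>

lemma Fourier_gauss_smoothing:
  fixes f :: "real \<Rightarrow> complex" and \<epsilon> x :: real
  assumes f: "integrable lborel f" and \<epsilon>: "0 < \<epsilon>"
    and F: "\<And>y. F y = (LINT z|lborel. f z * iexp (y * z))"
  shows "(LINT y|lborel. F y * iexp (- (y * x)) * of_real (exp (- ((\<epsilon> * y)\<^sup>2 / 2))))
       = 2 * pi * (LINT u|lborel. std_normal_density u *\<^sub>R f (x + \<epsilon> * u))"
proof -
  define G where "G y z = f z * (iexp (y * (z - x)) * of_real (exp (- ((\<epsilon> * y)\<^sup>2 / 2))))" for y z
  have [measurable]: "f \<in> borel_measurable borel" using f by simp
  have nG: "norm (G y z) = norm (f z) * exp (- ((\<epsilon> * y)\<^sup>2 / 2))" for y z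
    by (simp add: G_def norm_mult)
  have "integrable (lborel \<Otimes>\<^sub>M lborel) (\<lambda>(y, z). G y z)"
  proof (rule lborel_pair.Fubini_integrable)
    show "(\<lambda>(y, z). G y z) \<in> borel_measurable (lborel \<Otimes>\<^sub>M lborel)"
      unfolding G_def by measurable
    show "integrable lborel (\<lambda>y. LINT z|lborel. norm (case (y, z) of (y, z) \<Rightarrow> G y z))"
      using integrable_gaussian[OF \<epsilon>] by (simp add: nG)
    have "integrable lborel (\<lambda>z. G y z)" for y
    proof (rule Bochner_Integration.integrable_bound[OF f])
      show "G y \<in> borel_measurable lborel" unfolding G_def by measurable
    qed (auto simp: nG intro!: mult_left_le)
    then show "AE y in lborel. integrable lborel (\<lambda>z. case (y, z) of (y, z) \<Rightarrow> G y z)" by simp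
  qed
  then have Fub: "(LINT z|lborel. LINT y|lborel. G y z) = (LINT y|lborel. LINT z|lborel. G y z)"
    by (rule lborel_pair.Fubini_integral)
  have "F y * iexp (- (y * x)) * of_real (exp (- ((\<epsilon> * y)\<^sup>2 / 2))) = (LINT z|lborel. G y z)" for y
  proof -
    have "(LINT z|lborel. G y z) = (LINT z|lborel. f z * iexp (y * z) * (iexp (- (y * x)) * of_real (exp (- ((\<epsilon> * y)\<^sup>2 / 2)))))"
      by (rule Bochner_Integration.integral_cong) (auto simp: G_def right_diff_distrib exp_diff exp_minus field_simps)
    also have "\<dots> = (LINT z|lborel. f z * iexp (y * z)) * (iexp (- (y * x)) * of_real (exp (- ((\<epsilon> * y)\<^sup>2 / 2))))"
      by (rule integral_mult_left_zero)
    finally show ?thesis unfolding F by (simp only: mult.assoc)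
  qed
  then have "(LINT y|lborel. F y * iexp (- (y * x)) * of_real (exp (- ((\<epsilon> * y)\<^sup>2 / 2))))
      = (LINT z|lborel. LINT y|lborel. G y z)" by (simp add: Fub)
  also have "\<dots> = (LINT z|lborel. f z * of_real (2 * pi * (1 / \<epsilon>) * std_normal_density ((z - x) / \<epsilon>)))"
    by (intro Bochner_Integration.integral_cong refl)
       (simp only: G_def integral_mult_right_zero gaussian_char[OF \<epsilon>])
  also have "\<dots> = \<epsilon> *\<^sub>R (LINT u|lborel. f (x + \<epsilon> * u) * of_real (2 * pi * (1 / \<epsilon>) * std_normal_density ((x + \<epsilon> * u - x) / \<epsilon>)))"
    using lborel_integral_real_affine[of \<epsilon> "\<lambda>z. f z * of_real (2 * pi * (1 / \<epsilon>) * std_normal_density ((z - x) / \<epsilon>))" x] \<epsilon>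
    by simp
  also have "\<dots> = (LINT u|lborel. 2 * pi * (std_normal_density u *\<^sub>R f (x + \<epsilon> * u)))"
    using \<epsilon> by (subst integral_scaleR_right[symmetric], intro Bochner_Integration.integral_cong refl)
       (simp add: scaleR_conv_of_real)
  also have "\<dots> = 2 * pi * (LINT u|lborel. std_normal_density u *\<^sub>R f (x + \<epsilon> * u))"
    by (rule integral_mult_right_zero)
  finally show ?thesis .
qed

text \<open>Both sides of the smoothed identity converge by dominated convergence as the width tends
  to 0: the left under |F|, the right under \<open>B\<close> times the normal density.\<close>

lemma Fourier_inversion:
  fixes f :: "real \<Rightarrow> complex"
  assumes f: "integrable lborel f" and cont: "continuous_on UNIV f" and bdd: "\<And>x. norm (f x) \<le> B"
    and F: "\<And>y. F y = (LINT z|lborel. f z * iexp (y * z))"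
    and Fi: "integrable lborel F"
  shows "(LINT y|lborel. F y * iexp (- (y * x))) = 2 * pi * f x"
proof (rule LIMSEQ_unique)
  define \<epsilon> where "\<epsilon> k = 1 / real (Suc k)" for k
  have \<epsilon>: "0 < \<epsilon> k" for k by (simp add: \<epsilon>_def)
  have \<epsilon>0: "\<epsilon> \<longlonglongrightarrow> 0" unfolding \<epsilon>_def by (rule LIMSEQ_Suc[OF lim_1_over_n])
  have [measurable]: "f \<in> borel_measurable borel" "F \<in> borel_measurable borel" using f Fi by simp_all
  let ?L = "\<lambda>k. LINT y|lborel. F y * iexp (- (y * x)) * of_real (exp (- ((\<epsilon> k * y)\<^sup>2 / 2)))"
  show "?L \<longlonglongrightarrow> (LINT y|lborel. F y * iexp (- (y * x)))"
  proof (rule integral_dominated_convergence[where w = "\<lambda>y. norm (F y)"])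
    show "integrable lborel (\<lambda>y. norm (F y))" using Fi by simp
    have "(\<lambda>k. F y * iexp (- (y * x)) * of_real (exp (- ((\<epsilon> k * y)\<^sup>2 / 2))))
      \<longlonglongrightarrow> F y * iexp (- (y * x)) * of_real (exp (- ((0 * y)\<^sup>2 / 2)))" for y
      by (intro tendsto_intros \<epsilon>0)  simp
    then show "AE y in lborel. (\<lambda>k. F y * iexp (- (y * x)) * of_real (exp (- ((\<epsilon> k * y)\<^sup>2 / 2))))
      \<longlonglongrightarrow> F y * iexp (- (y * x))" by simp
    show "AE y in lborel. norm (F y * iexp (- (y * x)) * of_real (exp (- ((\<epsilon> k * y)\<^sup>2 / 2)))) \<le> norm (F y)" for k
      by (auto simp: norm_mult intro!: mult_left_le)
  qed measurable
  have "(\<lambda>k. LINT u|lborel. std_normal_density u *\<^sub>R f (x + \<epsilon> k * u)) \<longlonglongrightarrow> (LINT u|lborel. std_normal_density u *\<^sub>R f x)"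
  proof (rule integral_dominated_convergence[where w = "\<lambda>u. std_normal_density u * B"])
    show "integrable lborel (\<lambda>u. std_normal_density u * B)" by simp
    have "(\<lambda>k. std_normal_density u *\<^sub>R f (x + \<epsilon> k * u)) \<longlonglongrightarrow> std_normal_density u *\<^sub>R f (x + 0 * u)" for u
      by (intro tendsto_scaleR tendsto_const continuous_on_tendsto_compose[OF cont] tendsto_add tendsto_mult \<epsilon>0) auto
    then show "AE u in lborel. (\<lambda>k. std_normal_density u *\<^sub>R f (x + \<epsilon> k * u)) \<longlonglongrightarrow> std_normal_density u *\<^sub>R f x"
      by simp
    show "AE u in lborel. norm (std_normal_density u *\<^sub>R f (x + \<epsilon> k * u)) \<le> std_normal_density u * B" for k
      using bdd by (auto intro!: mult_left_mono)
  qed measurable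
  then have "(\<lambda>k. 2 * pi * (LINT u|lborel. std_normal_density u *\<^sub>R f (x + \<epsilon> k * u))) \<longlonglongrightarrow> 2 * pi * f x"
    by (intro tendsto_mult tendsto_const) (simp add: integral_scaleR_left)
  then show "?L \<longlonglongrightarrow> 2 * pi * f x"
    by (simp only: Fourier_gauss_smoothing[OF f \<epsilon> F])
qed

text \<open>Fourier inversion for x -> exp (c x - exp x), whose transform is Gamma on the line Re =
  c; multiplying by exp (- c theta) restores the full exponent.\<close>

lemma Mellin_inversion_exp:
  fixes c \<theta> :: real
  assumes c: "0 < c"
  shows "(LINT y|lborel. Gamma (Complex c y) * exp (- (Complex c y * of_real \<theta>)))
       = 2 * pi * of_real (exp (- exp \<theta>))"
proof -
  let ?f = "\<lambda>x. complex_of_real (exp (c * x) * exp (- exp x))"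
  have eq: "exp (Complex c y * of_real x) * of_real (exp (- exp x)) = ?f x * iexp (y * x)" for x y
    by (simp add: Complex_eq algebra_simps exp_add flip: exp_of_real)
  have "(LINT y|lborel. Gamma (Complex c y) * iexp (- (y * \<theta>))) = 2 * pi * ?f \<theta>"
  proof (rule Fourier_inversion)
    show "integrable lborel ?f"
      using Gamma_log_integral_real(1)[OF c] by (simp only: complex_of_real_integrable_eq)
    show "continuous_on UNIV ?f" by (intro continuous_intros)
    \<comment> \<open>The exponent c x - exp x is largest at x = ln c; the bound comes from the
      tangent inequality for \<open>exp\<close> at x - ln c.\<close>
    show "norm (?f x) \<le> exp (c * ln c - c)" for x
    proof -
      have "1 + (x - ln c) \<le> exp (x - ln c)" by (rule exp_ge_add_one_self)
      then have "c * (1 + (x - ln c)) \<le> c * exp (x - ln c)" using c by simp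
      also have "c * exp (x - ln c) = exp x" using c by (simp add: exp_diff)
      finally have "c * x - exp x \<le> c * ln c - c" by (simp add: algebra_simps)
      then show ?thesis by (simp flip: exp_add)
    qed
    show "Gamma (Complex c y) = (LINT x|lborel. ?f x * iexp (y * x))" for y
      using Gamma_log_integral(2)[of "Complex c y"] c by (simp only: eq) simp
    show "integrable lborel (\<lambda>y. Gamma (Complex c y))" by (rule integrable_Gamma_vertical[OF c])
  qed
  then have "(LINT y|lborel. Gamma (Complex c y) * iexp (- (y * \<theta>))) * exp (- (c * \<theta>)) = 2 * pi * ?f \<theta> * exp (- (c * \<theta>))"
    by simp
  moreover have "(LINT y|lborel. Gamma (Complex c y) * iexp (- (y * \<theta>))) * exp (- (c * \<theta>))
     = (LINT y|lborel. Gamma (Complex c y) * exp (- (Complex c y * of_real \<theta>)))"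
    by (subst integral_mult_left_zero[symmetric])
       (auto intro!: Bochner_Integration.integral_cong simp: Complex_eq algebra_simps exp_add exp_diff exp_minus field_simps simp flip: exp_of_real)
  ultimately show ?thesis by (simp add: exp_minus field_simps)
qed

text \<open>The joint integrand \<open>G\<close> can be read in two ways. For fixed tau it is a
  product over \<open>a\<close> of functions of \<open>S y a\<close>, and Mellin inversion gives
  back the factors exp (- exp ...). By \<open>dual\<close>, for fixed y it is a product over
  \<open>b\<close> of functions of \<open>B \<tau> b\<close>, whose integrals are Gamma values.
  Since \<open>S\<close> and \<open>B\<close> preserve the measure, each inner integral is a product
  of one-dimensional ones.\<close>

lemma Mellin_Parseval:
  fixes I :: "'i set" and \<kappa> \<theta> \<epsilon> :: "'i \<Rightarrow> real" and L :: "('i \<Rightarrow> real) \<Rightarrow> real"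
    and S B :: "('i \<Rightarrow> real) \<Rightarrow> 'i \<Rightarrow> real" and z :: "'i \<Rightarrow> ('i \<Rightarrow> real) \<Rightarrow> complex"
  defines "N \<equiv> Pi\<^sub>M I (\<lambda>_. lborel :: real measure)"
    and "U \<equiv> \<lambda>a y. Complex (\<kappa> a) (S y a)"
  assumes I: "finite I"
    and S: "S \<in> measurable N N" "distr N N S = N"
    and B: "B \<in> measurable N N" "distr N N B = N"
    and L[measurable]: "L \<in> borel_measurable N"
    and z[measurable]: "\<And>b. b \<in> I \<Longrightarrow> z b \<in> borel_measurable N"
    and \<kappa>: "\<And>a. a \<in> I \<Longrightarrow> 0 < \<kappa> a"
    and \<theta>: "\<And>b. b \<in> I \<Longrightarrow> 0 < \<theta> b"
    and Rez: "\<And>b y. b \<in> I \<Longrightarrow> Re (z b y) = \<theta> b"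
    and dual: "\<And>\<tau> y. (\<Sum>a\<in>I. U a y * of_real (\<tau> a)) + \<i> * of_real (L \<tau>) = - (\<Sum>b\<in>I. z b y * of_real (B \<tau> b))"
  shows "integrable N (\<lambda>\<tau>. exp (- \<i> * of_real (L \<tau>)) * of_real ((\<Prod>b\<in>I. exp (- exp (B \<tau> b))) * (\<Prod>a\<in>I. exp (- exp (\<tau> a + \<epsilon> a)))))"
      (is "integrable N ?P")
    and "integrable N (\<lambda>y. (\<Prod>a\<in>I. exp (- (U a y * of_real (\<epsilon> a))) * Gamma (U a y)) * (\<Prod>b\<in>I. Gamma (z b y)))"
      (is "integrable N ?Q")
    and "(2 * pi) ^ card I * (LINT \<tau>|N. exp (- \<i> * of_real (L \<tau>)) * of_real ((\<Prod>b\<in>I. exp (- exp (B \<tau> b))) * (\<Prod>a\<in>I. exp (- exp (\<tau> a + \<epsilon> a)))))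
       = (LINT y|N. (\<Prod>a\<in>I. exp (- (U a y * of_real (\<epsilon> a))) * Gamma (U a y)) * (\<Prod>b\<in>I. Gamma (z b y)))"
proof -
  interpret N: sigma_finite_measure N
    unfolding N_def using I lborel_prod.sigma_finite by blast
  interpret NN: pair_sigma_finite N N ..
  note S(1)[measurable] B(1)[measurable]
  have cmp[measurable]: "(\<lambda>y. y a) \<in> borel_measurable N" if "a \<in> I" for a
    using that unfolding N_def by measurable
  have Gm[measurable]: "(\<lambda>s. Gamma (Complex (\<kappa> a) s)) \<in> borel_measurable borel" if "a \<in> I" for a
    using integrable_Gamma_vertical[OF \<kappa>[OF that]] by simp
  have Cm[measurable]: "(\<lambda>s. Complex c s) \<in> borel_measurable borel" for c
    unfolding Complex_eq by measurable
  have Sm[measurable]: "(\<lambda>y. S y a) \<in> borel_measurable N" and Bm[measurable]: "(\<lambda>y. B y a) \<in> borel_measurable N"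
    if "a \<in> I" for a
    using measurable_compose[OF S(1) cmp[OF that]] measurable_compose[OF B(1) cmp[OF that]] by simp_all
  \<comment> \<open>The parameter \<open>c\<close> is tau before the exponentials in tau are split
    off, and 0 afterwards.\<close>
  define h where "h c a s = Gamma (Complex (\<kappa> a) s) * exp (- (Complex (\<kappa> a) s * of_real (c a + \<epsilon> a)))" for c :: "'i \<Rightarrow> real" and a s
  define k where "k w x = exp (w * of_real x) * complex_of_real (exp (- exp x))" for w :: complex and x :: real
  have hm[measurable]: "h c a \<in> borel_measurable borel" if "a \<in> I" for c a
    unfolding h_def using that by measurable
  have km[measurable]: "k w \<in> borel_measurable borel" for w
    unfolding k_def by measurable
  have hi: "integrable lborel (h c a)" if "a \<in> I" for c a
  proof (rule Bochner_Integration.integrable_bound)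
    show "integrable lborel (\<lambda>s. exp (- (\<kappa> a * (c a + \<epsilon> a))) *\<^sub>R Gamma (Complex (\<kappa> a) s))"
      using integrable_Gamma_vertical[OF \<kappa>[OF that]] by simp
    show "h c a \<in> borel_measurable lborel" using that by simp
  qed (auto simp: h_def norm_mult mult.commute)
  have Sint: "integrable N (\<lambda>y. \<Prod>a\<in>I. h c a (S y a))"
    and Sval: "(LINT y|N. (\<Prod>a\<in>I. h c a (S y a))) = (\<Prod>a\<in>I. (LINT s|lborel. h c a s))" for c
  proof -
    have m[measurable]: "(\<lambda>y. \<Prod>a\<in>I. h c a (y a)) \<in> borel_measurable N" by measurable
    have i: "integrable N (\<lambda>y. \<Prod>a\<in>I. h c a (y a))"
      unfolding N_def by (intro lborel_prod.product_integrable_prod I hi)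
    then have "integrable (distr N N S) (\<lambda>y. \<Prod>a\<in>I. h c a (y a))" by (simp only: S(2))
    then show "integrable N (\<lambda>y. \<Prod>a\<in>I. h c a (S y a))"
      by (subst (asm) integrable_distr_eq) simp_all
    have "(LINT y|N. (\<Prod>a\<in>I. h c a (S y a))) = (LINT y|distr N N S. (\<Prod>a\<in>I. h c a (y a)))"
      by (subst integral_distr) simp_all
    also have "\<dots> = (\<Prod>a\<in>I. (LINT s|lborel. h c a s))"
      unfolding S(2) unfolding N_def by (intro lborel_prod.product_integral_prod I hi)
    finally show "(LINT y|N. (\<Prod>a\<in>I. h c a (S y a))) = (\<Prod>a\<in>I. (LINT s|lborel. h c a s))" .
  qed
  have Bint: "integrable N (\<lambda>\<tau>. \<Prod>b\<in>I. k (w b) (B \<tau> b))"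
    and Bval: "(LINT \<tau>|N. (\<Prod>b\<in>I. k (w b) (B \<tau> b))) = (\<Prod>b\<in>I. Gamma (w b))"
    if w: "\<And>b. b \<in> I \<Longrightarrow> 0 < Re (w b)" for w
  proof -
    have m[measurable]: "(\<lambda>y. \<Prod>b\<in>I. k (w b) (y b)) \<in> borel_measurable N" by measurable
    have ki: "integrable lborel (k (w b))" if "b \<in> I" for b
      unfolding k_def by (rule Gamma_log_integral(1)[OF w[OF that]])
    have i: "integrable N (\<lambda>y. \<Prod>b\<in>I. k (w b) (y b))"
      unfolding N_def by (intro lborel_prod.product_integrable_prod I ki)
    then have "integrable (distr N N B) (\<lambda>y. \<Prod>b\<in>I. k (w b) (y b))" by (simp only: B(2))
    then show "integrable N (\<lambda>\<tau>. \<Prod>b\<in>I. k (w b) (B \<tau> b))"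
      by (subst (asm) integrable_distr_eq) simp_all
    have "(LINT \<tau>|N. (\<Prod>b\<in>I. k (w b) (B \<tau> b))) = (LINT \<tau>|distr N N B. (\<Prod>b\<in>I. k (w b) (\<tau> b)))"
      by (subst integral_distr) simp_all
    also have "\<dots> = (\<Prod>b\<in>I. (LINT x|lborel. k (w b) x))"
      unfolding B(2) unfolding N_def by (intro lborel_prod.product_integral_prod I ki)
    also have "\<dots> = (\<Prod>b\<in>I. Gamma (w b))"
      using w by (intro prod.cong refl) (simp only: k_def Gamma_log_integral(2))
    finally show "(LINT \<tau>|N. (\<Prod>b\<in>I. k (w b) (B \<tau> b))) = (\<Prod>b\<in>I. Gamma (w b))" .
  qed
  define G where "G \<tau> y = exp (- \<i> * of_real (L \<tau>)) * of_real (\<Prod>b\<in>I. exp (- exp (B \<tau> b))) * (\<Prod>a\<in>I. h \<tau> a (S y a))" for \<tau> y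
  have G2: "G \<tau> y = (\<Prod>a\<in>I. h (\<lambda>_. 0) a (S y a)) * (\<Prod>b\<in>I. k (z b y) (B \<tau> b))" for \<tau> y
  proof -
    have "(\<Prod>a\<in>I. h \<tau> a (S y a)) = (\<Prod>a\<in>I. h (\<lambda>_. 0) a (S y a) * exp (- (U a y * of_real (\<tau> a))))"
      by (intro prod.cong refl) (simp add: h_def U_def algebra_simps exp_add exp_diff exp_minus field_simps)
    also have "\<dots> = (\<Prod>a\<in>I. h (\<lambda>_. 0) a (S y a)) * exp (- (\<Sum>a\<in>I. U a y * of_real (\<tau> a)))"
      by (simp add: prod.distrib exp_sum[OF I] flip: sum_negf)
    finally have "G \<tau> y = (\<Prod>a\<in>I. h (\<lambda>_. 0) a (S y a)) * of_real (\<Prod>b\<in>I. exp (- exp (B \<tau> b)))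
        * (exp (- \<i> * of_real (L \<tau>)) * exp (- (\<Sum>a\<in>I. U a y * of_real (\<tau> a))))"
      by (simp add: G_def)
    also have "exp (- \<i> * of_real (L \<tau>)) * exp (- (\<Sum>a\<in>I. U a y * of_real (\<tau> a)))
        = exp (\<Sum>b\<in>I. z b y * of_real (B \<tau> b))"
    proof -
      have "- \<i> * of_real (L \<tau>) + - (\<Sum>a\<in>I. U a y * of_real (\<tau> a)) = (\<Sum>b\<in>I. z b y * of_real (B \<tau> b))"
        by (subst minus_minus[symmetric], subst dual[symmetric], simp only: minus_add mult_minus_left)
      then show ?thesis by (simp only: exp_add[symmetric])
    qed
    finally show ?thesis
      by (simp add: k_def prod.distrib exp_sum[OF I] mult_ac)
  qed
  have Gmeas: "(\<lambda>(\<tau>, y). G \<tau> y) \<in> borel_measurable (N \<Otimes>\<^sub>M N)"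
    unfolding G_def h_def by measurable
  \<comment> \<open>Only Re (z b y) = theta b affects the absolute value, so it does not depend on
    y. The two variables thus decouple in the norm of \<open>G\<close>, which is what Fubini
    needs.\<close>
  have nk: "norm (\<Prod>b\<in>I. k (z b y) (B \<tau> b)) = norm (\<Prod>b\<in>I. k (of_real (\<theta> b)) (B \<tau> b))" for y \<tau>
    by (simp add: k_def norm_mult Rez flip: prod_norm)
  have Gint: "integrable (N \<Otimes>\<^sub>M N) (\<lambda>(\<tau>, y). G \<tau> y)"
  proof (rule NN.Fubini_integrable[OF Gmeas])
    have "integrable N (\<lambda>\<tau>. norm (\<Prod>b\<in>I. k (of_real (\<theta> b)) (B \<tau> b)))"
      using Bint[of "\<lambda>b. of_real (\<theta> b)"] \<theta> by (intro integrable_norm) simp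
    then show "integrable N (\<lambda>\<tau>. LINT y|N. norm (case (\<tau>, y) of (\<tau>, y) \<Rightarrow> G \<tau> y))"
      by (simp add: G2 norm_mult nk)
    show "AE \<tau> in N. integrable N (\<lambda>y. case (\<tau>, y) of (\<tau>, y) \<Rightarrow> G \<tau> y)"
      using Sint by (simp add: G_def)
  qed
  have "(LINT s|lborel. h \<tau> a s) = 2 * pi * exp (- exp (\<tau> a + \<epsilon> a))" if "a \<in> I" for \<tau> a
    unfolding h_def using Mellin_inversion_exp[OF \<kappa>[OF that], of "\<tau> a + \<epsilon> a"] by simp
  then have GP: "(LINT y|N. G \<tau> y) = (2 * pi) ^ card I * ?P \<tau>" for \<tau>
    by (simp add: G_def Sval prod.distrib)
  have GQ: "(LINT \<tau>|N. G \<tau> y) = ?Q y" for y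
    using \<theta> Rez by (simp add: G2 Bval h_def U_def mult_ac)
  have "integrable N (\<lambda>\<tau>. LINT y|N. G \<tau> y)"
    using NN.integrable_fst[OF Gint] by simp
  then have "integrable N (\<lambda>\<tau>. inverse ((2 * pi) ^ card I) * ((2 * pi) ^ card I * ?P \<tau>))"
    unfolding GP by (rule integrable_mult_right)
  moreover have "inverse ((2 * pi) ^ card I) * ((2 * pi) ^ card I * p) = p" for p :: complex
    by (subst mult.assoc[symmetric], subst of_real_mult[symmetric], subst left_inverse) simp_all
  ultimately show "integrable N ?P" by (simp only:)
  have "integrable N (\<lambda>y. LINT \<tau>|N. G \<tau> y)"
    using NN.integrable_snd[OF Gint] by simp
  then show "integrable N ?Q" unfolding GQ .
  have "(LINT \<tau>|N. LINT y|N. G \<tau> y) = (LINT y|N. LINT \<tau>|N. G \<tau> y)"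
    using NN.Fubini_integral[OF Gint] by simp
  then show "(2 * pi) ^ card I * (LINT \<tau>|N. ?P \<tau>) = (LINT y|N. ?Q y)"
    by (simp only: GP GQ integral_mult_right_zero)
qed

text \<open>No measurability of \<open>f\<close> is assumed: in the application it is built from
  definite descriptions and is controlled only on the positive orthant. The measurable function
  \<open>F\<close> built from \<open>P\<close> replaces it there.\<close>

lemma positive_orthant_substitution:
  fixes f P :: "('i \<Rightarrow> real) \<Rightarrow> complex" and I :: "'i set"
  defines "N \<equiv> Pi\<^sub>M I (\<lambda>_. lborel :: real measure)"
  assumes I: "finite I" and P: "integrable N P"
    and f: "\<And>t. (\<And>a. a \<in> I \<Longrightarrow> 0 < t a) \<Longrightarrow> of_real (\<Prod>a\<in>I. t a) * f t = P (\<lambda>a\<in>I. ln (t a))"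
  shows "set_integrable N {t. \<forall>a\<in>I. 0 < t a} f"
    and "set_lebesgue_integral N {t. \<forall>a\<in>I. 0 < t a} f = (LINT \<tau>|N. P \<tau>)"
proof -
  define F where "F t = P (\<lambda>a\<in>I. ln (t a)) / of_real (\<Prod>a\<in>I. t a)" for t
  define E where "E y = (\<lambda>a\<in>I. exp (y a))" for y :: "'i \<Rightarrow> real"
  define S where "S = {t. \<forall>a\<in>I. 0 < (t a :: real)}"
  have c[measurable]: "(\<lambda>y. y a) \<in> borel_measurable N" if "a \<in> I" for a
    using that unfolding N_def by measurable
  have [measurable]: "P \<in> borel_measurable N" using P by simp
  have "(\<lambda>t. \<lambda>a\<in>I. ln (t a)) \<in> measurable N N"
    unfolding N_def by (rule measurable_restrict) (use c in \<open>simp add: N_def\<close>)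
  from measurable_compose[OF this, of P borel] have [measurable]: "F \<in> borel_measurable N"
    unfolding F_def by measurable
  have E[measurable]: "E \<in> measurable N N"
    unfolding N_def E_def by (rule measurable_restrict) (use c in \<open>simp add: N_def\<close>)
  have fF: "indicator S t *\<^sub>R f t = indicator S t *\<^sub>R F t" for t
  proof (cases "t \<in> S")
    case True
    then have "\<And>a. a \<in> I \<Longrightarrow> 0 < t a" by (simp add: S_def)
    then have "of_real (\<Prod>a\<in>I. t a) * f t = P (\<lambda>a\<in>I. ln (t a))" "(\<Prod>a\<in>I. t a) \<noteq> 0"
      using f I by (auto simp: less_imp_neq[symmetric])
    then have "f t = F t" by (simp add: F_def field_simps del: of_real_prod)
    then show ?thesis by simp
  qed simp
  have S: "ennreal (indicator S t) = (\<Prod>a\<in>I. indicator {0<..} (t a))" for t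
    using I by (auto simp: S_def indicator_def prod_eq_1_iff)
  have [measurable]: "(\<lambda>t. indicator S t :: real) \<in> borel_measurable N"
  proof -
    have "(\<lambda>t. \<Prod>a\<in>I. indicator {0<..} (t a) :: real) \<in> borel_measurable N" by measurable
    moreover have "indicator S t = (\<Prod>a\<in>I. indicator {0<..} (t a) :: real)" for t
      using I by (auto simp: S_def indicator_def prod_eq_1_iff)
    ultimately show ?thesis by simp
  qed
  have D: "distr (density N (\<lambda>y. ennreal (\<Prod>a\<in>I. exp (y a)))) N E = density N (\<lambda>t. ennreal (indicator S t))"
    using distr_exp_lborel_PiM[OF I] unfolding N_def[symmetric] S E_def by (simp add: prod_ennreal)
  have FE: "(\<Prod>a\<in>I. exp (y a)) *\<^sub>R F (E y) = P y" if "y \<in> space N" for y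
  proof -
    have "(\<lambda>a\<in>I. ln (E y a)) = y"
      using that by (auto simp: N_def space_PiM E_def fun_eq_iff PiE_def extensional_def)
    moreover have "(\<Prod>a\<in>I. E y a) = (\<Prod>a\<in>I. exp (y a))" by (simp add: E_def)
    ultimately show ?thesis using I by (simp add: F_def scaleR_conv_of_real del: of_real_prod)
  qed
  have "integrable N (\<lambda>y. (\<Prod>a\<in>I. exp (y a)) *\<^sub>R F (E y))"
    using P by (subst Bochner_Integration.integrable_cong[OF refl FE]) simp_all
  then have "integrable (density N (\<lambda>y. ennreal (\<Prod>a\<in>I. exp (y a)))) (\<lambda>y. F (E y))"
    by (subst integrable_density) (auto simp: prod_nonneg)
  then have "integrable (density N (\<lambda>t. ennreal (indicator S t))) F"
    unfolding D[symmetric] by (subst integrable_distr_eq) simp_all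
  then have "integrable N (\<lambda>t. indicator S t *\<^sub>R F t)"
    by (subst (asm) integrable_density) simp_all
  then show "set_integrable N {t. \<forall>a\<in>I. 0 < t a} f"
    unfolding set_integrable_def S_def[symmetric] fF .
  have "set_lebesgue_integral N S f = (LINT t|N. indicator S t *\<^sub>R F t)"
    unfolding set_lebesgue_integral_def fF ..
  also have "\<dots> = (LINT t|density N (\<lambda>t. ennreal (indicator S t)). F t)"
    by (subst integral_density) simp_all
  also have "\<dots> = (LINT y|density N (\<lambda>y. ennreal (\<Prod>a\<in>I. exp (y a))). F (E y))"
    unfolding D[symmetric] by (subst integral_distr) simp_all
  also have "\<dots> = (LINT y|N. (\<Prod>a\<in>I. exp (y a)) *\<^sub>R F (E y))"
    by (subst integral_density) (auto simp: prod_nonneg)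
  also have "\<dots> = (LINT y|N. P y)"
    by (intro Bochner_Integration.integral_cong refl FE)
  finally show "set_lebesgue_integral N {t. \<forall>a\<in>I. 0 < t a} f = (LINT \<tau>|N. P \<tau>)"
    unfolding S_def .
qed

section \<open>Rows of the factors\<close>

text \<open>Row vectors are functions on \<open>ix\<close>, where \<open>Neg k\<close> stands for the index \<open>2n + 2 - k\<close>. The operators
  \<open>e_act\<close>, \<open>f_act\<close>, \<open>s_act\<close> and \<open>word_act\<close> are right multiplications.\<close>

datatype ix = Pos nat | Mid | Neg nat

text \<open>For j = n the square of the generator does not vanish: Pos n goes to sqrt 2 times Mid,
  and Mid to - sqrt 2 times Neg n. Half of this square is the coefficient -1 of the quadratic
  term.\<close>

fun e_act :: "nat \<Rightarrow> nat \<Rightarrow> real \<Rightarrow> (ix \<Rightarrow> real) \<Rightarrow> ix \<Rightarrow> real" where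
  "e_act n j c v = (if j < n
     then v(Pos (Suc j) := v (Pos (Suc j)) + c * v (Pos j), Neg j := v (Neg j) - c * v (Neg (Suc j)))
     else v(Mid := v Mid + sqrt 2 * c * v (Pos n), Neg n := v (Neg n) - sqrt 2 * c * v Mid - c\<^sup>2 * v (Pos n)))"

fun f_act :: "nat \<Rightarrow> nat \<Rightarrow> real \<Rightarrow> (ix \<Rightarrow> real) \<Rightarrow> ix \<Rightarrow> real" where
  "f_act n j c v = (if j < n
     then v(Pos j := v (Pos j) + c * v (Pos (Suc j)), Neg (Suc j) := v (Neg (Suc j)) - c * v (Neg j))
     else v(Mid := v Mid - sqrt 2 * c * v (Neg n), Pos n := v (Pos n) + sqrt 2 * c * v Mid - c\<^sup>2 * v (Neg n)))"

declare e_act.simps[simp del] f_act.simps[simp del]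

text \<open>The standard lift of a simple reflection; \<open>s_act_eq\<close> shows it to be a
  signed permutation of the coordinates.\<close>

definition s_act :: "nat \<Rightarrow> nat \<Rightarrow> (ix \<Rightarrow> real) \<Rightarrow> ix \<Rightarrow> real" where
  "s_act n j v = e_act n j 1 (f_act n j (- 1) (e_act n j 1 v))"

lemma s_act_eq:
  "s_act n j v = (if j < n
     then v(Pos (Suc j) := v (Pos j), Pos j := - v (Pos (Suc j)), Neg j := - v (Neg (Suc j)), Neg (Suc j) := v (Neg j))
     else v(Neg n := - v (Pos n), Pos n := - v (Neg n), Mid := - v Mid))"
  by (auto simp: s_act_def e_act.simps f_act.simps fun_eq_iff algebra_simps power2_eq_square)

text \<open>The coordinates involved in the letters i, ..., n, that is, in the smaller orthogonal
  group containing R_n ... R_i.\<close>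

definition block :: "nat \<Rightarrow> nat \<Rightarrow> ix set" where
  "block n i = Pos ` {i..n} \<union> {Mid} \<union> Neg ` {i..n}"

lemma block_simps[simp]:
  "Pos k \<in> block n i \<longleftrightarrow> i \<le> k \<and> k \<le> n" "Neg k \<in> block n i \<longleftrightarrow> i \<le> k \<and> k \<le> n" "Mid \<in> block n i"
  by (auto simp: block_def)

definition supported :: "ix set \<Rightarrow> (ix \<Rightarrow> real) \<Rightarrow> bool" where
  "supported S v \<longleftrightarrow> (\<forall>a. a \<notin> S \<longrightarrow> v a = 0)"

definition basis :: "ix \<Rightarrow> ix \<Rightarrow> real" where
  "basis a = (\<lambda>b. if b = a then 1 else 0)"

definition word_act :: "nat \<Rightarrow> (coord \<Rightarrow> real) \<Rightarrow> (nat \<times> coord) list \<Rightarrow> (ix \<Rightarrow> real) \<Rightarrow> ix \<Rightarrow> real" where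
  "word_act n t ws = fold (\<lambda>(j, a). e_act n j (t a)) ws"

lemma word_act_simps [simp]:
  "word_act n t [] v = v" "word_act n t (w # ws) v = word_act n t ws (e_act n (fst w) (t (snd w)) v)"
  "word_act n t (ws @ ws') v = word_act n t ws' (word_act n t ws v)"
  by (simp_all add: word_act_def case_prod_beta)

definition tail_word :: "nat \<Rightarrow> nat \<Rightarrow> (nat \<times> coord) list" where
  "tail_word n i = concat (map (row_word n) (rev [i..<Suc n]))"

lemma word_eq_tail_word: "word n = tail_word n 1"
  by (simp add: word_def tail_word_def)

lemma tail_word_Suc_n: "tail_word n (Suc n) = []"
  by (simp add: tail_word_def)

lemma tail_word_step: "i \<le> n \<Longrightarrow> tail_word n i = tail_word n (Suc i) @ row_word n i"
  by (simp add: tail_word_def upt_conv_Cons del: upt_Suc)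

lemma row_word_letters:
  assumes "w \<in> set (row_word n i)" "1 \<le> i" "i \<le> n"
  shows "i \<le> fst w \<and> fst w \<le> n"
  using assms by (auto simp: row_word_def)

lemma tail_word_letters:
  assumes "w \<in> set (tail_word n i)" "1 \<le> i"
  shows "i \<le> fst w \<and> fst w \<le> n"
  using assms row_word_letters[of w n] by (fastforce simp: tail_word_def)

text \<open>With ascending letters a \<open>Pos\<close> entry receives its already updated
  predecessor, hence the recursion in \<open>w\<close>, while a \<open>Neg\<close> entry receives
  the old value of its successor. For descending letters the roles are exchanged.\<close>

lemma fold_ascending_ex:
  fixes s :: "nat \<Rightarrow> real" and v :: "ix \<Rightarrow> real"
  assumes "i \<le> m" "m \<le> n"
  defines "w \<equiv> fold (\<lambda>l. e_act n (l - 1) (s l)) [Suc i..<Suc m] v"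
  shows "w Mid = v Mid"
    and "w (Pos l) = (if i < l \<and> l \<le> m then v (Pos l) + s l * w (Pos (l - 1)) else v (Pos l))"
    and "w (Neg l) = (if i \<le> l \<and> l < m then v (Neg l) - s (Suc l) * v (Neg (Suc l)) else v (Neg l))"
proof -
  have "w Mid = v Mid \<and> (\<forall>l.
      w (Pos l) = (if i < l \<and> l \<le> m then v (Pos l) + s l * w (Pos (l - 1)) else v (Pos l)) \<and>
      w (Neg l) = (if i \<le> l \<and> l < m then v (Neg l) - s (Suc l) * v (Neg (Suc l)) else v (Neg l)))"
    using assms(1,2) unfolding w_def
  proof (induction m rule: dec_induct)
    case base
    then show ?case by simp
  next
    case (step m)
    define w where "w = fold (\<lambda>l. e_act n (l - 1) (s l)) [Suc i..<Suc m] v"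
    define w' where "w' = fold (\<lambda>l. e_act n (l - 1) (s l)) [Suc i..<Suc (Suc m)] v"
    have "w' = e_act n m (s (Suc m)) w" "m < n"
      using step by (simp_all add: w_def w'_def)
    then have w': "w' Mid = w Mid" "w' (Pos l) = (if l = Suc m then w (Pos (Suc m)) + s (Suc m) * w (Pos m) else w (Pos l))"
      "w' (Neg l) = (if l = m then w (Neg m) - s (Suc m) * w (Neg (Suc m)) else w (Neg l))" for l
      by (simp_all add: e_act.simps)
    have IH: "w Mid = v Mid" "w (Pos l) = (if i < l \<and> l \<le> m then v (Pos l) + s l * w (Pos (l - 1)) else v (Pos l))"
      "w (Neg l) = (if i \<le> l \<and> l < m then v (Neg l) - s (Suc l) * v (Neg (Suc l)) else v (Neg l))" for l
      using step.IH step.prems unfolding w_def by auto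
    show ?case
      unfolding w'_def[symmetric]
    proof (intro conjI allI)
      show "w' Mid = v Mid" using w' IH(1) by simp
      fix l
      show "w' (Pos l) = (if i < l \<and> l \<le> Suc m then v (Pos l) + s l * w' (Pos (l - 1)) else v (Pos l))"
      proof (cases "l = Suc m")
        case True
        then show ?thesis using step.hyps IH(2)[of "Suc m"] by (simp add: w')
      next
        case False
        then show ?thesis using w'(2)[of l] w'(2)[of "l - 1"] IH(2)[of l] by auto
      qed
      show "w' (Neg l) = (if i \<le> l \<and> l < Suc m then v (Neg l) - s (Suc l) * v (Neg (Suc l)) else v (Neg l))"
      proof (cases "l = m")
        case True
        then show ?thesis using step.hyps IH(3)[of m] IH(3)[of "Suc m"] by (simp add: w')
      next
        case False
        then show ?thesis using w'(3)[of l] IH(3)[of l] by auto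
      qed
    qed
  qed
  then show "w Mid = v Mid"
    and "w (Pos l) = (if i < l \<and> l \<le> m then v (Pos l) + s l * w (Pos (l - 1)) else v (Pos l))"
    and "w (Neg l) = (if i \<le> l \<and> l < m then v (Neg l) - s (Suc l) * v (Neg (Suc l)) else v (Neg l))"
    by blast+
qed

lemma fold_descending_ex:
  fixes t :: "nat \<Rightarrow> real" and v :: "ix \<Rightarrow> real"
  assumes "i \<le> n"
  defines "w \<equiv> fold (\<lambda>l. e_act n (l - 1) (t l)) (rev [Suc i..<Suc n]) v"
  shows "w Mid = v Mid"
    and "w (Pos l) = (if i < l \<and> l \<le> n then v (Pos l) + t l * v (Pos (l - 1)) else v (Pos l))"
    and "w (Neg l) = (if i \<le> l \<and> l < n then v (Neg l) - t (Suc l) * w (Neg (Suc l)) else v (Neg l))"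
proof -
  have "w Mid = v Mid \<and> (\<forall>l.
      w (Pos l) = (if i < l \<and> l \<le> n then v (Pos l) + t l * v (Pos (l - 1)) else v (Pos l)) \<and>
      w (Neg l) = (if i \<le> l \<and> l < n then v (Neg l) - t (Suc l) * w (Neg (Suc l)) else v (Neg l)))"
    using assms(1) unfolding w_def
  proof (induction i rule: inc_induct)
    case base
    then show ?case by simp
  next
    case (step i)
    define w where "w = fold (\<lambda>l. e_act n (l - 1) (t l)) (rev [Suc (Suc i)..<Suc n]) v"
    define w' where "w' = fold (\<lambda>l. e_act n (l - 1) (t l)) (rev [Suc i..<Suc n]) v"
    have "w' = e_act n i (t (Suc i)) w"
      using step.hyps by (simp add: w_def w'_def upt_conv_Cons del: upt_Suc)
    then have w': "w' Mid = w Mid" "w' (Pos l) = (if l = Suc i then w (Pos (Suc i)) + t (Suc i) * w (Pos i) else w (Pos l))"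
      "w' (Neg l) = (if l = i then w (Neg i) - t (Suc i) * w (Neg (Suc i)) else w (Neg l))" for l
      using step.hyps by (simp_all add: e_act.simps)
    have IH: "w Mid = v Mid" "w (Pos l) = (if Suc i < l \<and> l \<le> n then v (Pos l) + t l * v (Pos (l - 1)) else v (Pos l))"
      "w (Neg l) = (if Suc i \<le> l \<and> l < n then v (Neg l) - t (Suc l) * w (Neg (Suc l)) else v (Neg l))" for l
      using step.IH unfolding w_def by auto
    show ?case
      unfolding w'_def[symmetric]
    proof (intro conjI allI)
      show "w' Mid = v Mid" using w' IH(1) by simp
      fix l
      show "w' (Pos l) = (if i < l \<and> l \<le> n then v (Pos l) + t l * v (Pos (l - 1)) else v (Pos l))"
      proof (cases "l = Suc i")
        case True
        then show ?thesis using step.hyps IH(2)[of i] IH(2)[of "Suc i"] by (simp add: w')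
      next
        case False
        then show ?thesis using w'(2)[of l] IH(2)[of l] by auto
      qed
      show "w' (Neg l) = (if i \<le> l \<and> l < n then v (Neg l) - t (Suc l) * w' (Neg (Suc l)) else v (Neg l))"
      proof (cases "l = i")
        case True
        then show ?thesis using step.hyps IH(3)[of i] by (simp add: w')
      next
        case False
        then show ?thesis using w'(3)[of l] w'(3)[of "Suc l"] IH(3)[of l] by auto
      qed
    qed
  qed
  then show "w Mid = v Mid"
    and "w (Pos l) = (if i < l \<and> l \<le> n then v (Pos l) + t l * v (Pos (l - 1)) else v (Pos l))"
    and "w (Neg l) = (if i \<le> l \<and> l < n then v (Neg l) - t (Suc l) * w (Neg (Suc l)) else v (Neg l))"
    by blast+
qed

text \<open>The function \<open>x\<close> records the entries at \<open>Pos\<close> after the first, ascending half of the row.\<close>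

definition row_rel :: "nat \<Rightarrow> nat \<Rightarrow> (coord \<Rightarrow> real) \<Rightarrow> (ix \<Rightarrow> real) \<Rightarrow> (nat \<Rightarrow> real) \<Rightarrow> (ix \<Rightarrow> real) \<Rightarrow> bool" where
  "row_rel n i t v x w \<longleftrightarrow> x i = v (Pos i) \<and>
    (\<forall>l. i \<le> l \<longrightarrow> l < n \<longrightarrow> x (Suc l) = v (Pos (Suc l)) + t (DblB i (Suc l)) * x l) \<and>
    w (Pos i) = x i \<and>
    (\<forall>l. i \<le> l \<longrightarrow> l < n \<longrightarrow> w (Pos (Suc l)) = x (Suc l) + t (DblA i (Suc l)) * x l) \<and>
    w Mid = v Mid + sqrt 2 * t (Sgl i) * x n \<and>
    w (Neg n) = v (Neg n) - sqrt 2 * t (Sgl i) * v Mid - (t (Sgl i))\<^sup>2 * x n \<and>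
    (\<forall>l. i \<le> l \<longrightarrow> l < n \<longrightarrow>
      w (Neg l) = v (Neg l) - t (DblB i (Suc l)) * v (Neg (Suc l)) - t (DblA i (Suc l)) * w (Neg (Suc l))) \<and>
    (\<forall>l. l < i \<or> n < l \<longrightarrow> w (Pos l) = v (Pos l) \<and> w (Neg l) = v (Neg l))"

lemma row_relD:
  assumes "row_rel n i t v x w"
  shows "x i = v (Pos i)"
    and "\<And>l. i \<le> l \<Longrightarrow> l < n \<Longrightarrow> x (Suc l) = v (Pos (Suc l)) + t (DblB i (Suc l)) * x l"
    and "w (Pos i) = x i"
    and "\<And>l. i \<le> l \<Longrightarrow> l < n \<Longrightarrow> w (Pos (Suc l)) = x (Suc l) + t (DblA i (Suc l)) * x l"
    and "w Mid = v Mid + sqrt 2 * t (Sgl i) * x n"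
    and "w (Neg n) = v (Neg n) - sqrt 2 * t (Sgl i) * v Mid - (t (Sgl i))\<^sup>2 * x n"
    and "\<And>l. i \<le> l \<Longrightarrow> l < n \<Longrightarrow>
      w (Neg l) = v (Neg l) - t (DblB i (Suc l)) * v (Neg (Suc l)) - t (DblA i (Suc l)) * w (Neg (Suc l))"
    and "\<And>l. l < i \<or> n < l \<Longrightarrow> w (Pos l) = v (Pos l) \<and> w (Neg l) = v (Neg l)"
  using assms unfolding row_rel_def by blast+

lemma row_action:
  assumes i: "i \<le> n"
  obtains x where "row_rel n i t v x (word_act n t (row_word n i) v)"
proof -
  define w where "w = word_act n t (row_word n i) v"
  define y where "y = fold (\<lambda>l. e_act n (l - 1) (t (DblB i l))) [Suc i..<Suc n] v"
  define u where "u = e_act n n (t (Sgl i)) y"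
  have w: "w = fold (\<lambda>l. e_act n (l - 1) (t (DblA i l))) (rev [Suc i..<Suc n]) u"
    by (simp add: w_def word_act_def row_word_def fold_map y_def u_def comp_def rev_map del: upt_Suc)
  note Y = fold_ascending_ex[OF i order_refl, where s = "\<lambda>l. t (DblB i l)" and v = v, folded y_def]
  note W = fold_descending_ex[OF i, where t = "\<lambda>l. t (DblA i l)" and v = u, folded w]
  have U: "u (Pos l) = y (Pos l)" "u Mid = v Mid + sqrt 2 * t (Sgl i) * y (Pos n)"
    "u (Neg l) = (if l = n then v (Neg n) - sqrt 2 * t (Sgl i) * v Mid - (t (Sgl i))\<^sup>2 * y (Pos n) else y (Neg l))" for l
    using Y(1) Y(3)[of n] by (simp_all add: u_def e_act.simps)
  show ?thesis
  proof (rule that[of "\<lambda>l. y (Pos l)"], fold w_def, unfold row_rel_def, intro conjI allI impI)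
    fix l
    show "y (Pos i) = v (Pos i)" using Y(2)[of i] by simp
    show "w (Pos i) = y (Pos i)" using W(2)[of i] by (simp add: U)
    show "w Mid = v Mid + sqrt 2 * t (Sgl i) * y (Pos n)" by (simp add: W(1) U)
    show "w (Neg n) = v (Neg n) - sqrt 2 * t (Sgl i) * v Mid - (t (Sgl i))\<^sup>2 * y (Pos n)"
      using W(3)[of n] by (simp add: U)
    show "l < i \<or> n < l \<Longrightarrow> w (Pos l) = v (Pos l)" "l < i \<or> n < l \<Longrightarrow> w (Neg l) = v (Neg l)"
      using W(2,3)[of l] Y(2,3)[of l] i by (auto simp: U)
    assume l: "i \<le> l" "l < n"
    show "y (Pos (Suc l)) = v (Pos (Suc l)) + t (DblB i (Suc l)) * y (Pos l)"
      using Y(2)[of "Suc l"] l by simp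
    show "w (Pos (Suc l)) = y (Pos (Suc l)) + t (DblA i (Suc l)) * y (Pos l)" using W(2)[of "Suc l"] l by (simp add: U)
    show "w (Neg l) = v (Neg l) - t (DblB i (Suc l)) * v (Neg (Suc l)) - t (DblA i (Suc l)) * w (Neg (Suc l))"
      using W(3)[of l] Y(3)[of l] l by (simp add: U)
  qed
qed

section \<open>One row against the lift of the longest element\<close>

fun flip :: "(ix \<Rightarrow> real) \<Rightarrow> ix \<Rightarrow> real" where
  "flip v (Pos k) = v (Neg k)" | "flip v (Neg k) = v (Pos k)" | "flip v Mid = v Mid"

text \<open>The proportionality factor in the invariant for the ascending half of a transformed row;
  it is 1 where the row starts.\<close>

definition cfrac :: "(coord \<Rightarrow> real) \<Rightarrow> nat \<Rightarrow> nat \<Rightarrow> real" where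
  "cfrac t i l = (if l \<le> i then 1 else t (DblB i l) / (t (DblB i l) + t (DblA i l)))"

text \<open>Row \<open>i\<close> of the new coordinates, obtained by solving the recursions of
  \<open>row_rel\<close> for the original and the transformed row against each other. The entries
  are rational rather than monomial; \<open>row_sum_twist\<close> shows where the denominators
  cancel.\<close>

fun twist :: "nat \<Rightarrow> (coord \<Rightarrow> real) \<Rightarrow> coord \<Rightarrow> real" where
  "twist n t (DblA i l) = 1 / (cfrac t i (l - 1) * (t (DblB i l) + t (DblA i l)))"
| "twist n t (DblB i l) = t (DblB i l) / (cfrac t i (l - 1) * t (DblA i l) * (t (DblB i l) + t (DblA i l)))"
| "twist n t (Sgl i) = 1 / (cfrac t i n * t (Sgl i))"

text \<open>Up to a sign, \<open>flip\<close> is the lift of the longest element, so that this is one step of the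
  factorization. Along the ascending half of the row the entries \<open>X\<^sub>l\<close> on the right-hand side
  are \<open>cfrac t i l\<close> times the difference of the entries of \<open>w\<close> and \<open>v\<close> at \<open>Neg l\<close>.\<close>

lemma flip_row_action:
  fixes t :: "coord \<Rightarrow> real" and v :: "ix \<Rightarrow> real"
  assumes i: "i \<le> n" and t0: "0 < t (Sgl i)"
    and tA: "\<And>l. i < l \<Longrightarrow> l \<le> n \<Longrightarrow> 0 < t (DblA i l)" and tB: "\<And>l. i < l \<Longrightarrow> l \<le> n \<Longrightarrow> 0 < t (DblB i l)"
    and p: "p (Sgl i) = twist n t (Sgl i)" 
      "\<And>l. i < l \<Longrightarrow> l \<le> n \<Longrightarrow> p (DblA i l) = twist n t (DblA i l)"
      "\<And>l. i < l \<Longrightarrow> l \<le> n \<Longrightarrow> p (DblB i l) = twist n t (DblB i l)"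
    and v: "supported (block n i) v" "v (Neg i) = 0"
  defines "w \<equiv> word_act n (\<lambda>a. - t a) (row_word n i) v"
  assumes V: "V (Pos i) = w (Neg i)" "V Mid = - v Mid" "V (Neg i) = 0"
    "\<And>l. i < l \<Longrightarrow> l \<le> n \<Longrightarrow> V (Pos l) = - v (Neg l) * t (DblB i l) / t (DblA i l)"
    "\<And>l. i < l \<Longrightarrow> l \<le> n \<Longrightarrow> V (Neg l) = - v (Pos l) * t (DblA i l) / t (DblB i l)"
    "supported (block n i) V"
  shows "flip w = word_act n p (row_word n i) V"
proof -
  define W where "W = word_act n p (row_word n i) V"
  define C where "C = cfrac t i"
  obtain x where "row_rel n i (\<lambda>a. - t a) v x w"
    unfolding w_def by (rule row_action[OF i])
  note x = row_relD[OF this, simplified]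
  obtain X where "row_rel n i p V X W"
    unfolding W_def by (rule row_action[OF i])
  note X = row_relD[OF this]
  have Ci: "C i = 1" by (simp add: C_def cfrac_def)
  have C: "C (Suc l) = t (DblB i (Suc l)) / (t (DblB i (Suc l)) + t (DblA i (Suc l)))"
    "p (DblA i (Suc l)) = 1 / (C l * (t (DblB i (Suc l)) + t (DblA i (Suc l))))"
    "p (DblB i (Suc l)) = t (DblB i (Suc l)) / (C l * t (DblA i (Suc l)) * (t (DblB i (Suc l)) + t (DblA i (Suc l))))"
    if "i \<le> l" "l < n" for l
    using that p by (simp_all add: C_def cfrac_def)
  have Cpos: "0 < C l" if "i \<le> l" "l \<le> n" for l
    using that tA[of l] tB[of l] by (auto simp: C_def cfrac_def add_pos_pos)
  have pS: "p (Sgl i) = 1 / (C n * t (Sgl i))" using p by (simp add: C_def)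
  have tAS: "0 < t (DblA i (Suc l))" and tBS: "0 < t (DblB i (Suc l))" if "i \<le> l" "l < n" for l
    using tA[of "Suc l"] tB[of "Suc l"] that by auto
  have XC: "X l = C l * (w (Neg l) - v (Neg l))" if "i \<le> l" "l \<le> n" for l
    using that
  proof (induction l rule: dec_induct)
    case base
    then show ?case using v(2) by (simp add: X(1) V Ci)
  next
    case (step l)
    then have IH: "X l = C l * (w (Neg l) - v (Neg l))" and l: "i \<le> l" "l < n" by auto
    define a b c d where "a = t (DblA i (Suc l))" and "b = t (DblB i (Suc l))" and "c = v (Neg (Suc l))" and "d = w (Neg (Suc l))"
    have pos: "0 < a" "0 < b" "0 < C l" using tAS[OF l] tBS[OF l] Cpos[of l] l by (simp_all add: a_def b_def)
    have "X (Suc l) = - c * b / a + b / (C l * a * (b + a)) * (C l * (b * c + a * d))"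
      using X(2)[OF l] V(4)[of "Suc l"] x(7)[OF l] C(3)[OF l] IH l by (simp add: a_def b_def c_def d_def)
    also have "\<dots> = b / (b + a) * (d - c)"
    proof -
      have "b + a \<noteq> 0" using pos by simp
      with pos show ?thesis by (simp add: divide_simps) (simp add: algebra_simps)
    qed
    finally show ?case using C(1)[OF l] by (simp add: a_def b_def c_def d_def)
  qed
  \<comment> \<open>The descending half supplies what the ascending half lacks: b (d - c) / (b + a)
    plus (b c + a d) / (b + a) equals d.\<close>
  have WPos: "W (Pos l) = w (Neg l)" if "i \<le> l" "l \<le> n" for l
  proof (cases "l = i")
    case True
    then show ?thesis using X(1,3) V(1) by simp
  next
    case False
    with that obtain m where m: "l = Suc m" "i \<le> m" "m < n" by (cases l) auto
    define a b c d where "a = t (DblA i (Suc m))" and "b = t (DblB i (Suc m))" and "c = v (Neg (Suc m))" and "d = w (Neg (Suc m))"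
    have pos: "0 < a" "0 < b" "0 < C m" using tAS[OF m(2,3)] tBS[OF m(2,3)] Cpos[of m] m by (simp_all add: a_def b_def)
    have "W (Pos l) = b / (b + a) * (d - c) + 1 / (C m * (b + a)) * (C m * (b * c + a * d))"
      using X(4)[OF m(2,3)] XC[of m] XC[of "Suc m"] x(7)[OF m(2,3)] C(1,2)[OF m(2,3)] m by (simp add: a_def b_def c_def d_def)
    also have "\<dots> = d"
    proof -
      have "b + a \<noteq> 0" using pos by simp
      with pos show ?thesis by (simp add: divide_simps) (simp add: algebra_simps)
    qed
    finally show ?thesis by (simp add: m d_def)
  qed
  have sq: "sqrt 2 * (sqrt 2 * r) = 2 * r" for r by (simp add: mult.assoc[symmetric])
  have Cn: "0 < C n" using Cpos[of n] i by simp
  have Xn: "X n = C n * (sqrt 2 * t (Sgl i) * v Mid - (t (Sgl i))\<^sup>2 * x n)"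
    using XC[of n] x(6) i by simp
  have WMid: "W Mid = w Mid"
    using Cn t0 by (simp add: X(5) V(2) x(5) pS Xn field_simps power2_eq_square sq)
  have WNegn': "W (Neg n) = V (Neg n) + x n / C n"
    using Cn t0 by (simp add: X(6) V(2) pS Xn field_simps power2_eq_square sq)
  \<comment> \<open>The first summand is V (Neg (Suc l)); adding the correction x / C gives the
    entry that is wanted at this place.\<close>
  have step: "- v (Pos (Suc l)) * t (DblA i (Suc l)) / t (DblB i (Suc l)) + x (Suc l) / C (Suc l) = w (Pos (Suc l))"
    if l: "i \<le> l" "l < n" for l
  proof -
    define a b c d where "a = t (DblA i (Suc l))" and "b = t (DblB i (Suc l))" and "c = x (Suc l)" and "d = x l"
    have pos: "0 < a" "0 < b" using tAS[OF l] tBS[OF l] by (simp_all add: a_def b_def)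
    have "- (c + b * d) * a / b + c / (b / (b + a)) = c - a * d"
    proof -
      have "b + a \<noteq> 0" using pos by simp
      with pos show ?thesis by (simp add: divide_simps) (simp add: algebra_simps)
    qed
    then show ?thesis using x(2,4)[OF l] C(1)[OF l] by (simp add: a_def b_def c_def d_def)
  qed
  \<comment> \<open>The \<open>Neg\<close> entries feed each other from n downwards, hence the
    direction of the induction. The link between neighbours is W (Neg l) = V (Neg l) + x l / C
    l.\<close>
  have WNeg: "W (Neg l) = w (Pos l)" if "i \<le> l" "l \<le> n" for l
    using that(2,1)
  proof (induction l rule: inc_induct)
    case base
    show ?case
    proof (cases "n = i")
      case True
      then show ?thesis using WNegn' V(3) Ci x(3) by simp
    next
      case False
      with i obtain m where m: "n = Suc m" "i \<le> m" by (cases n) auto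
      then show ?thesis using WNegn' V(5)[of n] step[of m] by simp
    qed
  next
    case (step l)
    then have l: "i \<le> l" "l < n" and IH: "W (Neg (Suc l)) = w (Pos (Suc l))" by auto
    have "W (Neg l) = V (Neg l) + x l / C l"
    proof -
      define a b c d where "a = t (DblA i (Suc l))" and "b = t (DblB i (Suc l))" and "c = x (Suc l)" and "d = x l"
      have pos: "0 < a" "0 < b" "0 < C l" using tAS[OF l] tBS[OF l] Cpos[of l] l by (simp_all add: a_def b_def)
      have "W (Neg l) = V (Neg l) - b / (C l * a * (b + a)) * (- (c + b * d) * a / b) - 1 / (C l * (b + a)) * (c - a * d)"
        using X(7)[OF l] V(5)[of "Suc l"] IH x(2,4)[OF l] C(2,3)[OF l] l by (simp add: a_def b_def c_def d_def)
      also have "\<dots> = V (Neg l) + d / C l"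
      proof -
        have "b + a \<noteq> 0" using pos by simp
        with pos show ?thesis by (simp add: divide_simps) (simp add: algebra_simps)
      qed
      finally show ?thesis by (simp add: d_def)
    qed
    moreover have "V (Neg l) + x l / C l = w (Pos l)"
    proof (cases "l = i")
      case True
      then show ?thesis using V(3) Ci x(3) by simp
    next
      case False
      with l obtain m where m: "l = Suc m" "i \<le> m" by (cases l) auto
      then show ?thesis using V(5)[of l] \<open>i \<le> m\<close> l \<open>\<And>l. i \<le> l \<Longrightarrow> l < n \<Longrightarrow> - v (Pos (Suc l)) * t (DblA i (Suc l)) / t (DblB i (Suc l)) + x (Suc l) / C (Suc l) = w (Pos (Suc l))\<close>[of m] by simp
    qed
    ultimately show ?case by simp
  qed
  have "flip w a = W a" for a
  proof (cases a)
    case (Pos l)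
    show ?thesis
    proof (cases "i \<le> l \<and> l \<le> n")
      case False
      then show ?thesis using x(8)[of l] X(8)[of l] v(1) V(6) Pos by (auto simp: supported_def)
    qed (use WPos Pos in auto)
  next
    case (Neg l)
    show ?thesis
    proof (cases "i \<le> l \<and> l \<le> n")
      case False
      then show ?thesis using x(8)[of l] X(8)[of l] v(1) V(6) Neg by (auto simp: supported_def)
    qed (use WNeg Neg in auto)
  qed (use WMid in auto)
  then show ?thesis unfolding W_def by blast
qed

section \<open>Linearity, support and invariance of the word operators\<close>

lemma e_act_linear:
  "e_act n j c (\<lambda>a. x * u a + y * v a) = (\<lambda>a. x * e_act n j c u a + y * e_act n j c v a)"
  by (auto simp: e_act.simps fun_eq_iff algebra_simps)

lemma word_act_linear:
  "word_act n t ws (\<lambda>a. x * u a + y * v a) = (\<lambda>a. x * word_act n t ws u a + y * word_act n t ws v a)"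
  by (induction ws arbitrary: u v) (simp_all add: e_act_linear)

lemma word_act_scale: "word_act n t ws (\<lambda>a. x * u a) = (\<lambda>a. x * word_act n t ws u a)"
  using word_act_linear[of n t ws x u 0 u] by simp

lemma e_act_inverse: "e_act n j (- c) (e_act n j c v) = v" "e_act n j c (e_act n j (- c) v) = v"
  by (auto simp: e_act.simps fun_eq_iff algebra_simps power2_eq_square)

lemma word_act_inverse: "word_act n (\<lambda>a. - t a) (rev ws) (word_act n t ws v) = v"
  by (induction ws arbitrary: v) (simp_all add: e_act_inverse)

lemma word_act_inverse': "word_act n t ws (word_act n (\<lambda>a. - t a) (rev ws) v) = v"
  by (induction ws arbitrary: v) (simp_all add: e_act_inverse)

lemma word_act_inj: "word_act n t ws u = word_act n t ws v \<Longrightarrow> u = v"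
  by (metis word_act_inverse)

lemma word_act_cong: "(\<And>w. w \<in> set ws \<Longrightarrow> t (snd w) = t' (snd w)) \<Longrightarrow> word_act n t ws v = word_act n t' ws v"
  by (induction ws arbitrary: v) simp_all

lemma e_act_outside: "i \<le> j \<Longrightarrow> j \<le> n \<Longrightarrow> a \<notin> block n i \<Longrightarrow> e_act n j c v a = v a"
  by (cases a) (auto simp: e_act.simps)

lemma word_act_outside:
  assumes "\<And>w. w \<in> set ws \<Longrightarrow> i \<le> fst w \<and> fst w \<le> n" "a \<notin> block n i"
  shows "word_act n t ws v a = v a"
  using assms by (induction ws arbitrary: v) (simp_all add: e_act_outside[where i = i])

lemma e_act_fixes: "i \<le> j \<Longrightarrow> j \<le> n \<Longrightarrow> (\<And>b. b \<in> block n i \<Longrightarrow> v b = 0) \<Longrightarrow> e_act n j c v = v"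
  by (auto simp: e_act.simps fun_eq_iff)

lemma word_act_fixes:
  assumes "\<And>w. w \<in> set ws \<Longrightarrow> i \<le> fst w \<and> fst w \<le> n" "\<And>b. b \<in> block n i \<Longrightarrow> v b = 0"
  shows "word_act n t ws v = v"
  using assms by (induction ws arbitrary: v) (simp_all add: e_act_fixes[where i = i])

lemma supported_wop:
  assumes "\<And>w. w \<in> set ws \<Longrightarrow> i \<le> fst w \<and> fst w \<le> n" "supported (block n i) v"
  shows "supported (block n i) (word_act n t ws v)"
  using assms word_act_outside[OF assms(1)] by (simp add: supported_def)

lemma block_mono: "i \<le> j \<Longrightarrow> block n j \<subseteq> block n i"
  by (auto simp: block_def)

lemma block_Suc: "i \<le> n \<Longrightarrow> block n i = insert (Pos i) (insert (Neg i) (block n (Suc i)))"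
  by (auto simp: block_def image_iff)

lemma supported_mono: "S \<subseteq> S' \<Longrightarrow> supported S v \<Longrightarrow> supported S' v"
  by (auto simp: supported_def)

text \<open>The bilinear form of SO(n+1,n) in these coordinates. Its invariance serves to read off
  an entry of an inverse operator from an entry of the operator itself.\<close>

definition split_pairing :: "nat \<Rightarrow> (ix \<Rightarrow> real) \<Rightarrow> (ix \<Rightarrow> real) \<Rightarrow> real" where
  "split_pairing n v w = (\<Sum>k = 1..n. v (Pos k) * w (Neg k) + v (Neg k) * w (Pos k)) + v Mid * w Mid"

lemma sum_remove2:
  fixes f :: "nat \<Rightarrow> real"
  assumes "1 \<le> j" "j < n"
  shows "(\<Sum>k = 1..n. f k) = f j + f (Suc j) + (\<Sum>k\<in>{1..n} - {j, Suc j}. f k)"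
proof -
  have "(\<Sum>k = 1..n. f k) = f j + (\<Sum>k\<in>{1..n} - {j}. f k)"
    using assms by (intro sum.remove) auto
  also have "(\<Sum>k\<in>{1..n} - {j}. f k) = f (Suc j) + (\<Sum>k\<in>{1..n} - {j} - {Suc j}. f k)"
    using assms by (intro sum.remove) auto
  also have "{1..n} - {j} - {Suc j} = {1..n} - {j, Suc j}" by blast
  finally show ?thesis by simp
qed

lemma split_pairing_ex:
  assumes "1 \<le> j" "j \<le> n"
  shows "split_pairing n (e_act n j c v) (e_act n j c w) = split_pairing n v w"
proof (cases "j < n")
  case True
  have "(\<Sum>k\<in>{1..n} - {j, Suc j}. e_act n j c v (Pos k) * e_act n j c w (Neg k) + e_act n j c v (Neg k) * e_act n j c w (Pos k))
      = (\<Sum>k\<in>{1..n} - {j, Suc j}. v (Pos k) * w (Neg k) + v (Neg k) * w (Pos k))"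
    using True by (intro sum.cong) (auto simp: e_act.simps)
  then show ?thesis
    unfolding split_pairing_def sum_remove2[OF assms(1) True]
    using True by (simp add: e_act.simps algebra_simps)
next
  case False
  then have j: "j = n" using assms by simp
  have "(\<Sum>k\<in>{1..n} - {n}. e_act n j c v (Pos k) * e_act n j c w (Neg k) + e_act n j c v (Neg k) * e_act n j c w (Pos k))
      = (\<Sum>k\<in>{1..n} - {n}. v (Pos k) * w (Neg k) + v (Neg k) * w (Pos k))"
    using j by (intro sum.cong) (auto simp: e_act.simps)
  moreover have "n \<in> {1..n}" using assms j by simp
  ultimately show ?thesis
    unfolding split_pairing_def sum.remove[OF finite_atLeastAtMost \<open>n \<in> {1..n}\<close>]
    using j by (simp add: e_act.simps algebra_simps power2_eq_square)
qed

lemma split_pairing_wop: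
  assumes "\<And>w. w \<in> set ws \<Longrightarrow> 1 \<le> fst w \<and> fst w \<le> n"
  shows "split_pairing n (word_act n t ws u) (word_act n t ws v) = split_pairing n u v"
  using assms by (induction ws arbitrary: u v) (simp_all add: split_pairing_ex)

lemma split_pairing_basis:
  assumes "1 \<le> i" "i \<le> n"
  shows "split_pairing n v (basis (Pos i)) = v (Neg i)"
proof -
  have "split_pairing n v (basis (Pos i)) = (\<Sum>k = 1..n. if k = i then v (Neg i) else 0)"
  proof -
    have "(\<Sum>k = 1..n. v (Pos k) * basis (Pos i) (Neg k) + v (Neg k) * basis (Pos i) (Pos k))
        = (\<Sum>k = 1..n. if k = i then v (Neg i) else 0)"
      by (intro sum.cong refl) (auto simp: basis_def)
    then show ?thesis by (simp add: split_pairing_def basis_def)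
  qed
  then show ?thesis using assms by simp
qed

definition torus_act :: "nat \<Rightarrow> (nat \<Rightarrow> real) \<Rightarrow> (ix \<Rightarrow> real) \<Rightarrow> ix \<Rightarrow> real" where
  "torus_act n T v = (\<lambda>a. case a of Pos k \<Rightarrow> T k * v (Pos k) | Mid \<Rightarrow> v Mid | Neg k \<Rightarrow> v (Neg k) / T k)"

lemma torus_act_simps [simp]:
  "torus_act n T v (Pos k) = T k * v (Pos k)" "torus_act n T v Mid = v Mid" "torus_act n T v (Neg k) = v (Neg k) / T k"
  by (simp_all add: torus_act_def)

text \<open>Conjugation by a torus element multiplies a letter by the inverse simple root T_(j+1) /
  T_j; for the short root j = n the numerator is 1.\<close>

lemma torus_act_ex:
  assumes "\<And>k. i \<le> k \<Longrightarrow> k \<le> n \<Longrightarrow> 0 < T k" "i \<le> j" "j \<le> n"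
  shows "torus_act n T (e_act n j c v) = e_act n j (c * (if j < n then T (Suc j) else 1) / T j) (torus_act n T v)"
proof -
  have "T j \<noteq> 0" "j < n \<Longrightarrow> T (Suc j) \<noteq> 0"
    using assms(1)[of j] assms(1)[of "Suc j"] assms(2,3) by auto
  moreover have "\<not> j < n \<Longrightarrow> j = n" using assms by simp
  ultimately show ?thesis
    by (auto simp: e_act.simps torus_act_def fun_eq_iff field_simps power2_eq_square split: ix.split)
qed

lemma torus_act_wop:
  assumes T: "\<And>k. i \<le> k \<Longrightarrow> k \<le> n \<Longrightarrow> 0 < T k"
    and ws: "\<And>w. w \<in> set ws \<Longrightarrow> i \<le> fst w \<and> fst w \<le> n"
    and t': "\<And>w. w \<in> set ws \<Longrightarrow> t' (snd w) = t (snd w) * (if fst w < n then T (Suc (fst w)) else 1) / T (fst w)"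
  shows "torus_act n T (word_act n t ws v) = word_act n t' ws (torus_act n T v)"
  using ws t' by (induction ws arbitrary: v) (simp_all add: torus_act_ex[where i = i, OF T])

lemma torus_act_basis: "torus_act n T (basis a) = (\<lambda>b. (case a of Pos k \<Rightarrow> T k | Mid \<Rightarrow> 1 | Neg k \<Rightarrow> 1 / T k) * basis a b)"
  by (auto simp: torus_act_def basis_def fun_eq_iff split: ix.split)

section \<open>The factorization and its uniqueness\<close>

definition weyl_act :: "nat \<Rightarrow> (nat \<times> coord) list \<Rightarrow> (ix \<Rightarrow> real) \<Rightarrow> ix \<Rightarrow> real" where
  "weyl_act n ws = fold (\<lambda>(j, a). s_act n j) ws"

lemma weyl_act_append [simp]: "weyl_act n (ws @ ws') v = weyl_act n ws' (weyl_act n ws v)"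
  by (simp add: weyl_act_def)

lemma fold_ascending_sb:
  assumes "i \<le> m" "m \<le> n"
  shows "fold (\<lambda>l. s_act n (l - 1)) [Suc i..<Suc m] v = (\<lambda>a. case a of
      Pos l \<Rightarrow> if l = m then v (Pos i) else if i \<le> l \<and> l < m then - v (Pos (Suc l)) else v (Pos l)
    | Mid \<Rightarrow> v Mid
    | Neg l \<Rightarrow> if l = m then v (Neg i) else if i \<le> l \<and> l < m then - v (Neg (Suc l)) else v (Neg l))"
  using assms
proof (induction m rule: dec_induct)
  case base
  show ?case by (auto simp: fun_eq_iff split: ix.split)
next
  case (step m)
  define y where "y = fold (\<lambda>l. s_act n (l - 1)) [Suc i..<Suc m] v"
  have m: "m < n" "i \<le> m" using step by simp_all
  have y: "y (Pos l) = (if l = m then v (Pos i) else if i \<le> l \<and> l < m then - v (Pos (Suc l)) else v (Pos l))"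
    "y (Neg l) = (if l = m then v (Neg i) else if i \<le> l \<and> l < m then - v (Neg (Suc l)) else v (Neg l))"
    "y Mid = v Mid" for l
    using step.IH m unfolding y_def by simp_all
  have "fold (\<lambda>l. s_act n (l - 1)) [Suc i..<Suc (Suc m)] v = s_act n m y"
    using m by (simp add: y_def)
  also have "s_act n m y = (\<lambda>a. case a of
      Pos l \<Rightarrow> if l = Suc m then v (Pos i) else if i \<le> l \<and> l < Suc m then - v (Pos (Suc l)) else v (Pos l)
    | Mid \<Rightarrow> v Mid
    | Neg l \<Rightarrow> if l = Suc m then v (Neg i) else if i \<le> l \<and> l < Suc m then - v (Neg (Suc l)) else v (Neg l))"
    (is "_ = ?r")
  proof
    fix a
    show "s_act n m y a = ?r a"
    proof (cases a)
      case (Pos l)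
      consider "l = Suc m" | "l = m" | "l < m" | "Suc m < l" by linarith
      then show ?thesis using Pos m by cases (simp_all add: s_act_eq y)
    next
      case (Neg l)
      consider "l = Suc m" | "l = m" | "l < m" | "Suc m < l" by linarith
      then show ?thesis using Neg m by cases (simp_all add: s_act_eq y)
    qed (use m in \<open>simp add: s_act_eq y\<close>)
  qed
  finally show ?case .
qed

lemma fold_descending_sb:
  assumes "i \<le> n"
  shows "fold (\<lambda>l. s_act n (l - 1)) (rev [Suc i..<Suc n]) v = (\<lambda>a. case a of
      Pos l \<Rightarrow> if l = i then (- 1) ^ (n - i) * v (Pos n) else if i < l \<and> l \<le> n then v (Pos (l - 1)) else v (Pos l)
    | Mid \<Rightarrow> v Mid
    | Neg l \<Rightarrow> if l = i then (- 1) ^ (n - i) * v (Neg n) else if i < l \<and> l \<le> n then v (Neg (l - 1)) else v (Neg l))"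
  using assms
proof (induction i rule: inc_induct)
  case base
  show ?case by (auto simp: fun_eq_iff split: ix.split)
next
  case (step i)
  define y where "y = fold (\<lambda>l. s_act n (l - 1)) (rev [Suc (Suc i)..<Suc n]) v"
  have i: "i < n" using step by simp
  have e: "n - i = Suc (n - Suc i)" using i by simp
  have y: "y (Pos l) = (if l = Suc i then (- 1) ^ (n - Suc i) * v (Pos n) else if Suc i < l \<and> l \<le> n then v (Pos (l - 1)) else v (Pos l))"
    "y (Neg l) = (if l = Suc i then (- 1) ^ (n - Suc i) * v (Neg n) else if Suc i < l \<and> l \<le> n then v (Neg (l - 1)) else v (Neg l))"
    "y Mid = v Mid" for l
    using step.IH unfolding y_def by simp_all
  have "fold (\<lambda>l. s_act n (l - 1)) (rev [Suc i..<Suc n]) v = s_act n i y"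
    using i by (simp add: y_def upt_conv_Cons del: upt_Suc)
  also have "s_act n i y = (\<lambda>a. case a of
      Pos l \<Rightarrow> if l = i then (- 1) ^ (n - i) * v (Pos n) else if i < l \<and> l \<le> n then v (Pos (l - 1)) else v (Pos l)
    | Mid \<Rightarrow> v Mid
    | Neg l \<Rightarrow> if l = i then (- 1) ^ (n - i) * v (Neg n) else if i < l \<and> l \<le> n then v (Neg (l - 1)) else v (Neg l))"
    (is "_ = ?r")
  proof
    fix a
    show "s_act n i y a = ?r a"
    proof (cases a)
      case (Pos l)
      consider "l = Suc i" | "l = i" | "l < i" | "Suc i < l" by linarith
      then show ?thesis using Pos i by cases (simp_all add: s_act_eq y e)
    next
      case (Neg l)
      consider "l = Suc i" | "l = i" | "l < i" | "Suc i < l" by linarith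
      then show ?thesis using Neg i by cases (simp_all add: s_act_eq y e)
    qed (use i in \<open>simp add: s_act_eq y\<close>)
  qed
  finally show ?case .
qed

text \<open>The ascending letters carry the entry at i up to n, the middle letter exchanges it there
  with its opposite, and the descending letters carry it back with one sign each. The other entries
  of the inner block are moved down with a sign and returned without one, and the middle letter
  negates Mid.\<close>

lemma weyl_act_row:
  assumes "1 \<le> i" "i \<le> n"
  shows "weyl_act n (row_word n i) v = (\<lambda>a. if a \<in> {Pos i, Neg i} then (- 1) ^ (Suc n - i) * flip v a
    else if a \<in> block n (Suc i) then - v a else v a)"
proof -
  define y where "y = fold (\<lambda>l. s_act n (l - 1)) [Suc i..<Suc n] v"
  define z where "z = s_act n n y"
  have "weyl_act n (row_word n i) v = fold (\<lambda>l. s_act n (l - 1)) (rev [Suc i..<Suc n]) z"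
    by (simp add: weyl_act_def row_word_def fold_map comp_def rev_map y_def z_def del: upt_Suc)
  then have w: "weyl_act n (row_word n i) v (Pos l) = (if l = i then (- 1) ^ (n - i) * z (Pos n) else if i < l \<and> l \<le> n then z (Pos (l - 1)) else z (Pos l))"
    "weyl_act n (row_word n i) v (Neg l) = (if l = i then (- 1) ^ (n - i) * z (Neg n) else if i < l \<and> l \<le> n then z (Neg (l - 1)) else z (Neg l))"
    "weyl_act n (row_word n i) v Mid = z Mid" for l
    unfolding fold_descending_sb[OF assms(2)] by simp_all
  have y: "y (Pos l) = (if l = n then v (Pos i) else if i \<le> l \<and> l < n then - v (Pos (Suc l)) else v (Pos l))"
    "y (Neg l) = (if l = n then v (Neg i) else if i \<le> l \<and> l < n then - v (Neg (Suc l)) else v (Neg l))" "y Mid = v Mid" for l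
    unfolding y_def fold_ascending_sb[OF assms(2) order_refl] by simp_all
  have z: "z (Pos l) = (if l = n then - y (Neg n) else y (Pos l))" "z (Neg l) = (if l = n then - y (Pos n) else y (Neg l))"
    "z Mid = - y Mid" for l
    unfolding z_def s_act_eq by simp_all
  have e: "Suc n - i = Suc (n - i)" using assms by simp
  show ?thesis
  proof
    fix a
    show "weyl_act n (row_word n i) v a = (if a \<in> {Pos i, Neg i} then (- 1) ^ (Suc n - i) * flip v a
      else if a \<in> block n (Suc i) then - v a else v a)"
    proof (cases a)
      case (Pos l)
      consider "l = i" | "i < l" "l \<le> n" | "l < i" | "n < l" by linarith
      then show ?thesis
      proof cases
        case 2
        then obtain m where "l = Suc m" "i \<le> m" "m < n" by (cases l) auto
        then show ?thesis using Pos by (simp add: w z y)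
      qed (use Pos assms in \<open>simp_all add: w z y e\<close>)
    next
      case (Neg l)
      consider "l = i" | "i < l" "l \<le> n" | "l < i" | "n < l" by linarith
      then show ?thesis
      proof cases
        case 2
        then obtain m where "l = Suc m" "i \<le> m" "m < n" by (cases l) auto
        then show ?thesis using Neg by (simp add: w z y)
      qed (use Neg assms in \<open>simp_all add: w z y e\<close>)
    qed (simp add: w z y)
  qed
qed

text \<open>Each further row negates the whole inner block, so the sign accumulated inside always
  agrees with the sign that the row gives to its own pair. One global sign remains.\<close>

lemma weyl_act_tail:
  assumes "1 \<le> i" "i \<le> Suc n"
  shows "weyl_act n (tail_word n i) v = (\<lambda>a. if a \<in> block n i then (- 1) ^ (Suc n - i) * flip v a else v a)"
  using assms(2,1)
proof (induction i rule: inc_induct)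
  case base
  have "(if a \<in> block n (Suc n) then (- 1) ^ (Suc n - Suc n) * flip v a else v a) = v a" for a
    by (cases a) simp_all
  then show ?case by (simp add: tail_word_Suc_n weyl_act_def)
next
  case (step i)
  then have i: "1 \<le> i" "i \<le> n" by auto
  have e: "Suc n - i = Suc (Suc n - Suc i)" using i by simp
  define u where "u = weyl_act n (tail_word n (Suc i)) v"
  have u: "u a = (if a \<in> block n (Suc i) then (- 1) ^ (Suc n - Suc i) * flip v a else v a)" for a
    unfolding u_def using step.IH by simp
  show ?case
  proof
    fix a
    have "weyl_act n (tail_word n i) v a = (if a \<in> {Pos i, Neg i} then (- 1) ^ (Suc n - i) * flip u a
      else if a \<in> block n (Suc i) then - u a else u a)"
      unfolding tail_word_step[OF i(2)] weyl_act_append weyl_act_row[OF i] u_def ..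
    also have "\<dots> = (if a \<in> block n i then (- 1) ^ (Suc n - i) * flip v a else v a)"
    proof (cases "a \<in> {Pos i, Neg i}")
      case True
      then show ?thesis using i by (auto simp: u)
    next
      case False
      then have "a \<in> block n i \<longleftrightarrow> a \<in> block n (Suc i)" using i by (simp add: block_Suc)
      then show ?thesis using False by (simp add: u e)
    qed
    finally show "weyl_act n (tail_word n i) v a = (if a \<in> block n i then (- 1) ^ (Suc n - i) * flip v a else v a)" .
  qed
qed

section \<open>Bookkeeping for the coordinates and the monomials of the factorization\<close>

fun ixpos :: "nat \<Rightarrow> ix \<Rightarrow> nat" where
  "ixpos n (Pos k) = k - 1" | "ixpos n Mid = n" | "ixpos n (Neg k) = 2 * n + 1 - k"

fun row_of :: "coord \<Rightarrow> nat" where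
  "row_of (DblA k l) = k" | "row_of (DblB k l) = k" | "row_of (Sgl k) = k"

lemma row_of_word: "w \<in> set (row_word n i) \<Longrightarrow> row_of (snd w) = i"
  by (auto simp: row_word_def)

lemma row_of_tail: "w \<in> set (tail_word n i) \<Longrightarrow> i \<le> row_of (snd w) \<and> row_of (snd w) \<le> n"
  by (auto simp: tail_word_def row_of_word)

lemma coords_iff [simp]:
  "DblA k l \<in> coords n \<longleftrightarrow> 1 \<le> k \<and> k < l \<and> l \<le> n"
  "DblB k l \<in> coords n \<longleftrightarrow> 1 \<le> k \<and> k < l \<and> l \<le> n"
  "Sgl k \<in> coords n \<longleftrightarrow> 1 \<le> k \<and> k \<le> n"
  by (auto simp: coords_def pairs_def image_iff)

lemma positiveD:
  assumes "positive n t"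
  shows "1 \<le> k \<Longrightarrow> k < l \<Longrightarrow> l \<le> n \<Longrightarrow> 0 < t (DblA k l)"
    and "1 \<le> k \<Longrightarrow> k < l \<Longrightarrow> l \<le> n \<Longrightarrow> 0 < t (DblB k l)"
    and "1 \<le> k \<Longrightarrow> k \<le> n \<Longrightarrow> 0 < t (Sgl k)"
  using assms by (simp_all add: positive_def)

text \<open>The torus parameters that row k hands on to the rows inside it, whose letters are
  rescaled by quotients of neighbouring values. The value 1 in column n + 1 is the convention for
  the short root.\<close>

definition ratio :: "nat \<Rightarrow> (coord \<Rightarrow> real) \<Rightarrow> nat \<Rightarrow> nat \<Rightarrow> real" where
  "ratio n t k l = (if l \<le> n then t (DblA k l) / t (DblB k l) else 1)"

text \<open>Column n + 1 stands for the middle coordinate of the row, which makes the formulas for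
  all letters uniform.\<close>

definition tcol :: "nat \<Rightarrow> (coord \<Rightarrow> real) \<Rightarrow> nat \<Rightarrow> nat \<Rightarrow> real" where
  "tcol n t k l = (if l \<le> n then t (DblA k l) else t (Sgl k))"

text \<open>Row \<open>k\<close> is rescaled by the torus parts split off by the rows \<open>i, \<dots>, k - 1\<close>.\<close>

definition potA :: "nat \<Rightarrow> nat \<Rightarrow> (coord \<Rightarrow> real) \<Rightarrow> nat \<Rightarrow> nat \<Rightarrow> real" where
  "potA n i t k l = (\<Prod>m\<in>{i..<k}. ratio n t m (l - 1) / ratio n t m l) / tcol n t k l"

definition potB :: "nat \<Rightarrow> nat \<Rightarrow> (coord \<Rightarrow> real) \<Rightarrow> nat \<Rightarrow> nat \<Rightarrow> real" where
  "potB n i t k l = ratio n t k l * potA n i t k (Suc l)"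

definition potential :: "nat \<Rightarrow> nat \<Rightarrow> (coord \<Rightarrow> real) \<Rightarrow> real" where
  "potential n i t = (\<Sum>k\<in>{i..n}. (\<Sum>l\<in>{k<..Suc n}. potA n i t k l) + (\<Sum>l\<in>{k<..n}. potB n i t k l))"

definition torus_part :: "nat \<Rightarrow> nat \<Rightarrow> (coord \<Rightarrow> real) \<Rightarrow> nat \<Rightarrow> real" where
  "torus_part n i t k = (\<Prod>l\<in>{k<..n}. t (DblB k l) * t (DblA k l)) * (t (Sgl k))\<^sup>2 / (\<Prod>m\<in>{i..<k}. ratio n t m k)"

definition row_sum :: "nat \<Rightarrow> (coord \<Rightarrow> real) \<Rightarrow> nat \<Rightarrow> real" where
  "row_sum n t k = (\<Sum>l\<in>{k<..n}. t (DblA k l) + t (DblB k l)) + t (Sgl k)"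

text \<open>The coordinates of the inner rows after the torus element with entries
  \<open>ratio n t i\<close> has been moved through them.\<close>

fun rescale :: "nat \<Rightarrow> nat \<Rightarrow> (coord \<Rightarrow> real) \<Rightarrow> coord \<Rightarrow> real" where
  "rescale n i t (DblA k l) = (if i < k \<and> k < l \<and> l \<le> n then t (DblA k l) * ratio n t i l / ratio n t i (l - 1) else t (DblA k l))"
| "rescale n i t (DblB k l) = (if i < k \<and> k < l \<and> l \<le> n then t (DblB k l) * ratio n t i l / ratio n t i (l - 1) else t (DblB k l))"
| "rescale n i t (Sgl k) = (if i < k \<and> k \<le> n then t (Sgl k) / ratio n t i n else t (Sgl k))"

lemma ratio_pos:
  assumes "positive n t" "1 \<le> k" "k < l"
  shows "0 < ratio n t k l"
  using positiveD(1,2)[OF assms(1), of k l] assms by (auto simp: ratio_def)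

lemma positive_rescale:
  assumes "positive n t" "1 \<le> i"
  shows "positive n (rescale n i t)"
  unfolding positive_def
proof
  fix a assume a: "a \<in> coords n"
  note r = ratio_pos[OF assms(1), where k = i]
  show "0 < rescale n i t a"
  proof (cases a)
    case (DblA k l)
    with a have "0 < t (DblA k l)" using assms by (simp add: positive_def)
    then show ?thesis using DblA r[of l] r[of "l - 1"] assms(2) by auto
  next
    case (DblB k l)
    with a have "0 < t (DblB k l)" using assms by (simp add: positive_def)
    then show ?thesis using DblB r[of l] r[of "l - 1"] assms(2) by auto
  next
    case (Sgl k)
    with a have "0 < t (Sgl k)" using assms by (simp add: positive_def)
    then show ?thesis using Sgl r[of n] assms(2) by auto
  qed
qed

text \<open>Both coordinates of a column are rescaled by the same factor. Hence the ratios handed on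
  by deeper rows do not change, and the scalings of successive rows simply multiply.\<close>

lemma ratio_rescale:
  assumes "positive n t" "1 \<le> i" "i < k" "k < l"
  shows "ratio n (rescale n i t) k l = ratio n t k l"
proof -
  have "0 < ratio n t i l" "0 < ratio n t i (l - 1)"
    using assms by (auto intro!: ratio_pos)
  then show ?thesis using assms by (simp add: ratio_def[where k = k])
qed

lemma tcol_rescale:
  assumes "positive n t" "1 \<le> i" "i < k" "k < l" "l \<le> Suc n"
  shows "tcol n (rescale n i t) k l = tcol n t k l * ratio n t i l / ratio n t i (l - 1)"
proof (cases "l \<le> n")
  case False
  then have "l = Suc n" using assms by simp
  then show ?thesis using assms by (simp add: tcol_def) (simp add: ratio_def)
qed (use assms in \<open>simp add: tcol_def\<close>)

lemma potA_rescale: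
  assumes "positive n t" "1 \<le> i" "i < k" "k < l" "l \<le> Suc n"
  shows "potA n (Suc i) (rescale n i t) k l = potA n i t k l"
proof -
  have "{i..<k} = insert i {Suc i..<k}" using assms by auto
  moreover have "(\<Prod>m\<in>{Suc i..<k}. ratio n (rescale n i t) m (l - 1) / ratio n (rescale n i t) m l)
      = (\<Prod>m\<in>{Suc i..<k}. ratio n t m (l - 1) / ratio n t m l)"
    using assms by (intro prod.cong) (auto simp: ratio_rescale)
  ultimately show ?thesis
    using assms by (simp add: potA_def tcol_rescale mult_ac)
qed

lemma potential_rescale:
  assumes "positive n t" "1 \<le> i" "i \<le> n"
  shows "potential n i t = (\<Sum>l\<in>{i<..Suc n}. potA n i t i l) + (\<Sum>l\<in>{i<..n}. potB n i t i l)
      + potential n (Suc i) (rescale n i t)"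
proof -
  have "{i..n} = insert i {Suc i..n}" using assms by auto
  moreover have "(\<Sum>k\<in>{Suc i..n}. (\<Sum>l\<in>{k<..Suc n}. potA n i t k l) + (\<Sum>l\<in>{k<..n}. potB n i t k l))
      = potential n (Suc i) (rescale n i t)"
    unfolding potential_def using assms
    by (intro sum.cong refl arg_cong2[where f = "(+)"]) (auto simp: potA_rescale potB_def ratio_rescale)
  ultimately show ?thesis by (simp add: potential_def)
qed

lemma torus_part_rescale:
  assumes t: "positive n t" and i: "1 \<le> i" "i < k" "k \<le> n"
  shows "torus_part n i t k = ratio n t i k * torus_part n (Suc i) (rescale n i t) k"
proof -
  have rp: "0 < ratio n t i l" if "k \<le> l" for l using ratio_pos[OF t i(1), where l = l] that i by simp
  \<comment> \<open>The factors telescope along the row, and each occurs twice, for the two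
    coordinates of a column. The square of the middle coordinate later cancels the ratio at n, so
    only the ratio at k survives.\<close>
  have "(\<Prod>l\<in>{k<..m}. rescale n i t (DblB k l) * rescale n i t (DblA k l))
      = (\<Prod>l\<in>{k<..m}. t (DblB k l) * t (DblA k l)) * (ratio n t i m / ratio n t i k)\<^sup>2" if "k \<le> m" "m \<le> n" for m
    using that
  proof (induction m rule: dec_induct)
    case base
    then show ?case using rp[of k] by simp
  next
    case (step m)
    have "{k<..Suc m} = insert (Suc m) {k<..m}" using step.hyps by auto
    with step rp[of k] rp[of m] rp[of "Suc m"] i show ?case
      by (simp add: field_simps power2_eq_square)
  qed
  from this[of n] have A: "(\<Prod>l\<in>{k<..n}. rescale n i t (DblB k l) * rescale n i t (DblA k l))
      = (\<Prod>l\<in>{k<..n}. t (DblB k l) * t (DblA k l)) * (ratio n t i n / ratio n t i k)\<^sup>2"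
    using i by simp
  have "(\<Prod>m\<in>{Suc i..<k}. ratio n (rescale n i t) m k) = (\<Prod>m\<in>{Suc i..<k}. ratio n t m k)"
    using t i by (intro prod.cong) (auto simp: ratio_rescale)
  moreover have "{i..<k} = insert i {Suc i..<k}" using i by auto
  ultimately show ?thesis
    unfolding torus_part_def A using rp[of k] rp[of n] i by (simp add: power2_eq_square field_simps)
qed

lemma cfrac_pos: "positive n t \<Longrightarrow> 1 \<le> k \<Longrightarrow> l \<le> n \<Longrightarrow> 0 < cfrac t k l"
proof (cases "l \<le> k")
  case False
  assume "positive n t" "1 \<le> k" "l \<le> n"
  with False have "0 < t (DblA k l)" "0 < t (DblB k l)" using positiveD(1,2)[of n t k l] by simp_all
  then show ?thesis using False by (simp add: cfrac_def add_pos_pos)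
qed (simp add: cfrac_def)

text \<open>In the sum of the two twisted coordinates of a column the denominator s + t cancels.
  What remains is the reciprocal of \<open>cfrac\<close> for the preceding column, which is 1 + t /
  s there, or 1 at the start of the row. So each letter contributes at most two monomials.\<close>

lemma row_sum_twist:
  assumes t: "positive n t" and i: "1 \<le> i" "i \<le> n"
  shows "row_sum n (twist n t) i = (\<Sum>l\<in>{i<..Suc n}. potA n i t i l) + (\<Sum>l\<in>{i<..n}. potB n i t i l)"
proof -
  define c where "c l = (if l \<le> i then 0 else ratio n t i l)" for l
  have cf: "1 / cfrac t i l = 1 + c l" if "l \<le> n" for l
    using positiveD(1,2)[OF t, of i l] i that by (auto simp: cfrac_def c_def ratio_def field_simps)
  have "twist n t (DblA i l) + twist n t (DblB i l) = (1 + c (l - 1)) / t (DblA i l)" if "l \<in> {i<..n}" for l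
  proof -
    have p: "0 < t (DblA i l)" "0 < t (DblB i l)" "0 < cfrac t i (l - 1)"
      using positiveD(1,2)[OF t, of i l] that i t by (auto intro!: cfrac_pos)
    then have "t (DblB i l) + t (DblA i l) \<noteq> 0" by simp
    with p have "twist n t (DblA i l) + twist n t (DblB i l) = (1 / cfrac t i (l - 1)) / t (DblA i l)"
      by (simp add: divide_simps)
    also have "1 / cfrac t i (l - 1) = 1 + c (l - 1)" by (rule cf) (use that in \<open>simp, linarith\<close>)
    finally show ?thesis .
  qed
  moreover have "twist n t (Sgl i) = (1 + c n) / t (Sgl i)"
    using cf[of n] by (simp add: divide_divide_eq_left[symmetric])
  ultimately have "row_sum n (twist n t) i = (\<Sum>l\<in>{i<..n}. (1 + c (l - 1)) / tcol n t i l) + (1 + c n) / tcol n t i (Suc n)"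
    by (simp add: row_sum_def tcol_def)
  also have "\<dots> = (\<Sum>l\<in>{i<..Suc n}. (1 + c (l - 1)) / tcol n t i l)"
  proof -
    have "{i<..Suc n} = insert (Suc n) {i<..n}" using i by auto
    then show ?thesis by simp
  qed
  also have "\<dots> = (\<Sum>l\<in>{i<..Suc n}. potA n i t i l) + (\<Sum>l\<in>{i<..Suc n}. c (l - 1) / tcol n t i l)"
    by (simp add: potA_def add_divide_distrib sum.distrib)
  \<comment> \<open>Shifting the column by one turns the second monomials into \<open>potB\<close>;
    the extra term at l = i is 0 because \<open>c\<close> vanishes there.\<close>
  also have "(\<Sum>l\<in>{i<..Suc n}. c (l - 1) / tcol n t i l) = (\<Sum>l\<in>{i..n}. c l / tcol n t i (Suc l))"
    by (rule sum.reindex_bij_witness[of _ Suc "\<lambda>l. l - 1"]) auto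
  also have "\<dots> = (\<Sum>l\<in>{i<..n}. potB n i t i l)"
  proof -
    have "{i..n} = insert i {i<..n}" using i by auto
    then show ?thesis by (simp add: c_def potB_def potA_def)
  qed
  finally show ?thesis .
qed

lemma twist_pos:
  assumes t: "positive n t" and a: "a \<in> coords n"
  shows "0 < twist n t a"
proof (cases a)
  case (DblA k l)
  then have "0 < t (DblA k l)" "0 < t (DblB k l)" "0 < cfrac t k (l - 1)"
    using a positiveD(1,2)[OF t, of k l] cfrac_pos[OF t, of k "l - 1"] by auto
  then show ?thesis using DblA by (simp add: add_pos_pos)
next
  case (DblB k l)
  then have "0 < t (DblA k l)" "0 < t (DblB k l)" "0 < cfrac t k (l - 1)"
    using a positiveD(1,2)[OF t, of k l] cfrac_pos[OF t, of k "l - 1"] by auto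
  then show ?thesis using DblB by (simp add: add_pos_pos)
next
  case (Sgl k)
  then have "0 < t (Sgl k)" "0 < cfrac t k n"
    using a positiveD(3)[OF t, of k] cfrac_pos[OF t, of k n] by auto
  then show ?thesis using Sgl by simp
qed

section \<open>Existence and uniqueness of the triangular factorization\<close>

definition diag_entry :: "(nat \<Rightarrow> real) \<Rightarrow> ix \<Rightarrow> real" where
  "diag_entry T a = (case a of Pos k \<Rightarrow> T k | Mid \<Rightarrow> 1 | Neg k \<Rightarrow> 1 / T k)"

text \<open>Expresses that \<open>u\<close> can serve as row \<open>a\<close> of Y T with Y lower
  unipotent, restricted to the coordinates of the block.\<close>

definition lower_row :: "nat \<Rightarrow> nat \<Rightarrow> (nat \<Rightarrow> real) \<Rightarrow> ix \<Rightarrow> (ix \<Rightarrow> real) \<Rightarrow> bool" where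
  "lower_row n i T a u \<longleftrightarrow> supported (block n i) u \<and> (\<forall>b. ixpos n a < ixpos n b \<longrightarrow> u b = 0) \<and> u a = diag_entry T a"

lemma tail_word_cases:
  assumes "w \<in> set (tail_word n i)"
  obtains k l where "i \<le> k" "k < l" "l \<le> n" "w = (l - 1, DblA k l)"
  | k l where "i \<le> k" "k < l" "l \<le> n" "w = (l - 1, DblB k l)"
  | k where "i \<le> k" "k \<le> n" "w = (n, Sgl k)"
  using assms by (auto simp: tail_word_def row_word_def)

lemma split_pairing_commute: "split_pairing n v w = split_pairing n w v"
  by (simp add: split_pairing_def mult.commute add.commute)

lemma flip_scale: "flip (\<lambda>b. c * v b) = (\<lambda>b. c * flip v b)"
proof
  fix a show "flip (\<lambda>b. c * v b) a = c * flip v a" by (cases a) simp_all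
qed

lemma flip_basis: "flip (basis (Neg i)) = basis (Pos i)"
proof
  fix a show "flip (basis (Neg i)) a = basis (Pos i) a" by (cases a) (simp_all add: basis_def)
qed

lemma supported_basis: "a \<in> S \<Longrightarrow> supported S (basis a)"
  by (auto simp: supported_def basis_def)

text \<open>A path from Pos i to Neg i has to use every letter of the row: up through the ascending
  letters, across by the quadratic part of the middle one, back through the descending ones. The
  entry is therefore a single monomial.\<close>

lemma first_row_corner:
  assumes i: "1 \<le> i" "i \<le> n"
  shows "word_act n (\<lambda>a. - t a) (row_word n i) (basis (Pos i)) (Neg i) = (- 1) ^ (Suc n - i) * torus_part n i t i"
proof -
  define w where "w = word_act n (\<lambda>a. - t a) (row_word n i) (basis (Pos i))"
  obtain x where "row_rel n i (\<lambda>a. - t a) (basis (Pos i)) x w"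
    unfolding w_def by (rule row_action[OF i(2)])
  note R = row_relD[OF this]
  have xl: "x l = (- 1) ^ (l - i) * (\<Prod>m\<in>{i<..l}. t (DblB i m))" if "i \<le> l" "l \<le> n" for l
    using that
  proof (induction l rule: dec_induct)
    case base
    then show ?case by (simp add: R(1) basis_def)
  next
    case (step l)
    have "{i<..Suc l} = insert (Suc l) {i<..l}" "Suc l - i = Suc (l - i)" using step.hyps by auto
    then show ?case using step R(2)[of l] by (simp add: basis_def)
  qed
  have "w (Neg l) = (\<Prod>m\<in>{l<..n}. t (DblA i m)) * w (Neg n)" if "i \<le> l" "l \<le> n" for l
    using that(2,1)
  proof (induction l rule: inc_induct)
    case base
    then show ?case by simp
  next
    case (step l)
    have "{l<..n} = insert (Suc l) {Suc l<..n}" using step.hyps by auto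
    then show ?case using step R(7)[of l] by (simp add: basis_def)
  qed
  then have "w (Neg i) = (\<Prod>m\<in>{i<..n}. t (DblA i m)) * (- ((t (Sgl i))\<^sup>2 * x n))"
    using i R(6) by (simp add: basis_def)
  also have "\<dots> = (- 1) ^ (Suc n - i) * torus_part n i t i"
  proof -
    have "Suc n - i = Suc (n - i)" using i by simp
    then show ?thesis using xl[of n] i by (simp add: torus_part_def prod.distrib)
  qed
  finally show ?thesis unfolding w_def .
qed

lemma torus_part_pos:
  assumes t: "positive n t" and i: "1 \<le> i" and k: "i \<le> k" "k \<le> n"
  shows "0 < torus_part n i t k"
proof -
  have "0 < (\<Prod>l\<in>{k<..n}. t (DblB k l) * t (DblA k l))"
    using positiveD(1,2)[OF t, of k] i k by (intro prod_pos) auto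
  moreover have "0 < t (Sgl k)" using positiveD(3)[OF t, of k] i k by simp
  moreover have "0 < (\<Prod>m\<in>{i..<k}. ratio n t m k)"
    using ratio_pos[OF t] i by (intro prod_pos) auto
  ultimately show ?thesis by (simp add: torus_part_def)
qed

text \<open>The row \<open>R\<close> is handled by \<open>flip_row_action\<close>, which passes the
  problem for the inner factor \<open>Z\<close> on together with the torus element \<open>D\<close>.
  Pushing \<open>D\<close> through \<open>Z\<close> rescales the coordinates, and the hypotheses
  concern these rescaled coordinates. They yield the rows of the inner block; row Pos i is computed
  directly, and row Neg i, to which \<open>flip_row_action\<close> does not apply, comes from the
  invariant form.\<close>

lemma factorization_step:
  assumes i: "1 \<le> i" "i \<le> n" and t: "positive n t"
    and p': "positive n p'"
    and u': "\<And>a. a \<in> block n (Suc i) \<Longrightarrow> lower_row n (Suc i) (torus_part n (Suc i) (rescale n i t)) a (u' a)"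
    and eq: "\<And>a. a \<in> block n (Suc i) \<Longrightarrow>
      (\<lambda>b. (- 1) ^ (Suc n - Suc i) * flip (word_act n (\<lambda>a. - rescale n i t a) (tail_word n (Suc i)) (basis a)) b)
      = word_act n p' (tail_word n (Suc i)) (u' a)"
  defines "p \<equiv> \<lambda>a. if row_of a = i then twist n t a else p' a"
  shows "\<exists>u. \<forall>a\<in>block n i. lower_row n i (torus_part n i t) a (u a) \<and>
      (\<lambda>b. (- 1) ^ (Suc n - i) * flip (word_act n (\<lambda>a. - t a) (tail_word n i) (basis a)) b) = word_act n p (tail_word n i) (u a)"
proof -
  define D where "D = ratio n t i"
  define T where "T = torus_part n i t"
  define T' where "T' = torus_part n (Suc i) (rescale n i t)"
  define \<epsilon> :: real where "\<epsilon> = (- 1) ^ (Suc n - i)"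
  define \<epsilon>' :: real where "\<epsilon>' = (- 1) ^ (Suc n - Suc i)"
  define Z where "Z = word_act n (\<lambda>a. - t a) (tail_word n (Suc i))"
  define R where "R = word_act n (\<lambda>a. - t a) (row_word n i)"
  define Zp where "Zp = word_act n p (tail_word n (Suc i))"
  define Rp where "Rp = word_act n p (row_word n i)"
  have "Suc n - i = Suc (Suc n - Suc i)" using i by simp
  then have \<epsilon>: "\<epsilon> = - \<epsilon>'" "\<epsilon> * \<epsilon> = 1"
    by (simp_all add: \<epsilon>_def \<epsilon>'_def flip: power_mult_distrib)
  have Zp: "Zp = word_act n p' (tail_word n (Suc i))"
    unfolding Zp_def p_def using row_of_tail by (intro ext word_act_cong) force
  have D: "0 < D l" if "Suc i \<le> l" for l
    using ratio_pos[OF t i(1), of l] that by (simp add: D_def)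
  have letters: "\<And>w. w \<in> set (tail_word n (Suc i)) \<Longrightarrow> Suc i \<le> fst w \<and> fst w \<le> n"
    "\<And>w. w \<in> set (row_word n i) \<Longrightarrow> i \<le> fst w \<and> fst w \<le> n"
    using tail_word_letters[of _ n "Suc i"] row_word_letters[of _ n i] i by auto
  have Zfix: "word_act n c (tail_word n (Suc i)) v = v" if "\<And>b. b \<in> block n (Suc i) \<Longrightarrow> v b = 0" for c v
    by (rule word_act_fixes[OF letters(1) that])
  \<comment> \<open>Away from Pos i and Neg i the vector handed on is - flip (D v). Since no
    coordinate lives in column i, the value D i has no meaning, and the entry at Neg i is put to 0
    explicitly.\<close>
  have flipR: "flip (R v) = Rp (\<lambda>b. R v (Neg i) * basis (Pos i) b - (if b = Neg i then 0 else flip (torus_act n D v) b))"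
    (is "_ = Rp ?V") if v: "supported (block n i) v" "v (Neg i) = 0" for v
    unfolding R_def Rp_def
  proof (rule flip_row_action[OF i(2)])
    show "0 < t (Sgl i)" using positiveD(3)[OF t, of i] i by simp
    show "\<And>l. i < l \<Longrightarrow> l \<le> n \<Longrightarrow> 0 < t (DblA i l)" "\<And>l. i < l \<Longrightarrow> l \<le> n \<Longrightarrow> 0 < t (DblB i l)"
      using positiveD(1,2)[OF t, of i] i by simp_all
    show "supported (block n i) (\<lambda>b. word_act n (\<lambda>a. - t a) (row_word n i) v (Neg i) * basis (Pos i) b - (if b = Neg i then 0 else flip (torus_act n D v) b))"
      unfolding supported_def
    proof (intro allI impI)
      fix b assume "b \<notin> block n i"
      then show "word_act n (\<lambda>a. - t a) (row_word n i) v (Neg i) * basis (Pos i) b - (if b = Neg i then 0 else flip (torus_act n D v) b) = 0"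
        using v(1) i by (cases b) (auto simp: supported_def basis_def)
    qed
  qed (use v i in \<open>auto simp: p_def basis_def D_def ratio_def\<close>)
  have Rp_scale: "Rp (\<lambda>b. c * v b) = (\<lambda>b. c * Rp v b)" for c v
    unfolding Rp_def by (rule word_act_scale)
  define y where "y = R (basis (Pos i)) (Neg i)"
  have y: "\<epsilon> * y = T i" "T i > 0"
    using first_row_corner[OF i, of t] \<epsilon>(2) torus_part_pos[OF t i(1) order_refl i(2)]
    by (simp_all add: y_def R_def \<epsilon>_def T_def mult.assoc[symmetric])
  have first: "flip (R (basis (Pos i))) = Rp (\<lambda>b. y * basis (Pos i) b)"
  proof -
    have "(\<lambda>b. R (basis (Pos i)) (Neg i) * basis (Pos i) b - (if b = Neg i then 0 else flip (torus_act n D (basis (Pos i))) b))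
      = (\<lambda>b. y * basis (Pos i) b)"
    proof
      fix b show "R (basis (Pos i)) (Neg i) * basis (Pos i) b - (if b = Neg i then 0 else flip (torus_act n D (basis (Pos i))) b)
      = y * basis (Pos i) b" by (cases b) (auto simp: basis_def y_def)
    qed
    then show ?thesis using flipR[of "basis (Pos i)"] i by (simp add: supported_basis) (simp add: basis_def)
  qed
  \<comment> \<open>Here v (Neg i) is not 0. All operators are invertible, so a preimage exists, and
    only its support and its entry at Neg i have to be determined.\<close>
  have last: "\<exists>u. supported (block n i) u \<and> u (Neg i) = 1 / T i \<and>
      (\<lambda>b. \<epsilon> * flip (R (Z (basis (Neg i)))) b) = Rp (Zp u)"
  proof -
    define V where "V = word_act n (\<lambda>a. - p a) (rev (row_word n i)) (basis (Pos i))"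
    define u where "u = word_act n (\<lambda>a. - p a) (rev (tail_word n (Suc i))) V"
    have V: "Rp V = basis (Pos i)" unfolding V_def Rp_def by (rule word_act_inverse')
    have u: "Zp u = V" unfolding u_def Zp_def by (rule word_act_inverse')
    have "supported (block n i) V"
      unfolding V_def using letters(2) i by (intro supported_wop supported_basis) auto
    moreover have uV: "u b = V b" if "b \<notin> block n (Suc i)" for b
      unfolding u_def using letters(1) that by (intro word_act_outside[where i = "Suc i"]) auto
    ultimately have su: "supported (block n i) u"
      using block_mono[of i "Suc i" n] by (force simp: supported_def)
    \<comment> \<open>The entry at Neg i is the pairing with Pos i. By invariance it may be computed
      after applying \<open>Rp\<close>, where \<open>V\<close> itself becomes a basis
      vector.\<close>
    have "V (Neg i) = split_pairing n (Rp V) (Rp (basis (Pos i)))"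
    proof -
      have "1 \<le> fst w \<and> fst w \<le> n" if "w \<in> set (row_word n i)" for w
        using letters(2)[OF that] i by simp
      from split_pairing_wop[OF this, where ws = "row_word n i"] show ?thesis
        unfolding Rp_def using i by (simp add: split_pairing_basis)
    qed
    also have "\<dots> = Rp (basis (Pos i)) (Neg i)"
      unfolding V using i by (subst split_pairing_commute) (simp add: split_pairing_basis)
    finally have "y * V (Neg i) = Rp (\<lambda>b. y * basis (Pos i) b) (Neg i)" by (simp add: Rp_scale)
    also have "\<dots> = R (basis (Pos i)) (Pos i)" unfolding first[symmetric] by simp
    also have "\<dots> = 1"
    proof -
      obtain x where "row_rel n i (\<lambda>a. - t a) (basis (Pos i)) x (R (basis (Pos i)))"
        unfolding R_def by (rule row_action[OF i(2)])
      from row_relD(1,3)[OF this] show ?thesis by (simp add: basis_def)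
    qed
    finally have yV: "y * V (Neg i) = 1" .
    have "Z (basis (Neg i)) = basis (Neg i)"
      unfolding Z_def by (rule Zfix) (auto simp: basis_def)
    moreover have "R (basis (Neg i)) = basis (Neg i)"
    proof
      fix b
      obtain x where "row_rel n i (\<lambda>a. - t a) (basis (Neg i)) x (R (basis (Neg i)))"
        unfolding R_def by (rule row_action[OF i(2)])
      note r = row_relD[OF this]
      have x: "x l = 0" if "i \<le> l" "l \<le> n" for l
        using that by (induction l rule: dec_induct) (use r(1,2) in \<open>auto simp: basis_def\<close>)
      have P: "R (basis (Neg i)) (Pos l) = 0" for l
      proof (cases "i < l \<and> l \<le> n")
        case True
        then obtain m where "l = Suc m" "i \<le> m" "m < n" by (cases l) auto
        then show ?thesis using r(4)[of m] x by simp
      next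
        case False
        then show ?thesis using r(3) x[of i] r(8)[of l] i by (cases "l = i") (auto simp: basis_def)
      qed
      have N: "R (basis (Neg i)) (Neg l) = basis (Neg i) (Neg l)" if "i \<le> l" "l \<le> n" for l
        using that(2,1)
      proof (induction l rule: inc_induct)
        case base
        then show ?case using r(6) x[of n] i by (simp add: basis_def)
      next
        case (step l)
        then show ?case using r(7)[of l] by (simp add: basis_def)
      qed
      show "R (basis (Neg i)) b = basis (Neg i) b"
      proof (cases b)
        case (Neg l)
        then show ?thesis using N[of l] r(8)[of l] by (cases "i \<le> l \<and> l \<le> n") auto
      qed (use P r(5) x[of n] i in \<open>auto simp: basis_def\<close>)
    qed
    ultimately have "flip (R (Z (basis (Neg i)))) = basis (Pos i)" by (simp add: flip_basis)
    then have "(\<lambda>b. \<epsilon> * flip (R (Z (basis (Neg i)))) b) = (\<lambda>b. \<epsilon> * Rp (Zp u) b)" by (simp add: u V)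
    also have "\<dots> = Rp (Zp (\<lambda>b. \<epsilon> * u b))" unfolding Rp_def Zp_def by (simp add: word_act_scale)
    finally have "(\<lambda>b. \<epsilon> * flip (R (Z (basis (Neg i)))) b) = Rp (Zp (\<lambda>b. \<epsilon> * u b))" .
    moreover have "\<epsilon> * u (Neg i) = 1 / T i"
    proof -
      have "u (Neg i) = V (Neg i)" by (rule uV) simp
      then have "T i * (\<epsilon> * u (Neg i)) = 1"
        using yV \<epsilon>(2) unfolding y(1)[symmetric] by (simp add: mult_ac)
      then show ?thesis using y(2) by (simp add: field_simps)
    qed
    moreover have "supported (block n i) (\<lambda>b. \<epsilon> * u b)" using su by (simp add: supported_def)
    ultimately show ?thesis by blast
  qed
  then obtain uN where uN: "supported (block n i) uN" "uN (Neg i) = 1 / T i"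
    "(\<lambda>b. \<epsilon> * flip (R (Z (basis (Neg i)))) b) = Rp (Zp uN)" by blast
  \<comment> \<open>\<open>D\<close> passes \<open>Z\<close> at the cost of rescaling, and the minus
    sign in \<open>flipR\<close> accounts for the change from \<epsilon>' to \<epsilon>. Besides the
    inner solution only a multiple of Pos i appears; Pos i precedes every inner index, so
    triangularity is preserved.\<close>
  have middle: "(\<lambda>b. \<epsilon> * flip (R (Z (basis a))) b)
      = Rp (Zp (\<lambda>b. \<epsilon> * R (Z (basis a)) (Neg i) * basis (Pos i) b + diag_entry D a * u' a b))"
    if a: "a \<in> block n (Suc i)" for a
  proof -
    define v where "v = Z (basis a)"
    have sv: "supported (block n (Suc i)) v"
      unfolding v_def Z_def using letters(1) a by (intro supported_wop supported_basis) auto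
    then have v0: "supported (block n i) v" "v (Neg i) = 0" "v (Pos i) = 0"
      using supported_mono[OF block_mono[of i "Suc i" n]] by (auto simp: supported_def)
    have "torus_act n D v = word_act n (\<lambda>a. - rescale n i t a) (tail_word n (Suc i)) (torus_act n D (basis a))"
      unfolding v_def Z_def
    proof (rule torus_act_wop[where i = "Suc i"])
      fix w assume w: "w \<in> set (tail_word n (Suc i))"
      then show "- rescale n i t (snd w) = - t (snd w) * (if fst w < n then D (Suc (fst w)) else 1) / D (fst w)"
      proof (cases rule: tail_word_cases)
        case (1 k l)
        then show ?thesis by (auto simp: D_def)
      next
        case (2 k l)
        then show ?thesis by (auto simp: D_def)
      next
        case (3 k)
        then show ?thesis by (auto simp: D_def)
      qed
    qed (use D letters(1) in auto)
    also have "\<dots> = (\<lambda>b. diag_entry D a * word_act n (\<lambda>a. - rescale n i t a) (tail_word n (Suc i)) (basis a) b)"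
      unfolding torus_act_basis diag_entry_def[symmetric] by (rule word_act_scale)
    finally have "(\<lambda>b. \<epsilon>' * flip (torus_act n D v) b) = (\<lambda>b. diag_entry D a * Zp (u' a) b)"
      using fun_cong[OF eq[OF a]] unfolding Zp by (simp add: flip_scale \<epsilon>'_def mult.left_commute)
    then have f: "\<epsilon>' * flip (torus_act n D v) b = diag_entry D a * Zp (u' a) b" for b by metis
    have "(\<lambda>b. \<epsilon> * flip (R v) b) = Rp (\<lambda>b. \<epsilon> * (R v (Neg i) * basis (Pos i) b - (if b = Neg i then 0 else flip (torus_act n D v) b)))"
      unfolding flipR[OF v0(1,2)] by (rule Rp_scale[symmetric])
    also have "(\<lambda>b. \<epsilon> * (R v (Neg i) * basis (Pos i) b - (if b = Neg i then 0 else flip (torus_act n D v) b)))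
        = (\<lambda>b. \<epsilon> * R v (Neg i) * basis (Pos i) b + diag_entry D a * Zp (u' a) b)"
      using v0(3) by (auto simp: fun_eq_iff algebra_simps \<epsilon>(1) simp flip: f)
    also have "\<dots> = Zp (\<lambda>b. \<epsilon> * R v (Neg i) * basis (Pos i) b + diag_entry D a * u' a b)"
    proof -
      have "Zp (basis (Pos i)) = basis (Pos i)"
        unfolding Zp_def by (rule Zfix) (auto simp: basis_def)
      then show ?thesis unfolding Zp_def word_act_linear by simp
    qed
    finally show ?thesis unfolding v_def .
  qed
  have word: "word_act n c (tail_word n i) v = word_act n c (row_word n i) (word_act n c (tail_word n (Suc i)) v)" for c v
    by (simp add: tail_word_step[OF i(2)])
  define u where "u a = (if a = Pos i then (\<lambda>b. T i * basis (Pos i) b) else if a = Neg i then uN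
    else (\<lambda>b. \<epsilon> * R (Z (basis a)) (Neg i) * basis (Pos i) b + diag_entry D a * u' a b))" for a
  have "lower_row n i T a (u a) \<and> (\<lambda>b. \<epsilon> * flip (R (Z (basis a))) b) = Rp (Zp (u a))" if a: "a \<in> block n i" for a
  proof -
    consider "a = Pos i" | "a = Neg i" | "a \<in> block n (Suc i)" "a \<noteq> Pos i" "a \<noteq> Neg i" using a i by (auto simp: block_Suc)
    then show ?thesis
    proof cases
      case 1
      have Z: "Z (basis (Pos i)) = basis (Pos i)" "Zp (\<lambda>b. T i * basis (Pos i) b) = (\<lambda>b. T i * basis (Pos i) b)"
        unfolding Z_def Zp_def by (rule Zfix, auto simp: basis_def)+
      have "(\<lambda>b. \<epsilon> * flip (R (basis (Pos i))) b) = Rp (\<lambda>b. \<epsilon> * (y * basis (Pos i) b))"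
        unfolding first by (rule Rp_scale[symmetric])
      then have "(\<lambda>b. \<epsilon> * flip (R (basis (Pos i))) b) = Rp (\<lambda>b. T i * basis (Pos i) b)"
        by (simp add: mult.assoc[symmetric] y(1))
      moreover have "lower_row n i T (Pos i) (\<lambda>b. T i * basis (Pos i) b)"
        using i by (auto simp: lower_row_def supported_def basis_def diag_entry_def)
      ultimately show ?thesis using 1 Z by (simp add: u_def)
    next
      case 2
      have "uN b = 0" if "ixpos n (Neg i) < ixpos n b" for b
      proof (cases "b \<in> block n i")
        case True
        then show ?thesis using that i by (cases b) auto
      qed (use uN(1) in \<open>auto simp: supported_def\<close>)
      then have "lower_row n i T (Neg i) uN"
        using uN(1,2) by (simp add: lower_row_def diag_entry_def)
      then show ?thesis using 2 uN(3) by (simp add: u_def)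
    next
      case 3
      note L = u'[OF 3(1), folded T'_def]
      have "ixpos n (Pos i) < ixpos n a" using 3 i by (cases a) auto
      moreover have "diag_entry D a * diag_entry T' a = diag_entry T a"
        using torus_part_rescale[OF t i(1)] 3 by (cases a) (auto simp: diag_entry_def D_def T_def T'_def)
      moreover have "supported (block n i) (u' a)"
        using L supported_mono[OF block_mono[of i "Suc i" n]] by (simp add: lower_row_def)
      ultimately have "lower_row n i T a (\<lambda>b. \<epsilon> * R (Z (basis a)) (Neg i) * basis (Pos i) b + diag_entry D a * u' a b)"
        using L 3 i by (auto simp: lower_row_def supported_def basis_def)
      then show ?thesis using 3 middle[OF 3(1)] by (simp add: u_def)
    qed
  qed
  then show ?thesis
    unfolding word T_def \<epsilon>_def R_def Z_def Rp_def Zp_def by blast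
qed

lemma row_sum_cong: "(\<And>a. row_of a = k \<Longrightarrow> p a = q a) \<Longrightarrow> row_sum n p k = row_sum n q k"
  by (simp add: row_sum_def)

text \<open>Downward induction on \<open>i\<close> with \<open>t\<close> arbitrary, since the inner
  problem is posed for rescaled coordinates. It is carried out with the signed flip, to which
  \<open>flip_row_action\<close> refers; on vectors supported in the block this is the same as
  \<open>weyl_act\<close>.\<close>

lemma factorization:
  assumes "1 \<le> i" "i \<le> Suc n" "positive n t"
  shows "\<exists>p u. positive n p \<and>
    (\<forall>a\<in>block n i. lower_row n i (torus_part n i t) a (u a) \<and>
      weyl_act n (tail_word n i) (word_act n (\<lambda>a. - t a) (tail_word n i) (basis a)) = word_act n p (tail_word n i) (u a)) \<and>
    (\<Sum>k\<in>{i..n}. row_sum n p k) = potential n i t"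
proof -
  have "\<exists>p u. positive n p \<and>
    (\<forall>a\<in>block n i. lower_row n i (torus_part n i t) a (u a) \<and>
      (\<lambda>b. (- 1) ^ (Suc n - i) * flip (word_act n (\<lambda>a. - t a) (tail_word n i) (basis a)) b) = word_act n p (tail_word n i) (u a)) \<and>
    (\<Sum>k\<in>{i..n}. row_sum n p k) = potential n i t"
    using assms(2,1,3)
  proof (induction i arbitrary: t rule: inc_induct)
    case base
    have "lower_row n (Suc n) (torus_part n (Suc n) t) a (basis a) \<and>
      (\<lambda>b. (- 1) ^ (Suc n - Suc n) * flip (word_act n (\<lambda>a. - t a) (tail_word n (Suc n)) (basis a)) b) = word_act n t (tail_word n (Suc n)) (basis a)"
      if "a \<in> block n (Suc n)" for a
    proof -
      have "a = Mid" using that by (cases a) auto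
      moreover have "flip (basis Mid) b = basis Mid b" for b by (cases b) (simp_all add: basis_def)
      ultimately show ?thesis
        by (auto simp: tail_word_Suc_n lower_row_def diag_entry_def supported_def basis_def)
    qed
    then show ?case using base by (intro exI[of _ t] exI[of _ basis]) (simp add: potential_def)
  next
    case (step i)
    then have i: "1 \<le> i" "i \<le> n" by auto
    from step.IH[OF _ positive_rescale[OF step.prems(2) i(1)]] i
    obtain p' u' where p': "positive n p'"
      and u': "\<And>a. a \<in> block n (Suc i) \<Longrightarrow> lower_row n (Suc i) (torus_part n (Suc i) (rescale n i t)) a (u' a)"
      and eq: "\<And>a. a \<in> block n (Suc i) \<Longrightarrow>
      (\<lambda>b. (- 1) ^ (Suc n - Suc i) * flip (word_act n (\<lambda>a. - rescale n i t a) (tail_word n (Suc i)) (basis a)) b)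
      = word_act n p' (tail_word n (Suc i)) (u' a)"
      and sum: "(\<Sum>k\<in>{Suc i..n}. row_sum n p' k) = potential n (Suc i) (rescale n i t)"
      by auto
    define p where "p = (\<lambda>a. if row_of a = i then twist n t a else p' a)"
    from factorization_step[OF i step.prems(2) p' u' eq, folded p_def] obtain u where
      u: "\<forall>a\<in>block n i. lower_row n i (torus_part n i t) a (u a) \<and>
      (\<lambda>b. (- 1) ^ (Suc n - i) * flip (word_act n (\<lambda>a. - t a) (tail_word n i) (basis a)) b) = word_act n p (tail_word n i) (u a)"
      by blast
    have "positive n p"
      using p' twist_pos[OF step.prems(2)] by (simp add: positive_def p_def)
    moreover have "(\<Sum>k\<in>{i..n}. row_sum n p k) = potential n i t"
    proof -
      have "{i..n} = insert i {Suc i..n}" using i by auto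
      moreover have "row_sum n p i = row_sum n (twist n t) i"
        by (rule row_sum_cong) (simp add: p_def)
      moreover have "(\<Sum>k\<in>{Suc i..n}. row_sum n p k) = (\<Sum>k\<in>{Suc i..n}. row_sum n p' k)"
        by (intro sum.cong refl row_sum_cong) (auto simp: p_def)
      ultimately show ?thesis
        by (simp add: sum row_sum_twist[OF step.prems(2) i] potential_rescale[OF step.prems(2) i])
    qed
    ultimately show ?case using u by blast
  qed
  moreover have "weyl_act n (tail_word n i) (word_act n (\<lambda>a. - t a) (tail_word n i) (basis a))
      = (\<lambda>b. (- 1) ^ (Suc n - i) * flip (word_act n (\<lambda>a. - t a) (tail_word n i) (basis a)) b)" if "a \<in> block n i" for a
  proof -
    have "supported (block n i) (word_act n (\<lambda>a. - t a) (tail_word n i) (basis a))"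
      using tail_word_letters[of _ n i] assms that by (intro supported_wop supported_basis) auto
    moreover have "flip v b = 0" "v b = 0" if "supported (block n i) v" "b \<notin> block n i" for v b
      using that by (cases b; auto simp: supported_def)+
    ultimately show ?thesis unfolding weyl_act_tail[OF assms(1,2)] by (auto simp: fun_eq_iff)
  qed
  ultimately show ?thesis by auto
qed

text \<open>The entry at Pos i yields T. The \<open>Neg\<close> entries are nonzero by positivity,
  and their successive quotients are the descending coordinates up to sign. These determine the
  intermediate \<open>x\<close>, whose quotients are the ascending coordinates, and the entry at Mid
  gives the middle one.\<close>

lemma row_coordinates_unique:
  assumes i: "1 \<le> i" "i \<le> n" and p: "positive n p" and p': "positive n p'" and T: "0 < T" "0 < T'"
    and eq: "(\<lambda>b. T * word_act n p (row_word n i) (basis (Pos i)) b) = (\<lambda>b. T' * word_act n p' (row_word n i) (basis (Pos i)) b)"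
  shows "T = T'" and "\<And>a. a \<in> coords n \<Longrightarrow> row_of a = i \<Longrightarrow> p a = p' a"
proof -
  define w where "w = word_act n p (row_word n i) (basis (Pos i))"
  define w' where "w' = word_act n p' (row_word n i) (basis (Pos i))"
  obtain x where "row_rel n i p (basis (Pos i)) x w"
    unfolding w_def by (rule row_action[OF i(2)])
  note R = row_relD[OF this]
  obtain x' where "row_rel n i p' (basis (Pos i)) x' w'"
    unfolding w'_def by (rule row_action[OF i(2)])
  note R' = row_relD[OF this]
  have "T * w (Pos i) = T' * w' (Pos i)" using eq unfolding w_def w'_def by metis
  then show TT: "T = T'" using R(1,3) R'(1,3) by (simp add: basis_def)
  then have "T * w b = T * w' b" for b using eq unfolding w_def w'_def by metis
  then have ww: "w b = w' b" for b using T by simp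
  have xpos: "0 < x l" if "i \<le> l" "l \<le> n" for l
    using that
  proof (induction l rule: dec_induct)
    case base
    then show ?case using R(1) by (simp add: basis_def)
  next
    case (step l)
    then have "0 < p (DblB i (Suc l))" "0 < x l" using positiveD(2)[OF p, of i "Suc l"] i by auto
    then show ?case using R(2)[of l] step by (simp add: basis_def)
  qed
  have wneg: "w (Neg l) \<noteq> 0" if "i \<le> l" "l \<le> n" for l
    using that(2,1)
  proof (induction l rule: inc_induct)
    case base
    have "0 < p (Sgl i)" "0 < x n" using positiveD(3)[OF p, of i] xpos[of n] i by auto
    then show ?case using R(6) by (simp add: basis_def)
  next
    case (step l)
    then have "0 < p (DblA i (Suc l))" using positiveD(1)[OF p, of i "Suc l"] i by auto
    then show ?case using R(7)[of l] step by (simp add: basis_def)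
  qed
  have A: "p (DblA i (Suc l)) = p' (DblA i (Suc l))" if l: "i \<le> l" "l < n" for l
    using R(7)[OF l] R'(7)[OF l] wneg[of "Suc l"] ww l by (simp add: basis_def)
  have xx: "x l = x' l" if "i \<le> l" "l \<le> n" for l
    using that
  proof (induction l rule: dec_induct)
    case base
    then show ?case using R(1) R'(1) by simp
  next
    case (step l)
    then show ?case using R(4)[of l] R'(4)[of l] A[of l] ww[of "Pos (Suc l)"] by simp
  qed
  have B: "p (DblB i (Suc l)) = p' (DblB i (Suc l))" if l: "i \<le> l" "l < n" for l
    using R(2)[OF l] R'(2)[OF l] xx[of l] xx[of "Suc l"] xpos[of l] l by (simp add: basis_def)
  have S: "p (Sgl i) = p' (Sgl i)"
    using R(5) R'(5) ww[of Mid] xx[of n] xpos[of n] i by (simp add: basis_def)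
  fix a assume a: "a \<in> coords n" "row_of a = i"
  show "p a = p' a"
  proof (cases a)
    case (DblA k l)
    then obtain m where "l = Suc m" "i \<le> m" "m < n" using a by (cases l) auto
    then show ?thesis using DblA A[of m] a by simp
  next
    case (DblB k l)
    then obtain m where "l = Suc m" "i \<le> m" "m < n" using a by (cases l) auto
    then show ?thesis using DblB B[of m] a by simp
  qed (use S a in simp)
qed

lemma snd_row_word: "w \<in> set (row_word n i) \<Longrightarrow> 1 \<le> i \<Longrightarrow> i \<le> n \<Longrightarrow> snd w \<in> coords n"
  by (auto simp: row_word_def)

text \<open>By triangularity row Pos i is a multiple of a basis vector, so it isolates T i and the
  factor R_i. Once R_i is cancelled, the entry at Pos i can be projected away and the inner problem
  remains.\<close>

lemma factorization_unique:
  assumes "1 \<le> i" "i \<le> Suc n" and p: "positive n p" and p': "positive n p'"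
    and T: "\<And>k. i \<le> k \<Longrightarrow> k \<le> n \<Longrightarrow> 0 < T k" "\<And>k. i \<le> k \<Longrightarrow> k \<le> n \<Longrightarrow> 0 < T' k"
    and "\<And>a. a \<in> block n i \<Longrightarrow> lower_row n i T a (u a)" "\<And>a. a \<in> block n i \<Longrightarrow> lower_row n i T' a (u' a)"
    and "\<And>a. a \<in> block n i \<Longrightarrow> word_act n p (tail_word n i) (u a) = word_act n p' (tail_word n i) (u' a)"
  shows "(\<forall>k\<in>{i..n}. T k = T' k) \<and> (\<forall>a\<in>coords n. i \<le> row_of a \<longrightarrow> p a = p' a)"
  using assms(2,1) T assms(7-)
proof (induction i arbitrary: u u' rule: inc_induct)
  case base
  have "row_of a \<le> n" if "a \<in> coords n" for a using that by (cases a) auto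
  then show ?case by force
next
  case (step i)
  then have i: "1 \<le> i" "i \<le> n" by auto
  have word: "word_act n c (tail_word n i) v = word_act n c (row_word n i) (word_act n c (tail_word n (Suc i)) v)" for c v
    by (simp add: tail_word_step[OF i(2)])
  have letters: "\<And>w. w \<in> set (tail_word n (Suc i)) \<Longrightarrow> Suc i \<le> fst w \<and> fst w \<le> n"
    using tail_word_letters[of _ n "Suc i"] by auto
  have Zfix: "word_act n c (tail_word n (Suc i)) v = v" if "\<And>b. b \<in> block n (Suc i) \<Longrightarrow> v b = 0" for c v
    by (rule word_act_fixes[OF letters that])
  have first: "v = (\<lambda>b. S i * basis (Pos i) b)" if "lower_row n i S (Pos i) v" for v S
  proof
    fix b
    show "v b = S i * basis (Pos i) b"
    proof (cases "b \<in> block n i")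
      case True
      then show ?thesis using that i
        by (cases b) (auto simp: lower_row_def basis_def diag_entry_def)
    next
      case False
      then show ?thesis using that i by (auto simp: lower_row_def basis_def supported_def)
    qed
  qed
  have bi: "Pos i \<in> block n i" using i by simp
  have "word_act n c (tail_word n i) (\<lambda>b. S * basis (Pos i) b) = (\<lambda>b. S * word_act n c (row_word n i) (basis (Pos i)) b)" for c S
    unfolding word by (subst Zfix) (auto simp: basis_def word_act_scale)
  then have "(\<lambda>b. T i * word_act n p (row_word n i) (basis (Pos i)) b) = (\<lambda>b. T' i * word_act n p' (row_word n i) (basis (Pos i)) b)"
    using step.prems(6)[OF bi] first[OF step.prems(4)[OF bi]] first[OF step.prems(5)[OF bi]] by metis
  from row_coordinates_unique[OF i p p' _ _ this] step.prems(2,3)[of i] i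
  have Ti: "T i = T' i" and pi: "\<And>a. a \<in> coords n \<Longrightarrow> row_of a = i \<Longrightarrow> p a = p' a" by auto
  have row: "word_act n p (row_word n i) v = word_act n p' (row_word n i) v" for v
    using pi row_of_word snd_row_word i by (intro word_act_cong) auto
  \<comment> \<open>Removes the entry at Pos i. The inner letters neither read nor change this
    entry, so the projection commutes with the inner word.\<close>
  define f where "f v = (\<lambda>b. 1 * v b + (- v (Pos i)) * basis (Pos i) b)" for v :: "ix \<Rightarrow> real"
  have zf: "word_act n c (tail_word n (Suc i)) (f v) = f (word_act n c (tail_word n (Suc i)) v)" for c v
  proof -
    have "word_act n c (tail_word n (Suc i)) v (Pos i) = v (Pos i)"
      using letters by (intro word_act_outside[where i = "Suc i"]) auto
    moreover have "word_act n c (tail_word n (Suc i)) (basis (Pos i)) = basis (Pos i)"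
      by (rule Zfix) (auto simp: basis_def)
    ultimately show ?thesis unfolding f_def word_act_linear by simp
  qed
  have lf: "lower_row n (Suc i) S a (f v)" if "lower_row n i S a v" "a \<in> block n (Suc i)" for S a v
  proof -
    \<comment> \<open>Neg i comes after all inner indices in the matrix order, so triangularity
      kills this entry and the support shrinks to the inner block.\<close>
    have "ixpos n a < ixpos n (Neg i)" using that(2) i by (cases a) auto
    then have "v (Neg i) = 0" using that(1) by (simp add: lower_row_def)
    moreover have "a \<noteq> Pos i" using that(2) by auto
    ultimately show ?thesis using that(1) i
      by (auto simp: lower_row_def f_def supported_def basis_def block_Suc)
  qed
  have sub: "a \<in> block n i" if "a \<in> block n (Suc i)" for a using that block_mono[of i "Suc i" n] by auto
  have "(\<forall>k\<in>{Suc i..n}. T k = T' k) \<and> (\<forall>a\<in>coords n. Suc i \<le> row_of a \<longrightarrow> p a = p' a)"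
  proof (rule step.IH[of "\<lambda>a. f (u a)" "\<lambda>a. f (u' a)"])
    fix a assume a: "a \<in> block n (Suc i)"
    show "lower_row n (Suc i) T a (f (u a))" "lower_row n (Suc i) T' a (f (u' a))"
      using step.prems(4,5)[OF sub[OF a]] lf a by auto
    have "word_act n p (row_word n i) (word_act n p (tail_word n (Suc i)) (u a)) = word_act n p (row_word n i) (word_act n p' (tail_word n (Suc i)) (u' a))"
      using step.prems(6)[OF sub[OF a]] unfolding word row .
    then show "word_act n p (tail_word n (Suc i)) (f (u a)) = word_act n p' (tail_word n (Suc i)) (f (u' a))"
      unfolding zf by (metis word_act_inj)
  qed (use step.prems(2,3) in auto)
  then show ?case
    using Ti pi by (metis atLeastAtMost_iff le_antisym not_less_eq_eq)
qed

section \<open>Matrices and Whittaker vectors\<close>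

abbreviation ixs :: "nat \<Rightarrow> ix set" where "ixs n \<equiv> block n (Suc 0)"

abbreviation mats :: "nat \<Rightarrow> real mat set" where "mats n \<equiv> carrier_mat (Suc (2 * n)) (Suc (2 * n))"

lemma mats_mult [simp]: "A \<in> mats n \<Longrightarrow> B \<in> mats n \<Longrightarrow> A * B \<in> mats n"
  by (rule mult_carrier_mat)

lemma mats_uminus [simp]: "A \<in> mats n \<Longrightarrow> - A \<in> mats n"
  by (rule uminus_carrier_mat)

lemma bij_ixpos: "bij_betw (ixpos n) (ixs n) {0..<Suc (2 * n)}"
proof (rule bij_betwI[where g = "\<lambda>r. if r < n then Pos (r + 1) else if r = n then Mid else Neg (2 * n + 1 - r)"])
  show "ixpos n \<in> ixs n \<rightarrow> {0..<Suc (2 * n)}"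
  proof
    fix a assume "a \<in> ixs n" then show "ixpos n a \<in> {0..<Suc (2 * n)}" by (cases a) auto
  qed
  show "(if ixpos n a < n then Pos (ixpos n a + 1) else if ixpos n a = n then Mid else Neg (2 * n + 1 - ixpos n a)) = a"
    if "a \<in> ixs n" for a
    using that by (cases a) auto
qed auto

lemma ixpos_less: "a \<in> ixs n \<Longrightarrow> ixpos n a < Suc (2 * n)"
  using bij_ixpos[of n] by (auto simp: bij_betw_def)

lemma ixpos_eq_iff: "a \<in> ixs n \<Longrightarrow> b \<in> ixs n \<Longrightarrow> ixpos n a = ixpos n b \<longleftrightarrow> a = b"
  using bij_ixpos[of n] by (auto simp: bij_betw_def inj_on_def)

lemma ixpos_surj: "r < Suc (2 * n) \<Longrightarrow> \<exists>a\<in>ixs n. r = ixpos n a"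
  using bij_ixpos[of n] by (auto simp: bij_betw_def image_iff dest: equalityD2)

lemma finite_ixs [simp]: "finite (block n i)"
  by (simp add: block_def)

text \<open>Right multiplication on row vectors. The value 0 off \<open>ixs n\<close> makes results
  canonical, so that products and equality of matrices can be tested as equality of
  functions.\<close>

definition act :: "nat \<Rightarrow> real mat \<Rightarrow> (ix \<Rightarrow> real) \<Rightarrow> ix \<Rightarrow> real" where
  "act n A v = (\<lambda>b. if b \<in> ixs n then \<Sum>a\<in>ixs n. v a * A $$ (ixpos n a, ixpos n b) else 0)"

lemma supported_act: "supported (ixs n) (act n A v)"
  by (simp add: supported_def act_def)

lemma act_basis:
  assumes "a \<in> ixs n" "b \<in> ixs n"
  shows "act n A (basis a) b = A $$ (ixpos n a, ixpos n b)"
proof -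
  have "act n A (basis a) b = (\<Sum>c\<in>ixs n. if c = a then A $$ (ixpos n a, ixpos n b) else 0)"
    unfolding act_def if_P[OF assms(2)] by (intro sum.cong) (auto simp: basis_def)
  then show ?thesis using assms(1) by simp
qed

lemma mat_eq_act:
  assumes "A \<in> mats n" "B \<in> mats n" "\<And>a. a \<in> ixs n \<Longrightarrow> act n A (basis a) = act n B (basis a)"
  shows "A = B"
proof (rule eq_matI)
  fix r c assume "r < dim_row B" "c < dim_col B"
  then obtain a b where "a \<in> ixs n" "b \<in> ixs n" "r = ixpos n a" "c = ixpos n b"
    using assms ixpos_surj[of r n] ixpos_surj[of c n] by auto
  then show "A $$ (r, c) = B $$ (r, c)"
    using assms(3)[of a] act_basis[of a n b] by metis
qed (use assms in auto)

lemma act_mult: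
  assumes "A \<in> mats n" "B \<in> mats n"
  shows "act n (A * B) v = act n B (act n A v)"
proof
  fix b
  show "act n (A * B) v b = act n B (act n A v) b"
  proof (cases "b \<in> ixs n")
    case True
    have AB: "(A * B) $$ (ixpos n a, ixpos n b) = (\<Sum>c\<in>ixs n. A $$ (ixpos n a, ixpos n c) * B $$ (ixpos n c, ixpos n b))"
      if "a \<in> ixs n" for a
    proof -
      have "(A * B) $$ (ixpos n a, ixpos n b) = (\<Sum>k\<in>{0..<Suc (2 * n)}. A $$ (ixpos n a, k) * B $$ (k, ixpos n b))"
        using assms that True ixpos_less[of a n] ixpos_less[of b n] by (auto simp: scalar_prod_def intro!: sum.cong)
      then show ?thesis
        by (simp only: sum.reindex_bij_betw[OF bij_ixpos, of "\<lambda>k. A $$ (ixpos n a, k) * B $$ (k, ixpos n b)"])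
    qed
    have "act n (A * B) v b = (\<Sum>a\<in>ixs n. \<Sum>c\<in>ixs n. v a * (A $$ (ixpos n a, ixpos n c) * B $$ (ixpos n c, ixpos n b)))"
      using True by (simp add: act_def AB sum_distrib_left)
    also have "\<dots> = (\<Sum>c\<in>ixs n. \<Sum>a\<in>ixs n. v a * (A $$ (ixpos n a, ixpos n c) * B $$ (ixpos n c, ixpos n b)))"
      by (rule sum.swap)
    also have "\<dots> = act n B (act n A v) b"
      using True by (simp add: act_def sum_distrib_right mult.assoc)
    finally show ?thesis .
  qed (simp add: act_def)
qed

lemma act_one: "supported (ixs n) v \<Longrightarrow> act n (1\<^sub>m (Suc (2 * n))) v = v"
proof
  fix b assume v: "supported (ixs n) v"
  show "act n (1\<^sub>m (Suc (2 * n))) v b = v b"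
  proof (cases "b \<in> ixs n")
    case True
    have "act n (1\<^sub>m (Suc (2 * n))) v b = (\<Sum>a\<in>ixs n. if a = b then v b else 0)"
      unfolding act_def if_P[OF True]
      using ixpos_less[of _ n] True by (intro sum.cong) (auto simp: ixpos_eq_iff)
    then show ?thesis using True by simp
  qed (use v in \<open>simp add: act_def supported_def\<close>)
qed

lemma act_smult: "A \<in> mats n \<Longrightarrow> act n (c \<cdot>\<^sub>m A) v = (\<lambda>b. c * act n A v b)"
  using ixpos_less[of _ n] by (auto simp: act_def sum_distrib_left fun_eq_iff mult_ac intro!: sum.cong)

lemma act_minus: "A \<in> mats n \<Longrightarrow> B \<in> mats n \<Longrightarrow> act n (A - B) v = (\<lambda>b. act n A v b - act n B v b)"
  using ixpos_less[of _ n] by (auto simp: act_def fun_eq_iff right_diff_distrib sum_subtractf)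

lemma unit_mat_carrier [simp]: "unit_mat n p q \<in> mats n"
  by (simp add: unit_mat_def)

lemma act_unit:
  assumes "a \<in> ixs n" "b \<in> ixs n" "p = Suc (ixpos n a)" "q = Suc (ixpos n b)"
  shows "act n (unit_mat n p q) v = (\<lambda>c. if c = b then v a else 0)"
proof
  fix c
  show "act n (unit_mat n p q) v c = (if c = b then v a else 0)"
  proof (cases "c \<in> ixs n")
    case True
    have "act n (unit_mat n p q) v c = (\<Sum>d\<in>ixs n. if d = a then (if c = b then v a else 0) else 0)"
      unfolding act_def if_P[OF True]
      using True assms ixpos_less[of _ n] by (intro sum.cong) (auto simp: unit_mat_def ixpos_eq_iff)
    then show ?thesis using assms(1) by simp
  qed (use assms in \<open>auto simp: act_def\<close>)
qed

lemma chev_carrier [simp]: "chev_e n j \<in> mats n" "chev_f n j \<in> mats n"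
  by (auto simp: chev_e_def chev_f_def minus_carrier_mat)

lemma act_chev_e:
  assumes "1 \<le> j" "j \<le> n"
  shows "act n (chev_e n j) v = (if j < n
    then (\<lambda>b. if b = Pos (Suc j) then v (Pos j) else if b = Neg j then - v (Neg (Suc j)) else 0)
    else (\<lambda>b. if b = Mid then sqrt 2 * v (Pos n) else if b = Neg n then - sqrt 2 * v Mid else 0))"
proof (cases "j < n")
  case True
  have "act n (unit_mat n j (j + 1)) v = (\<lambda>c. if c = Pos (Suc j) then v (Pos j) else 0)"
    using assms True by (intro act_unit) auto
  moreover have "act n (unit_mat n (2 * n + 1 - j) (2 * n + 2 - j)) v = (\<lambda>c. if c = Neg j then v (Neg (Suc j)) else 0)"
    using assms True by (intro act_unit) auto
  ultimately show ?thesis using True by (auto simp: chev_e_def act_minus fun_eq_iff)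
next
  case False
  then have j: "j = n" using assms by simp
  have "act n (unit_mat n n (n + 1)) v = (\<lambda>c. if c = Mid then v (Pos n) else 0)"
    using assms j by (intro act_unit) auto
  moreover have "act n (unit_mat n (n + 1) (n + 2)) v = (\<lambda>c. if c = Neg n then v Mid else 0)"
    using assms j by (intro act_unit) auto
  ultimately show ?thesis using j by (auto simp: chev_e_def act_minus act_smult minus_carrier_mat fun_eq_iff)
qed

lemma act_chev_f:
  assumes "1 \<le> j" "j \<le> n"
  shows "act n (chev_f n j) v = (if j < n
    then (\<lambda>b. if b = Pos j then v (Pos (Suc j)) else if b = Neg (Suc j) then - v (Neg j) else 0)
    else (\<lambda>b. if b = Pos n then sqrt 2 * v Mid else if b = Mid then - sqrt 2 * v (Neg n) else 0))"
proof (cases "j < n")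
  case True
  have "act n (unit_mat n (j + 1) j) v = (\<lambda>c. if c = Pos j then v (Pos (Suc j)) else 0)"
    using assms True by (intro act_unit) auto
  moreover have "act n (unit_mat n (2 * n + 2 - j) (2 * n + 1 - j)) v = (\<lambda>c. if c = Neg (Suc j) then v (Neg j) else 0)"
    using assms True by (intro act_unit) auto
  ultimately show ?thesis using True by (auto simp: chev_f_def act_minus fun_eq_iff)
next
  case False
  then have j: "j = n" using assms by simp
  have "act n (unit_mat n (n + 1) n) v = (\<lambda>c. if c = Pos n then v Mid else 0)"
    using assms j by (intro act_unit) auto
  moreover have "act n (unit_mat n (n + 2) (n + 1)) v = (\<lambda>c. if c = Mid then v (Neg n) else 0)"
    using assms j by (intro act_unit) auto
  ultimately show ?thesis using j by (auto simp: chev_f_def act_minus act_smult minus_carrier_mat fun_eq_iff)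
qed

lemma pow_mat_carrier: "A \<in> mats n \<Longrightarrow> A ^\<^sub>m m \<in> mats n"
  by (rule pow_carrier_mat)

lemma mat_exp_carrier [simp]: "A \<in> mats n \<Longrightarrow> mat_exp A \<in> mats n"
  by (auto simp: mat_exp_def)

lemma mat_exp_entry:
  assumes "A \<in> mats n" "a \<in> ixs n" "b \<in> ixs n"
  shows "mat_exp A $$ (ixpos n a, ixpos n b) = (\<Sum>m. ((act n A ^^ m) (basis a)) b / fact m)"
proof -
  have pow: "act n (A ^\<^sub>m m) v = (act n A ^^ m) v" if "supported (ixs n) v" for m v
  proof (induction m)
    case 0
    then show ?case using assms(1) that by (simp add: act_one)
  next
    case (Suc m)
    then show ?case using assms(1) pow_mat_carrier[OF assms(1), of m] by (simp add: act_mult)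
  qed
  have "(A ^\<^sub>m m) $$ (ixpos n a, ixpos n b) = ((act n A ^^ m) (basis a)) b" for m
    using act_basis[OF assms(2,3), of "A ^\<^sub>m m"] pow[OF supported_basis[OF assms(2)]] by simp
  then show ?thesis using assms ixpos_less[of _ n] by (auto simp: mat_exp_def)
qed

text \<open>Every multiple of a Chevalley generator has vanishing cube, so its exponential series
  stops at the quadratic term; that term is nonzero only for the short root.\<close>

lemma act_mat_exp:
  assumes A: "A \<in> mats n" and v: "supported (ixs n) v"
    and nil: "\<And>v. act n A (act n A (act n A v)) = (\<lambda>_. 0)"
  shows "act n (mat_exp A) v = (\<lambda>b. v b + act n A v b + act n A (act n A v) b / 2)"
proof
  fix b
  show "act n (mat_exp A) v b = v b + act n A v b + act n A (act n A v) b / 2"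
  proof (cases "b \<in> ixs n")
    case False
    then show ?thesis using v by (simp add: act_def supported_def)
  next
    case True
    have zero: "act n A (\<lambda>_. 0) = (\<lambda>_. 0)" by (auto simp: act_def fun_eq_iff)
    have high: "(act n A ^^ m) w = (\<lambda>_. 0)" if "3 \<le> m" for m w
      using that
    proof (induction m rule: dec_induct)
      case base
      then show ?case using nil by (simp add: numeral_3_eq_3)
    qed (simp add: zero)
    have e: "mat_exp A $$ (ixpos n a, ixpos n b) = basis a b + A $$ (ixpos n a, ixpos n b) + (A * A) $$ (ixpos n a, ixpos n b) / 2"
      if a: "a \<in> ixs n" for a
    proof -
      have "mat_exp A $$ (ixpos n a, ixpos n b) = (\<Sum>m\<in>{0, 1, 2}. ((act n A ^^ m) (basis a)) b / fact m)"
        unfolding mat_exp_entry[OF A a True]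
      proof (rule suminf_finite)
        fix m :: nat assume "m \<notin> {0, 1, 2}"
        then have "3 \<le> m" by (simp; presburger)
        then show "((act n A ^^ m) (basis a)) b / fact m = 0" by (simp add: high)
      qed simp
      then show ?thesis
        using act_basis[OF a True, of A] act_basis[OF a True, of "A * A"] A by (simp add: act_mult numeral_2_eq_2)
    qed
    have "act n (mat_exp A) v b = (\<Sum>a\<in>ixs n. v a * basis a b) + act n A v b + act n (A * A) v b / 2"
      using True by (simp add: act_def e algebra_simps sum.distrib sum_divide_distrib)
    also have "(\<Sum>a\<in>ixs n. v a * basis a b) = (\<Sum>a\<in>ixs n. if a = b then v b else 0)"
      by (intro sum.cong) (auto simp: basis_def)
    also have "\<dots> = v b" using True by simp
    finally show ?thesis using A by (simp add: act_mult)
  qed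
qed

lemma act_exp_e:
  assumes "1 \<le> j" "j \<le> n" "supported (ixs n) v"
  shows "act n (mat_exp (c \<cdot>\<^sub>m chev_e n j)) v = e_act n j c v"
proof -
  have "act n (mat_exp (c \<cdot>\<^sub>m chev_e n j)) v = (\<lambda>b. v b + act n (c \<cdot>\<^sub>m chev_e n j) v b
      + act n (c \<cdot>\<^sub>m chev_e n j) (act n (c \<cdot>\<^sub>m chev_e n j) v) b / 2)"
    using assms by (intro act_mat_exp) (auto simp: act_smult act_chev_e)
  also have "\<dots> = e_act n j c v"
    using assms by (auto simp: act_smult act_chev_e e_act.simps fun_eq_iff power2_eq_square)
  finally show ?thesis .
qed

lemma act_exp_f:
  assumes "1 \<le> j" "j \<le> n" "supported (ixs n) v"
  shows "act n (mat_exp (c \<cdot>\<^sub>m chev_f n j)) v = f_act n j c v"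
proof -
  have "act n (mat_exp (c \<cdot>\<^sub>m chev_f n j)) v = (\<lambda>b. v b + act n (c \<cdot>\<^sub>m chev_f n j) v b
      + act n (c \<cdot>\<^sub>m chev_f n j) (act n (c \<cdot>\<^sub>m chev_f n j) v) b / 2)"
    using assms by (intro act_mat_exp) (auto simp: act_smult act_chev_f)
  also have "\<dots> = f_act n j c v"
    using assms by (auto simp: act_smult act_chev_f f_act.simps fun_eq_iff power2_eq_square)
  finally show ?thesis .
qed

text \<open>Acting on rows reverses composition, so a product read from left to right becomes a
  \<open>fold\<close>. Support is carried along because the factors are known only on supported
  vectors.\<close>

lemma act_mat_prod:
  assumes "\<And>w. w \<in> set ws \<Longrightarrow> f w \<in> mats n"
    and "\<And>w v. w \<in> set ws \<Longrightarrow> supported (ixs n) v \<Longrightarrow> act n (f w) v = g w v" and "supported (ixs n) v"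
  shows "mat_prod n (map f ws) \<in> mats n \<and> act n (mat_prod n (map f ws)) v = fold g ws v"
  using assms
proof (induction ws arbitrary: v)
  case Nil
  then show ?case by (simp add: mat_prod_def act_one)
next
  case (Cons w ws)
  have "mat_prod n (map f (w # ws)) = f w * mat_prod n (map f ws)" by (simp add: mat_prod_def)
  moreover have "supported (ixs n) (g w v)"
    using Cons.prems(2)[of w v] Cons.prems(3) supported_act[of n "f w" v] by simp
  ultimately show ?case using Cons by (simp add: act_mult)
qed

lemma word_letters: "w \<in> set (word n) \<Longrightarrow> 1 \<le> fst w \<and> fst w \<le> n"
  using tail_word_letters[of w n 1] by (simp add: word_eq_tail_word)

lemma act_X_mat:
  assumes "supported (ixs n) v"
  shows "X_mat n t \<in> mats n" and "act n (X_mat n t) v = word_act n t (tail_word n (Suc 0)) v"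
proof -
  have "X_mat n t \<in> mats n \<and> act n (X_mat n t) v = fold (\<lambda>(j, a). e_act n j (t a)) (word n) v"
    unfolding X_mat_def
  proof (rule act_mat_prod)
    fix w v assume w: "w \<in> set (word n)" and v: "supported (ixs n) v"
    obtain j a where "w = (j, a)" by (cases w)
    then show "act n (case w of (j, a) \<Rightarrow> mat_exp (t a \<cdot>\<^sub>m chev_e n j)) v = (case w of (j, a) \<Rightarrow> e_act n j (t a)) v"
      using word_letters[OF w] v by (simp add: act_exp_e)
  qed (use assms in \<open>auto split: prod.split\<close>)
  then show "X_mat n t \<in> mats n" "act n (X_mat n t) v = word_act n t (tail_word n (Suc 0)) v"
    by (simp_all add: word_act_def word_eq_tail_word)
qed

lemma X_mat_carrier [simp]: "X_mat n t \<in> mats n"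
  using act_X_mat(1)[of n "\<lambda>_. 0" t] by (simp add: supported_def)

lemma act_w0_bar:
  assumes "supported (ixs n) v"
  shows "w0_bar n \<in> mats n" and "act n (w0_bar n) v = weyl_act n (tail_word n (Suc 0)) v"
proof -
  have one: "1 \<cdot>\<^sub>m A = A" "(- 1) \<cdot>\<^sub>m A = - A" for A :: "real mat" by (auto intro!: eq_matI)
  have "w0_bar n \<in> mats n \<and> act n (w0_bar n) v = fold (\<lambda>(j, a). s_act n j) (word n) v"
    unfolding w0_bar_def
  proof (rule act_mat_prod)
    fix w v assume w: "w \<in> set (word n)" and v: "supported (ixs n) v"
    obtain j a where wj: "w = (j, a)" by (cases w)
    have E: "act n (mat_exp (chev_e n j)) u = e_act n j 1 u" "act n (mat_exp (- chev_f n j)) u = f_act n j (- 1) u"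
      if "supported (ixs n) u" for u
      using act_exp_e[of j n u 1] act_exp_f[of j n u "- 1"] word_letters[OF w] that by (simp_all add: wj one)
    have s1: "supported (ixs n) (e_act n j 1 v)" using E(1)[OF v] supported_act by metis
    have s2: "supported (ixs n) (f_act n j (- 1) (e_act n j 1 v))" using E(2)[OF s1] supported_act by metis
    have "act n (mat_exp (chev_e n j) * mat_exp (- chev_f n j) * mat_exp (chev_e n j)) v = s_act n j v"
      using E(1)[OF v] E(2)[OF s1] E(1)[OF s2]
      by (simp add: s_act_def act_mult)
    then show "act n (case w of (j, a) \<Rightarrow> mat_exp (chev_e n j) * mat_exp (- chev_f n j) * mat_exp (chev_e n j)) v
        = (case w of (j, a) \<Rightarrow> s_act n j) v" by (simp add: wj)
  qed (use assms in \<open>auto split: prod.split\<close>)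
  then show "w0_bar n \<in> mats n" "act n (w0_bar n) v = weyl_act n (tail_word n (Suc 0)) v"
    by (simp_all add: weyl_act_def word_eq_tail_word)
qed

lemma w0_bar_carrier [simp]: "w0_bar n \<in> mats n"
  using act_w0_bar(1)[of n "\<lambda>_. 0"] by (simp add: supported_def)

lemma act_diag:
  assumes "supported (ixs n) v"
  shows "act n (mat_diag (Suc (2 * n)) f) v = (\<lambda>b. f (ixpos n b) * v b)"
proof
  fix b
  show "act n (mat_diag (Suc (2 * n)) f) v b = f (ixpos n b) * v b"
  proof (cases "b \<in> ixs n")
    case True
    have "act n (mat_diag (Suc (2 * n)) f) v b = (\<Sum>a\<in>ixs n. if a = b then f (ixpos n b) * v b else 0)"
      unfolding act_def if_P[OF True]
      using ixpos_less[of _ n] True by (intro sum.cong) (auto simp: mat_diag_def ixpos_eq_iff)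
    then show ?thesis using True by simp
  qed (use assms in \<open>simp add: act_def supported_def\<close>)
qed

lemma torus_carrier [simp]: "torus n T \<in> mats n"
  by (simp add: torus_def mat_diag_def)

lemma act_torus:
  assumes "supported (ixs n) v"
  shows "act n (torus n T) v = (\<lambda>b. diag_entry T b * v b)"
proof
  fix b
  show "act n (torus n T) v b = diag_entry T b * v b"
  proof (cases "b \<in> ixs n")
    case True
    have "torus n T = mat_diag (Suc (2 * n)) (\<lambda>r. if r < n then T (r + 1) else if r = n then 1 else inverse (T (hat n (r + 1))))"
      by (simp add: torus_def)
    then show ?thesis using True
      by (cases b) (auto simp: act_diag[OF assms] diag_entry_def hat_def divide_inverse)
  qed (use assms in \<open>simp add: act_def supported_def\<close>)
qed

lemma act_exp_cartan:
  assumes "supported (ixs n) v"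
  shows "mat_exp (- cartan n x) \<in> mats n" and "act n (mat_exp (- cartan n x)) v = torus_act n (\<lambda>k. exp (- x k)) v"
proof -
  define h where "h r = (if r < n then x (r + 1) else if r = n then 0 else - x (hat n (r + 1)))" for r
  have c: "- cartan n x = mat_diag (Suc (2 * n)) (\<lambda>r. - h r)"
    by (auto simp: cartan_def h_def mat_diag_def intro!: eq_matI)
  have m: "mat_diag (Suc (2 * n)) f \<in> mats n" for f :: "nat \<Rightarrow> real" by (simp add: mat_diag_def)
  then show "mat_exp (- cartan n x) \<in> mats n" unfolding c by simp
  have pow: "(act n (mat_diag (Suc (2 * n)) (\<lambda>r. - h r)) ^^ m) (basis a) = (\<lambda>b. (- h (ixpos n b)) ^ m * basis a b)"
    if a: "a \<in> ixs n" for a m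
  proof (induction m)
    case (Suc m)
    have "supported (ixs n) (\<lambda>b. (- h (ixpos n b)) ^ m * basis a b)"
      using supported_basis[OF a] by (simp add: supported_def)
    then show ?case by (simp add: Suc act_diag mult.assoc)
  qed simp
  have e: "mat_exp (- cartan n x) $$ (ixpos n a, ixpos n b) = mat_diag (Suc (2 * n)) (\<lambda>r. exp (- h r)) $$ (ixpos n a, ixpos n b)"
    if "a \<in> ixs n" "b \<in> ixs n" for a b
    unfolding c mat_exp_entry[OF m that] pow[OF that(1)]
  proof (cases "a = b")
    case True
    then show "(\<Sum>m. (- h (ixpos n b)) ^ m * basis a b / fact m) = mat_diag (Suc (2 * n)) (\<lambda>r. exp (- h r)) $$ (ixpos n a, ixpos n b)"
      using ixpos_less[OF that(2)] by (simp add: basis_def mat_diag_def exp_def divide_inverse mult.commute)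
  next
    case False
    then show "(\<Sum>m. (- h (ixpos n b)) ^ m * basis a b / fact m) = mat_diag (Suc (2 * n)) (\<lambda>r. exp (- h r)) $$ (ixpos n a, ixpos n b)"
      using ixpos_less[OF that(1)] ixpos_less[OF that(2)] ixpos_eq_iff[OF that] by (simp add: basis_def mat_diag_def)
  qed
  have "act n (mat_exp (- cartan n x)) v = act n (mat_diag (Suc (2 * n)) (\<lambda>r. exp (- h r))) v"
    by (auto simp: act_def e fun_eq_iff intro!: sum.cong)
  also have "\<dots> = torus_act n (\<lambda>k. exp (- x k)) v"
    unfolding act_diag[OF assms]
  proof
    fix b
    show "exp (- h (ixpos n b)) * v b = torus_act n (\<lambda>k. exp (- x k)) v b"
    proof (cases "b \<in> ixs n")
      case True
      then show ?thesis by (cases b) (auto simp: h_def hat_def exp_minus field_simps)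
    next
      case False
      then have "v b = 0" using assms by (simp add: supported_def)
      then show ?thesis by (cases b) auto
    qed
  qed
  finally show "act n (mat_exp (- cartan n x)) v = torus_act n (\<lambda>k. exp (- x k)) v" .
qed

section \<open>Evaluation of the two Whittaker vectors\<close>

lemma lower_unipotent_lower_row:
  assumes Y: "lower_unipotent n Y" and a: "a \<in> ixs n"
  shows "lower_row n (Suc 0) T a (act n (torus n T) (act n Y (basis a)))"
proof -
  have u: "act n (torus n T) (act n Y (basis a)) b = diag_entry T b * Y $$ (ixpos n a, ixpos n b)" if "b \<in> ixs n" for b
    by (simp only: act_torus[OF supported_act] act_basis[OF a that])
  have "act n (torus n T) (act n Y (basis a)) b = 0" if "ixpos n a < ixpos n b" for b
  proof (cases "b \<in> ixs n")
    case True
    then show ?thesis using Y that ixpos_less[of b n] by (simp add: u lower_unipotent_def)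
  qed (simp add: act_def)
  moreover have "act n (torus n T) (act n Y (basis a)) a = diag_entry T a"
    using Y ixpos_less[OF a] by (simp add: u a lower_unipotent_def)
  ultimately show ?thesis by (simp add: lower_row_def supported_act)
qed

text \<open>Tested on basis rows, the matrix identity becomes \<open>factorization_unique\<close>.
  This is what makes the definite descriptions of both Whittaker vectors well defined.\<close>

lemma triangular_factorization_unique:
  assumes p: "positive n p" "positive n p'" and T: "\<forall>k\<in>{1..n}. 0 < T k" "\<forall>k\<in>{1..n}. 0 < T' k"
    and Y: "lower_unipotent n Y" "lower_unipotent n Y'"
    and eq: "Y * torus n T * X_mat n p = Y' * torus n T' * X_mat n p'"
  shows "(\<forall>k\<in>{1..n}. T k = T' k) \<and> (\<forall>a\<in>coords n. p a = p' a)"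
proof -
  have c: "Y \<in> mats n" "Y' \<in> mats n" using Y by (simp_all add: lower_unipotent_def)
  have "(\<forall>k\<in>{Suc 0..n}. T k = T' k) \<and> (\<forall>a\<in>coords n. Suc 0 \<le> row_of a \<longrightarrow> p a = p' a)"
  proof (rule factorization_unique[OF _ _ p])
    fix a assume a: "a \<in> ixs n"
    show "lower_row n (Suc 0) T a (act n (torus n T) (act n Y (basis a)))"
      "lower_row n (Suc 0) T' a (act n (torus n T') (act n Y' (basis a)))"
      using Y a by (auto intro: lower_unipotent_lower_row)
    have "act n (Y * torus n T * X_mat n p) (basis a) = act n (Y' * torus n T' * X_mat n p') (basis a)"
      by (simp only: eq)
    then show "word_act n p (tail_word n (Suc 0)) (act n (torus n T) (act n Y (basis a)))
        = word_act n p' (tail_word n (Suc 0)) (act n (torus n T') (act n Y' (basis a)))"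
      using c by (simp add: act_mult act_X_mat(2)[OF supported_act])
  qed (use T in auto)
  moreover have "Suc 0 \<le> row_of a" if "a \<in> coords n" for a using that by (cases a) auto
  ultimately show ?thesis by auto
qed

lemma one_unipotent: "lower_unipotent n (1\<^sub>m (Suc (2 * n)))"
  by (simp add: lower_unipotent_def)

text \<open>In \<open>whittaker_L\<close> the coordinates are hidden behind the group element; this
  recovers them.\<close>

lemma X_mat_inj:
  assumes "positive n t" "positive n t'" "X_mat n t = X_mat n t'"
  shows "\<forall>a\<in>coords n. t a = t' a"
  using triangular_factorization_unique[OF assms(1,2), of "\<lambda>_. 1" "\<lambda>_. 1" "1\<^sub>m (Suc (2 * n))" "1\<^sub>m (Suc (2 * n))"]
    assms(3) one_unipotent by simp

lemma snd_word: "w \<in> set (word n) \<Longrightarrow> snd w \<in> coords n"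
  using snd_row_word[of w n] by (auto simp: word_def)

lemma X_mat_cong: "(\<And>a. a \<in> coords n \<Longrightarrow> t a = t' a) \<Longrightarrow> X_mat n t = X_mat n t'"
  unfolding X_mat_def using snd_word by (intro arg_cong[where f = "mat_prod n"] map_cong refl) (force split: prod.split)

lemma chi_cong: "(\<And>k. k \<in> {1..n} \<Longrightarrow> T k = T' k) \<Longrightarrow> chi n \<nu> T = chi n \<nu> T'"
  unfolding chi_def by (intro prod.cong) auto

lemma pairs_Sigma: "pairs n = (SIGMA i:{1..n}. {i<..n})"
  by (auto simp: pairs_def)

lemma finite_pairs [simp]: "finite (pairs n)"
  by (simp add: pairs_Sigma)

lemma char_exp_row_sum: "char_exp n t = complex_of_real (exp (- (\<Sum>k = 1..n. row_sum n t k)))"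
proof -
  have "(\<Sum>(i, j)\<in>pairs n. t (DblA i j) + t (DblB i j)) + (\<Sum>i = 1..n. t (Sgl i)) = (\<Sum>k = 1..n. row_sum n t k)"
    by (simp add: pairs_Sigma row_sum_def sum.distrib flip: sum.Sigma)
  then show ?thesis unfolding char_exp_def by (simp add: algebra_simps)
qed

lemma char_exp_cong: "(\<And>a. a \<in> coords n \<Longrightarrow> t a = t' a) \<Longrightarrow> char_exp n t = char_exp n t'"
proof -
  assume "\<And>a. a \<in> coords n \<Longrightarrow> t a = t' a"
  then have "row_sum n t k = row_sum n t' k" if "k \<in> {1..n}" for k
    using that unfolding row_sum_def by (intro arg_cong2[where f = "(+)"] sum.cong) auto
  then show ?thesis unfolding char_exp_row_sum by simp
qed

lemma left_factorization_exists:
  assumes t: "positive n t"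
  obtains Y p where "lower_unipotent n Y" "positive n p"
    "X_mat n (\<lambda>a. - t a) * w0_bar n = Y * torus n (torus_part n 1 t) * X_mat n p"
    "(\<Sum>k = 1..n. row_sum n p k) = potential n 1 t"
proof -
  define T where "T = torus_part n 1 t"
  from factorization[of 1 n t] t obtain p u where p: "positive n p"
    and u: "\<And>a. a \<in> ixs n \<Longrightarrow> lower_row n (Suc 0) T a (u a)"
    and eq: "\<And>a. a \<in> ixs n \<Longrightarrow> weyl_act n (tail_word n (Suc 0)) (word_act n (\<lambda>a. - t a) (tail_word n (Suc 0)) (basis a)) = word_act n p (tail_word n (Suc 0)) (u a)"
    and sum: "(\<Sum>k = 1..n. row_sum n p k) = potential n 1 t"
    by (auto simp: T_def)
  have Tpos: "0 < diag_entry T b" if "b \<in> ixs n" for b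
    using that torus_part_pos[OF t, of 1] by (cases b) (auto simp: diag_entry_def T_def)
  \<comment> \<open>Recovers the index from its position, so that a matrix can be assembled from the
    row functions \<open>u\<close>; dividing by the diagonal then splits off the torus part.\<close>
  define ix where "ix = the_inv_into (ixs n) (ixpos n)"
  have ix: "ix (ixpos n a) = a" if "a \<in> ixs n" for a
    unfolding ix_def using bij_ixpos[of n] that by (intro the_inv_into_f_f) (auto simp: bij_betw_def)
  define Y where "Y = Matrix.mat (Suc (2 * n)) (Suc (2 * n)) (\<lambda>(r, c). u (ix r) (ix c) / diag_entry T (ix c))"
  have Yc: "Y \<in> mats n" by (simp add: Y_def)
  have Ye: "Y $$ (ixpos n a, ixpos n b) = u a b / diag_entry T b" if "a \<in> ixs n" "b \<in> ixs n" for a b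
    using that ixpos_less[of _ n] by (simp add: Y_def ix)
  have "lower_unipotent n Y"
    unfolding lower_unipotent_def
  proof (intro conjI allI impI)
    show "Y \<in> carrier_mat (2 * n + 1) (2 * n + 1)" using Yc by simp
    fix r assume "r < 2 * n + 1"
    then obtain a where a: "a \<in> ixs n" "r = ixpos n a" using ixpos_surj[of r n] by auto
    then show "Y $$ (r, r) = 1" using u[OF a(1)] Tpos[OF a(1)] by (simp add: Ye lower_row_def)
  next
    fix c r assume "c < 2 * n + 1" "r < c"
    then obtain a b where "a \<in> ixs n" "r = ixpos n a" "b \<in> ixs n" "c = ixpos n b"
      using ixpos_surj[of r n] ixpos_surj[of c n] by auto
    then show "Y $$ (r, c) = 0" using u[of a] \<open>r < c\<close> by (simp add: Ye lower_row_def)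
  qed
  moreover have "X_mat n (\<lambda>a. - t a) * w0_bar n = Y * torus n T * X_mat n p"
  proof (rule mat_eq_act)
    fix a assume a: "a \<in> ixs n"
    have "act n (torus n T) (act n Y (basis a)) = u a"
    proof
      fix b
      show "act n (torus n T) (act n Y (basis a)) b = u a b"
      proof (cases "b \<in> ixs n")
        case True
        then show ?thesis using Tpos[OF True] by (simp only: act_torus[OF supported_act] act_basis[OF a] Ye[OF a]) simp
      next
        case False
        then show ?thesis using u[OF a] by (simp add: act_def lower_row_def supported_def)
      qed
    qed
    moreover have "supported (ixs n) (u a)" using u[OF a] by (simp add: lower_row_def)
    moreover have "act n (w0_bar n) (word_act n (\<lambda>a. - t a) (tail_word n (Suc 0)) (basis a))
        = weyl_act n (tail_word n (Suc 0)) (word_act n (\<lambda>a. - t a) (tail_word n (Suc 0)) (basis a))"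
      using act_X_mat(2)[OF supported_basis[OF a], of "\<lambda>a. - t a"] supported_act by (intro act_w0_bar) metis
    ultimately show "act n (X_mat n (\<lambda>a. - t a) * w0_bar n) (basis a) = act n (Y * torus n T * X_mat n p) (basis a)"
      using Yc eq[OF a] by (simp add: act_mult act_X_mat(2) supported_basis[OF a])
  qed (use Yc in simp_all)
  ultimately show ?thesis using that p sum unfolding T_def by blast
qed

lemma whittaker_L_eq:
  assumes t: "positive n t"
  shows "whittaker_L n \<nu> (X_mat n t) = chi n \<nu> (torus_part n 1 t) * complex_of_real (exp (- potential n 1 t))"
proof -
  obtain Y p where Y: "lower_unipotent n Y" and p: "positive n p"
    and eq: "X_mat n (\<lambda>a. - t a) * w0_bar n = Y * torus n (torus_part n 1 t) * X_mat n p"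
    and sum: "(\<Sum>k = 1..n. row_sum n p k) = potential n 1 t"
    using left_factorization_exists[OF t] .
  have ce: "char_exp n p = complex_of_real (exp (- potential n 1 t))"
    by (simp only: char_exp_row_sum sum)
  have Tp: "\<forall>k\<in>{1..n}. 0 < torus_part n 1 t k" using torus_part_pos[OF t, of 1] by simp
  show ?thesis
    unfolding whittaker_L_def
  proof (rule the_equality)
    show "\<exists>t' Y T p. positive n t' \<and> X_mat n t = X_mat n t' \<and> lower_unipotent n Y \<and> (\<forall>k\<in>{1..n}. 0 < T k) \<and> positive n p \<and>
      X_mat n (\<lambda>a. - t' a) * w0_bar n = Y * torus n T * X_mat n p \<and>
      chi n \<nu> (torus_part n 1 t) * complex_of_real (exp (- potential n 1 t)) = chi n \<nu> T * char_exp n p"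
      using t Y Tp p eq ce by metis
    fix v
    assume "\<exists>t' Y T p. positive n t' \<and> X_mat n t = X_mat n t' \<and> lower_unipotent n Y \<and> (\<forall>k\<in>{1..n}. 0 < T k) \<and> positive n p \<and>
      X_mat n (\<lambda>a. - t' a) * w0_bar n = Y * torus n T * X_mat n p \<and> v = chi n \<nu> T * char_exp n p"
    then obtain t' Y' T' p' where h: "positive n t'" "X_mat n t = X_mat n t'" "lower_unipotent n Y'" "\<forall>k\<in>{1..n}. 0 < T' k"
      "positive n p'" "X_mat n (\<lambda>a. - t' a) * w0_bar n = Y' * torus n T' * X_mat n p'" "v = chi n \<nu> T' * char_exp n p'"
      by blast
    \<comment> \<open>Equal group elements have equal coordinates, so the negated coordinates agree
      as well and both factorizations concern the same matrix.\<close>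
    have "X_mat n (\<lambda>a. - t a) = X_mat n (\<lambda>a. - t' a)"
      using X_mat_inj[OF t h(1,2)] by (intro X_mat_cong) simp
    then have e: "Y * torus n (torus_part n 1 t) * X_mat n p = Y' * torus n T' * X_mat n p'" using eq h(6) by simp
    have "chi n \<nu> (torus_part n 1 t) = chi n \<nu> T'" "char_exp n p = char_exp n p'"
      using triangular_factorization_unique[OF p h(5) Tp h(4) Y h(3) e] by (auto intro!: chi_cong char_exp_cong)
    then show "v = chi n \<nu> (torus_part n 1 t) * complex_of_real (exp (- potential n 1 t))"
      using h(7) ce by simp
  qed
qed

text \<open>The simple root of the letter belonging to a coordinate, evaluated at x.\<close>

fun weight :: "nat \<Rightarrow> (nat \<Rightarrow> real) \<Rightarrow> coord \<Rightarrow> real" where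
  "weight n x (DblA k l) = x (l - 1) - x l"
| "weight n x (DblB k l) = x (l - 1) - x l"
| "weight n x (Sgl k) = x n"

lemma one_SO_split: "1\<^sub>m (Suc (2 * n)) \<in> SO_split n"
  by (auto simp: SO_split_def)

text \<open>The torus element exp (- h(x)) is moved to the left of X, which rescales each coordinate
  by the exponential of its root. The factorization is then explicit, with Y = 1.\<close>

lemma whittaker_R_eq:
  assumes t: "positive n t"
  shows "whittaker_R n \<mu> (X_mat n t * mat_exp (- cartan n x))
    = chi n \<mu> (\<lambda>k. exp (- x k)) * char_exp n (\<lambda>a. t a * exp (weight n x a))"
proof -
  define T where "T = (\<lambda>k. exp (- x k))"
  define t' where "t' = (\<lambda>a. t a * exp (weight n x a))"
  have t': "positive n t'" using t by (simp add: positive_def t'_def)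
  have Tp: "\<forall>k\<in>{1..n}. 0 < T k" by (simp add: T_def)
  have torus_act: "torus_act n T v = (\<lambda>b. diag_entry T b * v b)" for v
    by (auto simp: torus_act_def diag_entry_def fun_eq_iff split: ix.split)
  have eq: "X_mat n t * mat_exp (- cartan n x) = 1\<^sub>m (Suc (2 * n)) * torus n T * X_mat n t'"
  proof (rule mat_eq_act)
    have E: "mat_exp (- cartan n x) \<in> mats n"
      using act_exp_cartan(1)[where n = n and v = "\<lambda>_. 0" and x = x] by (simp add: supported_def)
    then show "X_mat n t * mat_exp (- cartan n x) \<in> mats n" "1\<^sub>m (Suc (2 * n)) * torus n T * X_mat n t' \<in> mats n"
      by simp_all
    fix a assume a: "a \<in> ixs n"
    have "act n (X_mat n t * mat_exp (- cartan n x)) (basis a) = torus_act n T (word_act n t (tail_word n (Suc 0)) (basis a))"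
      using E act_exp_cartan(2)[OF supported_act[of n "X_mat n t" "basis a"], where x = x]
      by (simp add: act_mult act_X_mat(2) supported_basis[OF a] T_def)
    also have "\<dots> = word_act n t' (tail_word n (Suc 0)) (torus_act n T (basis a))"
    proof (rule torus_act_wop[where i = "Suc 0"])
      fix w assume w: "w \<in> set (tail_word n (Suc 0))"
      then show "Suc 0 \<le> fst w \<and> fst w \<le> n" by (intro tail_word_letters) auto
      show "t' (snd w) = t (snd w) * (if fst w < n then T (Suc (fst w)) else 1) / T (fst w)"
        using w by (cases rule: tail_word_cases) (auto simp: t'_def T_def exp_diff exp_minus field_simps)
    qed (simp add: T_def)
    also have "\<dots> = act n (1\<^sub>m (Suc (2 * n)) * torus n T * X_mat n t') (basis a)"
      using act_X_mat(2)[OF supported_act[of n "torus n T" "basis a"], where t = t']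
      by (simp add: act_mult act_one supported_basis[OF a] act_torus torus_act)
    finally show "act n (X_mat n t * mat_exp (- cartan n x)) (basis a) = act n (1\<^sub>m (Suc (2 * n)) * torus n T * X_mat n t') (basis a)" .
  qed
  show ?thesis
    unfolding whittaker_R_def T_def[symmetric] t'_def[symmetric]
  proof (rule the_equality)
    show "\<exists>Y S s. Y \<in> SO_split n \<and> lower_unipotent n Y \<and> (\<forall>k\<in>{1..n}. 0 < S k) \<and> positive n s \<and>
      X_mat n t * mat_exp (- cartan n x) = Y * torus n S * X_mat n s \<and> chi n \<mu> T * char_exp n t' = chi n \<mu> S * char_exp n s"
      using one_SO_split one_unipotent Tp t' eq by metis
    fix v
    assume "\<exists>Y S s. Y \<in> SO_split n \<and> lower_unipotent n Y \<and> (\<forall>k\<in>{1..n}. 0 < S k) \<and> positive n s \<and>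
      X_mat n t * mat_exp (- cartan n x) = Y * torus n S * X_mat n s \<and> v = chi n \<mu> S * char_exp n s"
    then obtain Y S s where h: "lower_unipotent n Y" "\<forall>k\<in>{1..n}. 0 < S k" "positive n s"
      "X_mat n t * mat_exp (- cartan n x) = Y * torus n S * X_mat n s" "v = chi n \<mu> S * char_exp n s" by blast
    have "1\<^sub>m (Suc (2 * n)) * torus n T * X_mat n t' = Y * torus n S * X_mat n s" using eq h(4) by simp
    from triangular_factorization_unique[OF t' h(3) Tp h(2) one_unipotent h(1) this]
    have "chi n \<mu> T = chi n \<mu> S" "char_exp n t' = char_exp n s" by (auto intro!: chi_cong char_exp_cong)
    then show "v = chi n \<mu> T * char_exp n t'" using h(5) by simp
  qed
qed

section \<open>The wave function in logarithmic coordinates\<close>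

lemma finite_coords [simp]: "finite (coords n)"
  by (simp add: coords_def)

text \<open>Proved for commutative monoids so that it serves sums and products alike.\<close>

lemma (in comm_monoid_set) coords_split:
  "F h (coords n) = F (\<lambda>k. h (Sgl k) \<^bold>* F (\<lambda>l. h (DblA k l) \<^bold>* h (DblB k l)) {k<..n}) {1..n}"
proof -
  have "F h (coords n) = F h ((\<lambda>(i, j). DblA i j) ` pairs n \<union> (\<lambda>(i, j). DblB i j) ` pairs n) \<^bold>* F h (Sgl ` {1..n})"
    unfolding coords_def by (rule union_disjoint) auto
  also have "F h ((\<lambda>(i, j). DblA i j) ` pairs n \<union> (\<lambda>(i, j). DblB i j) ` pairs n)
      = F h ((\<lambda>(i, j). DblA i j) ` pairs n) \<^bold>* F h ((\<lambda>(i, j). DblB i j) ` pairs n)"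
    by (rule union_disjoint) auto
  also have "F h ((\<lambda>(i, j). DblA i j) ` pairs n) = F (\<lambda>(i, j). h (DblA i j)) (pairs n)"
    by (subst reindex) (auto simp: inj_on_def comp_def case_prod_beta)
  also have "F h ((\<lambda>(i, j). DblB i j) ` pairs n) = F (\<lambda>(i, j). h (DblB i j)) (pairs n)"
    by (subst reindex) (auto simp: inj_on_def comp_def case_prod_beta)
  also have "F h (Sgl ` {1..n}) = F (\<lambda>i. h (Sgl i)) {1..n}"
    by (subst reindex) (auto simp: inj_on_def comp_def)
  finally show ?thesis
    by (simp add: pairs_Sigma Sigma[symmetric] distrib ac_simps)
qed

lemma prod_pairs: "(\<Prod>(k, l)\<in>pairs n. f k l) = (\<Prod>k = 1..n. \<Prod>l\<in>{k<..n}. f k l)"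
  by (simp add: pairs_Sigma prod.Sigma)

lemma sum_pairs_swap:
  fixes n :: nat
  shows "(\<Sum>k = 1..n. \<Sum>l\<in>{k<..n}. f k l) = (\<Sum>l = 1..n. \<Sum>k\<in>{1..<l}. f k l)"
proof -
  have "(\<Sum>k = 1..n. \<Sum>l\<in>{k<..n}. f k l) = (\<Sum>(k, l)\<in>(SIGMA k:{1..n}. {k<..n}). f k l)"
    by (rule sum.Sigma) simp_all
  also have "\<dots> = (\<Sum>(l, k)\<in>(SIGMA l:{1..n}. {1..<l}). f k l)"
    by (rule sum.reindex_bij_witness[of _ "\<lambda>(l, k). (k, l)" "\<lambda>(l, k). (k, l)"]) auto
  also have "\<dots> = (\<Sum>l = 1..n. \<Sum>k\<in>{1..<l}. f k l)"
    by (rule sum.Sigma[symmetric]) simp_all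
  finally show ?thesis .
qed

section \<open>Logarithms of the monomials\<close>

definition lratio :: "nat \<Rightarrow> (coord \<Rightarrow> real) \<Rightarrow> nat \<Rightarrow> nat \<Rightarrow> real" where
  "lratio n \<tau> m l = (if l \<le> n then \<tau> (DblA m l) - \<tau> (DblB m l) else 0)"

definition lcol :: "nat \<Rightarrow> (coord \<Rightarrow> real) \<Rightarrow> nat \<Rightarrow> nat \<Rightarrow> real" where
  "lcol n \<tau> k l = (if l \<le> n then \<tau> (DblA k l) else \<tau> (Sgl k))"

definition lpot :: "nat \<Rightarrow> (coord \<Rightarrow> real) \<Rightarrow> nat \<Rightarrow> nat \<Rightarrow> real" where
  "lpot n \<tau> k l = (\<Sum>m\<in>{1..<k}. lratio n \<tau> m (l - 1) - lratio n \<tau> m l) - lcol n \<tau> k l"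

text \<open>The logarithms of the exponents of the left Whittaker vector, indexed by coordinates:
  each is \<open>-\<tau>\<^sub>a\<close> plus a linear function of coordinates that precede \<open>a\<close>.\<close>

fun shift :: "nat \<Rightarrow> coord \<Rightarrow> (coord \<Rightarrow> real) \<Rightarrow> real" where
  "shift n (DblA k l) \<tau> = (\<Sum>m\<in>{1..<k}. lratio n \<tau> m (l - 1) - lratio n \<tau> m l)"
| "shift n (Sgl k) \<tau> = (\<Sum>m\<in>{1..<k}. lratio n \<tau> m n)"
| "shift n (DblB k l) \<tau> = \<tau> (DblA k l) + lpot n \<tau> k (Suc l)"

definition lexp :: "nat \<Rightarrow> (coord \<Rightarrow> real) \<Rightarrow> coord \<Rightarrow> real" where
  "lexp n \<tau> a = - \<tau> a + shift n a \<tau>"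

definition ltorus :: "nat \<Rightarrow> (coord \<Rightarrow> real) \<Rightarrow> nat \<Rightarrow> real" where
  "ltorus n \<tau> k = (\<Sum>l\<in>{k<..n}. \<tau> (DblA k l) + \<tau> (DblB k l)) + 2 * \<tau> (Sgl k) - (\<Sum>m\<in>{1..<k}. lratio n \<tau> m k)"

lemma lexp_simps:
  "k < l \<Longrightarrow> l \<le> n \<Longrightarrow> lexp n \<tau> (DblA k l) = lpot n \<tau> k l"
  "lexp n \<tau> (Sgl k) = lpot n \<tau> k (Suc n)"
  "k < l \<Longrightarrow> l \<le> n \<Longrightarrow> lexp n \<tau> (DblB k l) = lratio n \<tau> k l + lpot n \<tau> k (Suc l)"
  by (simp_all add: lexp_def lpot_def lcol_def lratio_def)

context
  fixes n :: nat and t :: "coord \<Rightarrow> real" and \<tau> :: "coord \<Rightarrow> real"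
  assumes t: "positive n t" and \<tau>: "\<And>a. a \<in> coords n \<Longrightarrow> \<tau> a = ln (t a)"
begin

lemma exp_log: "a \<in> coords n \<Longrightarrow> exp (\<tau> a) = t a"
  using t \<tau> by (simp add: positive_def)

lemma ratio_log: "1 \<le> m \<Longrightarrow> m < l \<Longrightarrow> ratio n t m l = exp (lratio n \<tau> m l)"
  by (simp add: ratio_def lratio_def exp_diff exp_log)

lemma potA_log: "1 \<le> k \<Longrightarrow> k < l \<Longrightarrow> l \<le> Suc n \<Longrightarrow> potA n (Suc 0) t k l = exp (lpot n \<tau> k l)"
proof -
  assume k: "1 \<le> k" "k < l" "l \<le> Suc n"
  have "tcol n t k l = exp (lcol n \<tau> k l)" using k by (simp add: tcol_def lcol_def exp_log)
  moreover have "(\<Prod>m\<in>{1..<k}. ratio n t m (l - 1) / ratio n t m l) = (\<Prod>m\<in>{1..<k}. exp (lratio n \<tau> m (l - 1) - lratio n \<tau> m l))"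
    using k by (intro prod.cong) (auto simp: ratio_log exp_diff)
  ultimately show ?thesis by (simp add: potA_def lpot_def exp_diff exp_sum)
qed

lemma potential_log: "potential n 1 t = (\<Sum>a\<in>coords n. exp (lexp n \<tau> a))"
proof -
  have "(\<Sum>l\<in>{k<..Suc n}. potA n (Suc 0) t k l) + (\<Sum>l\<in>{k<..n}. potB n (Suc 0) t k l)
      = exp (lexp n \<tau> (Sgl k)) + (\<Sum>l\<in>{k<..n}. exp (lexp n \<tau> (DblA k l)) + exp (lexp n \<tau> (DblB k l)))"
    if k: "k \<in> {1..n}" for k
  proof -
    have "{k<..Suc n} = insert (Suc n) {k<..n}" using k by auto
    moreover have "(\<Sum>l\<in>{k<..n}. potA n (Suc 0) t k l) = (\<Sum>l\<in>{k<..n}. exp (lexp n \<tau> (DblA k l)))"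
      using k by (intro sum.cong) (auto simp: potA_log lexp_simps)
    moreover have "(\<Sum>l\<in>{k<..n}. potB n (Suc 0) t k l) = (\<Sum>l\<in>{k<..n}. exp (lexp n \<tau> (DblB k l)))"
      using k by (intro sum.cong) (auto simp: potA_log potB_def ratio_log lexp_simps exp_add)
    moreover have "potA n (Suc 0) t k (Suc n) = exp (lexp n \<tau> (Sgl k))"
      using k by (simp add: potA_log lexp_simps)
    ultimately show ?thesis by (simp add: sum.distrib)
  qed
  then show ?thesis by (simp add: potential_def sum.coords_split)
qed

lemma torus_part_log: "k \<in> {1..n} \<Longrightarrow> torus_part n 1 t k = exp (ltorus n \<tau> k)"
proof -
  assume k: "k \<in> {1..n}"
  have "(\<Prod>l\<in>{k<..n}. t (DblB k l) * t (DblA k l)) = (\<Prod>l\<in>{k<..n}. exp (\<tau> (DblA k l) + \<tau> (DblB k l)))"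
    using k by (intro prod.cong) (auto simp: exp_add exp_log)
  moreover have "(t (Sgl k))\<^sup>2 = exp (2 * \<tau> (Sgl k))"
    using k by (simp add: exp_double exp_log)
  moreover have "(\<Prod>m\<in>{1..<k}. ratio n t m k) = (\<Prod>m\<in>{1..<k}. exp (lratio n \<tau> m k))"
    by (intro prod.cong) (auto simp: ratio_log)
  ultimately show ?thesis
    by (simp add: torus_part_def ltorus_def exp_diff exp_add exp_sum)
qed

text \<open>In logarithmic coordinates the measure is T^rho: collecting coefficients gives rho_k -
  rho_l = l - k, rho_k + rho_l = 2n + 1 - k - l and 2 rho_k = 2n + 1 - 2k, the prescribed exponents.
  The product over all coordinates is the Jacobian from dt = t d tau.\<close>

lemma jacobian_log:
  "((\<Prod>(i, j)\<in>pairs n. t (DblA i j) ^ (j - i) * t (DblB i j) ^ (2 * n + 1 - i - j) / (t (DblA i j) * t (DblB i j)))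
     * (\<Prod>i = 1..n. t (Sgl i) ^ (2 * n + 1 - 2 * i) / t (Sgl i))) * (\<Prod>a\<in>coords n. t a)
   = exp (\<Sum>k = 1..n. rho n k * ltorus n \<tau> k)"
proof -
  let ?a = "\<lambda>k l. t (DblA k l) ^ (l - k) * t (DblB k l) ^ (2 * n + 1 - k - l) / (t (DblA k l) * t (DblB k l))"
  let ?b = "\<lambda>k. t (Sgl k) ^ (2 * n + 1 - 2 * k) / t (Sgl k)"
  let ?c = "\<lambda>k l. real (l - k) * \<tau> (DblA k l) + real (2 * n + 1 - k - l) * \<tau> (DblB k l)"
  let ?d = "\<lambda>k. real (2 * n + 1 - 2 * k) * \<tau> (Sgl k)"
  have "((\<Prod>(i, j)\<in>pairs n. t (DblA i j) ^ (j - i) * t (DblB i j) ^ (2 * n + 1 - i - j) / (t (DblA i j) * t (DblB i j)))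
     * (\<Prod>i = 1..n. t (Sgl i) ^ (2 * n + 1 - 2 * i) / t (Sgl i))) * (\<Prod>a\<in>coords n. t a)
     = (\<Prod>k = 1..n. (\<Prod>l\<in>{k<..n}. ?a k l)
       * (?b k) * (t (Sgl k) * (\<Prod>l\<in>{k<..n}. t (DblA k l) * t (DblB k l))))"
    by (simp only: prod.coords_split prod_pairs prod.distrib)
  also have "\<dots> = (\<Prod>k = 1..n. exp ((\<Sum>l\<in>{k<..n}. ?c k l) + ?d k))"
  proof (rule prod.cong[OF refl])
    fix k assume k: "k \<in> {1..n}"
    have "(\<Prod>l\<in>{k<..n}. ?a k l)
        * (\<Prod>l\<in>{k<..n}. t (DblA k l) * t (DblB k l))
        = (\<Prod>l\<in>{k<..n}. exp (?c k l))"
      unfolding prod.distrib[symmetric]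
    proof (rule prod.cong[OF refl])
      fix l assume l: "l \<in> {k<..n}"
      then have e: "exp (\<tau> (DblA k l)) = t (DblA k l)" "exp (\<tau> (DblB k l)) = t (DblB k l)" using k by (simp_all add: exp_log)
      show "?a k l * (t (DblA k l) * t (DblB k l))
        = exp (?c k l)"
        unfolding e[symmetric] by (simp only: exp_add exp_of_nat_mult) simp
    qed
    note X = this
    have Y: "?b k * t (Sgl k) = exp (?d k)"
    proof -
      have e: "exp (\<tau> (Sgl k)) = t (Sgl k)" using k by (simp add: exp_log)
      show ?thesis unfolding e[symmetric] by (simp only: exp_of_nat_mult) simp
    qed
    have r: "a * b * (c * d) = (a * d) * (b * c)" for a b c d :: real by (simp add: mult_ac)
    show "(\<Prod>l\<in>{k<..n}. ?a k l)
       * (?b k) * (t (Sgl k) * (\<Prod>l\<in>{k<..n}. t (DblA k l) * t (DblB k l)))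
       = exp ((\<Sum>l\<in>{k<..n}. ?c k l) + ?d k)"
      by (subst r) (simp only: X Y exp_add exp_sum[OF finite_greaterThanAtMost])
  qed
  also have "\<dots> = exp (\<Sum>k = 1..n. (\<Sum>l\<in>{k<..n}. ?c k l) + ?d k)"
    by (rule exp_sum[OF finite_atLeastAtMost, symmetric])
  also have "(\<Sum>k = 1..n. (\<Sum>l\<in>{k<..n}. ?c k l) + ?d k)
      = (\<Sum>k = 1..n. rho n k * ltorus n \<tau> k)"
  proof -
    have "(\<Sum>k = 1..n. rho n k * ltorus n \<tau> k) = (\<Sum>k = 1..n. (\<Sum>l\<in>{k<..n}. rho n k * (\<tau> (DblA k l) + \<tau> (DblB k l))) + 2 * rho n k * \<tau> (Sgl k))
        - (\<Sum>k = 1..n. \<Sum>m\<in>{1..<k}. rho n k * lratio n \<tau> m k)"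
      by (simp add: ltorus_def sum_subtractf[symmetric] sum_distrib_left algebra_simps)
    \<comment> \<open>Exchanging the summations attaches each \<open>lratio\<close> to the row whose
      coordinates it contains, so that coefficients can be compared row by row.\<close>
    also have "(\<Sum>k = 1..n. \<Sum>m\<in>{1..<k}. rho n k * lratio n \<tau> m k) = (\<Sum>k = 1..n. \<Sum>l\<in>{k<..n}. rho n l * lratio n \<tau> k l)"
      by (rule sum_pairs_swap[symmetric])
    also have "(\<Sum>k = 1..n. (\<Sum>l\<in>{k<..n}. rho n k * (\<tau> (DblA k l) + \<tau> (DblB k l))) + 2 * rho n k * \<tau> (Sgl k)) - \<dots>
        = (\<Sum>k = 1..n. (\<Sum>l\<in>{k<..n}. rho n k * (\<tau> (DblA k l) + \<tau> (DblB k l)) - rho n l * lratio n \<tau> k l) + 2 * rho n k * \<tau> (Sgl k))"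
      by (simp add: sum_subtractf sum.distrib)
    also have "\<dots> = (\<Sum>k = 1..n. (\<Sum>l\<in>{k<..n}. ?c k l) + ?d k)"
      by (intro sum.cong arg_cong2[where f = "(+)"] refl)
         (auto simp: rho_def lratio_def of_nat_diff algebra_simps)
    finally show ?thesis by simp
  qed
  finally show ?thesis .
qed

end

section \<open>Duality between the two families of exponents\<close>

lemma sum_telescope_nat:
  fixes f :: "nat \<Rightarrow> 'a::comm_ring_1"
  assumes "m \<le> l"
  shows "(\<Sum>k\<in>{m..<l}. f k - f (Suc k)) = f m - f l"
proof -
  have "(\<Sum>k\<in>{m..<l}. f k - f (Suc k)) = - (\<Sum>k\<in>{m..<l}. f (Suc k) - f k)"
    by (simp flip: sum_negf)
  then show ?thesis using sum_Suc_diff'[OF assms, of f] by simp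
qed

text \<open>The exponents pair with the logarithms by summation by parts twice: in the row index
  of \<open>gd\<close>, which telescopes to row \<open>m + 1\<close>, and then in the column index.\<close>

lemma exponent_duality:
  fixes tA tB ga de :: "nat \<Rightarrow> nat \<Rightarrow> 'a::comm_ring_1" and tS gs lm :: "nat \<Rightarrow> 'a" and n :: nat
  defines "R \<equiv> \<lambda>m l. if l \<le> n then tA m l - tB m l else 0"
    and "cl \<equiv> \<lambda>k l. if l \<le> n then tA k l else tS k"
    and "gd \<equiv> \<lambda>k l. if l \<le> n then ga k l + de k l else gs k"
  defines "pot \<equiv> \<lambda>k l. (\<Sum>m\<in>{1..<k}. R m (l - 1) - R m l) - cl k l"
    and "zA \<equiv> \<lambda>k l. gd k l - ga (Suc k) (l - 1) - de k (l - 1) + (lm k + lm (l - 1))"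
    and "zB \<equiv> \<lambda>k l. ga (Suc k) l + de k l - gd (Suc k) (Suc l) + (lm k - lm l)"
  assumes ga: "\<And>k l. l \<le> k \<Longrightarrow> ga k l = 0" and de: "\<And>k l. l \<le> k \<Longrightarrow> de k l = 0" and gs: "gs (Suc n) = 0"
  shows "(\<Sum>k = 1..n. (gs k - gs (Suc k)) * tS k
      + (\<Sum>l\<in>{k<..n}. (ga k l - ga (Suc k) l) * tA k l + (de k l - de (Suc k) l) * tB k l))
    + (\<Sum>k = 1..n. lm k * ((\<Sum>l\<in>{k<..n}. tA k l + tB k l) + 2 * tS k - (\<Sum>m\<in>{1..<k}. R m k)))
    = - (\<Sum>k = 1..n. zA k (Suc n) * pot k (Suc n)
      + (\<Sum>l\<in>{k<..n}. zA k l * pot k l + zB k l * (R k l + pot k (Suc l))))"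
proof -
  \<comment> \<open>The total coefficient of \<open>pot k l\<close>. The term with \<open>zB\<close>
    refers to the next column, so after a shift it joins \<open>zA\<close>; the parts with
    \<open>ga\<close> and \<open>de\<close> then combine to a difference of
    \<open>gd\<close>.\<close>
  define w where "w k l = gd k l - gd (Suc k) l + 2 * lm k" for k l
  let ?Q = "\<lambda>k m. (\<Sum>l\<in>{k<..Suc n}. (gd k l - gd (Suc k) l) * (R m (l - 1) - R m l))"
  let ?H = "\<lambda>k. (\<Sum>l\<in>{k<..n}. R k l * (gd (Suc k) (Suc l) - gd (Suc k) l + zB k l) + 2 * lm l * R k l - w k l * tA k l)"
  let ?L = "\<lambda>k. (\<Sum>l\<in>{k<..n}. (ga k l - ga (Suc k) l) * tA k l + (de k l - de (Suc k) l) * tB k l)"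
  let ?Z = "\<lambda>k. zA k (Suc n) * pot k (Suc n) + (\<Sum>l\<in>{k<..n}. zA k l * pot k l + zB k l * (R k l + pot k (Suc l)))"
  let ?M = "\<lambda>k. (\<Sum>l\<in>{k<..n}. lm k * (tA k l + tB k l) - lm l * R k l)"
  let ?V = "\<lambda>k. (\<Sum>l\<in>{k<..Suc n}. w k l * pot k l)"
  let ?W = "\<lambda>k m. (\<Sum>l\<in>{k<..Suc n}. w k l * (R m (l - 1) - R m l))"
  \<comment> \<open>These diagonal values are the boundary terms of the telescoping over rows; in
    column n + 1 the claim is the convention for \<open>gs\<close>.\<close>
  have gd0: "gd l l = 0" if "l \<le> Suc n" for l
    using that ga[of l l] de[of l l] gs by (auto simp: gd_def le_Suc_eq)
  have RS: "R m (Suc n) = 0" for m by (simp add: R_def)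
  have ins: "{k<..Suc n} = insert (Suc n) {k<..n}" if "k \<in> {1..n}" for k using that by auto
  have shift: "(\<Sum>l\<in>{k<..n}. f (Suc l)) = (\<Sum>l\<in>{Suc k<..Suc n}. f l)" for k and f :: "nat \<Rightarrow> 'a"
    by (rule sum.reindex_bij_witness[of _ "\<lambda>l. l - 1" Suc]) auto
  have inner: "?Z k
      = ?V k + (\<Sum>l\<in>{k<..n}. zB k l * R k l)" if k: "k \<in> {1..n}" for k
  proof -
    have "(\<Sum>l\<in>{k<..n}. zB k l * pot k (Suc l)) = (\<Sum>l\<in>{Suc k<..Suc n}. zB k (l - 1) * pot k l)"
      using shift[where k = k and f = "\<lambda>l. zB k (l - 1) * pot k l"] by simp
    moreover have "?V k = (\<Sum>l\<in>{k<..Suc n}. zA k l * pot k l) + (\<Sum>l\<in>{Suc k<..Suc n}. zB k (l - 1) * pot k l)"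
    proof -
      have i2: "{k<..Suc n} = insert (Suc k) {Suc k<..Suc n}" using k by auto
      have "w k (Suc k) = zA k (Suc k)"
        using gd0[of "Suc k"] k ga[of k "Suc k"] de[of k k] by (simp add: w_def zA_def ga)
      moreover have "w k l = zA k l + zB k (l - 1)" if "l \<in> {Suc k<..Suc n}" for l
        using that by (simp add: w_def zA_def zB_def)
      ultimately show ?thesis by (simp add: i2 distrib_right sum.distrib)
    qed
    ultimately show ?thesis by (simp add: ins[OF k] algebra_simps sum.distrib)
  qed
  have rowk: "?V k
      = (\<Sum>m\<in>{1..<k}. ?Q k m + 2 * lm k * R m k)
        - ((\<Sum>l\<in>{k<..n}. w k l * tA k l) + w k (Suc n) * tS k)" if k: "k \<in> {1..n}" for k
  proof -
    have "?V k = (\<Sum>l\<in>{k<..Suc n}. \<Sum>m\<in>{1..<k}. w k l * (R m (l - 1) - R m l)) - (\<Sum>l\<in>{k<..Suc n}. w k l * cl k l)"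
      by (simp add: pot_def right_diff_distrib sum_subtractf sum_distrib_left)
    also have "(\<Sum>l\<in>{k<..Suc n}. \<Sum>m\<in>{1..<k}. w k l * (R m (l - 1) - R m l)) = (\<Sum>m\<in>{1..<k}. \<Sum>l\<in>{k<..Suc n}. w k l * (R m (l - 1) - R m l))"
      by (rule sum.swap)
    also have "\<dots> = (\<Sum>m\<in>{1..<k}. ?Q k m + 2 * lm k * R m k)"
    proof (rule sum.cong[OF refl])
      fix m
      \<comment> \<open>The part 2 lm k of \<open>w\<close> does not depend on the column, so its
        sum telescopes to \<open>R m k\<close>; it later meets the same expression in the torus
        term.\<close>
      have "(\<Sum>l\<in>{k<..Suc n}. R m (l - 1) - R m l) = (\<Sum>l\<in>{k..<Suc n}. R m l - R m (Suc l))"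
        by (rule sum.reindex_bij_witness[of _ Suc "\<lambda>l. l - 1"]) auto
      also have "\<dots> = R m k" using k RS by (subst sum_telescope_nat) auto
      finally have tel: "(\<Sum>l\<in>{k<..Suc n}. R m (l - 1) - R m l) = R m k" .
      have "?W k m
          = ?Q k m + (\<Sum>l\<in>{k<..Suc n}. 2 * lm k * (R m (l - 1) - R m l))"
        unfolding w_def by (simp only: distrib_right sum.distrib)
      then show "?W k m
          = ?Q k m + 2 * lm k * R m k"
        by (simp only: tel flip: sum_distrib_left)
    qed
    also have "(\<Sum>l\<in>{k<..Suc n}. w k l * cl k l) = (\<Sum>l\<in>{k<..n}. w k l * tA k l) + w k (Suc n) * tS k"
    proof -
      have "(\<Sum>l\<in>{k<..n}. w k l * cl k l) = (\<Sum>l\<in>{k<..n}. w k l * tA k l)"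
        by (intro sum.cong) (auto simp: cl_def)
      moreover have "cl k (Suc n) = tS k" by (simp add: cl_def)
      ultimately show ?thesis by (simp add: ins[OF k] add.commute)
    qed
    finally show ?thesis .
  qed
  \<comment> \<open>Row m of \<open>R\<close> receives contributions from all rows k > m. Summing
    over k first telescopes \<open>gd\<close>; a shift of the column then leaves a difference of
    neighbouring columns.\<close>
  have Y: "(\<Sum>k\<in>{m<..n}. \<Sum>l\<in>{k<..Suc n}. (gd k l - gd (Suc k) l) * (R m (l - 1) - R m l))
      = (\<Sum>l\<in>{m<..n}. R m l * (gd (Suc m) (Suc l) - gd (Suc m) l))" if m: "m \<in> {1..n}" for m
  proof -
    have "(\<Sum>k\<in>{m<..n}. \<Sum>l\<in>{k<..Suc n}. (gd k l - gd (Suc k) l) * (R m (l - 1) - R m l))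
        = (\<Sum>(k, l)\<in>(SIGMA k:{m<..n}. {k<..Suc n}). (gd k l - gd (Suc k) l) * (R m (l - 1) - R m l))"
      by (rule sum.Sigma) simp_all
    also have "\<dots> = (\<Sum>(l, k)\<in>(SIGMA l:{m<..Suc n}. {Suc m..<l}). (gd k l - gd (Suc k) l) * (R m (l - 1) - R m l))"
      by (rule sum.reindex_bij_witness[of _ "\<lambda>(l, k). (k, l)" "\<lambda>(l, k). (k, l)"]) auto
    also have "\<dots> = (\<Sum>l\<in>{m<..Suc n}. \<Sum>k\<in>{Suc m..<l}. (gd k l - gd (Suc k) l) * (R m (l - 1) - R m l))"
      by (rule sum.Sigma[symmetric]) simp_all
    also have "\<dots> = (\<Sum>l\<in>{m<..Suc n}. gd (Suc m) l * (R m (l - 1) - R m l))"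
    proof (rule sum.cong[OF refl])
      fix l assume l: "l \<in> {m<..Suc n}"
      have "(\<Sum>k\<in>{Suc m..<l}. gd k l - gd (Suc k) l) = gd (Suc m) l - gd l l"
        using l by (intro sum_telescope_nat) auto
      then show "(\<Sum>k\<in>{Suc m..<l}. (gd k l - gd (Suc k) l) * (R m (l - 1) - R m l)) = gd (Suc m) l * (R m (l - 1) - R m l)"
        using l gd0[of l] by (simp flip: sum_distrib_right)
    qed
    also have "\<dots> = (\<Sum>l\<in>{m<..Suc n}. gd (Suc m) l * R m (l - 1)) - (\<Sum>l\<in>{m<..Suc n}. gd (Suc m) l * R m l)"
      by (simp add: right_diff_distrib sum_subtractf)
    also have "(\<Sum>l\<in>{m<..Suc n}. gd (Suc m) l * R m l) = (\<Sum>l\<in>{m<..n}. gd (Suc m) l * R m l)"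
      by (simp add: ins[OF m] RS)
    also have "(\<Sum>l\<in>{m<..Suc n}. gd (Suc m) l * R m (l - 1)) = (\<Sum>l\<in>{Suc m<..Suc n}. gd (Suc m) l * R m (l - 1))"
    proof -
      have "{m<..Suc n} = insert (Suc m) {Suc m<..Suc n}" using m by auto
      then show ?thesis using gd0[of "Suc m"] m by simp
    qed
    also have "\<dots> = (\<Sum>l\<in>{m<..n}. gd (Suc m) (Suc l) * R m l)"
      using shift[where k = m and f = "\<lambda>l. gd (Suc m) l * R m (l - 1)"] by simp
    finally show ?thesis by (simp add: algebra_simps sum_subtractf)
  qed
  have "(\<Sum>k = 1..n. ?Z k)
      = (\<Sum>k = 1..n. ?V k + (\<Sum>l\<in>{k<..n}. zB k l * R k l))"
    by (intro sum.cong refl inner)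
  also have "\<dots> = (\<Sum>k = 1..n. \<Sum>m\<in>{1..<k}. ?Q k m + 2 * lm k * R m k)
      - (\<Sum>k = 1..n. (\<Sum>l\<in>{k<..n}. w k l * tA k l) + w k (Suc n) * tS k) + (\<Sum>k = 1..n. \<Sum>l\<in>{k<..n}. zB k l * R k l)"
    unfolding sum_subtractf[symmetric] sum.distrib[symmetric] by (rule sum.cong[OF refl]) (simp only: rowk sum.distrib)
  also have "(\<Sum>k = 1..n. \<Sum>m\<in>{1..<k}. ?Q k m + 2 * lm k * R m k)
      = (\<Sum>m = 1..n. \<Sum>k\<in>{m<..n}. ?Q k m + 2 * lm k * R m k)"
    by (rule sum_pairs_swap[symmetric])
  also have "\<dots> = (\<Sum>m = 1..n. \<Sum>l\<in>{m<..n}. R m l * (gd (Suc m) (Suc l) - gd (Suc m) l) + 2 * lm l * R m l)"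
    by (rule sum.cong[OF refl]) (simp only: sum.distrib Y)
  finally have total: "(\<Sum>k = 1..n. ?Z k)
      = (\<Sum>k = 1..n. ?H k - w k (Suc n) * tS k)"
    by (simp add: sum.distrib sum_subtractf algebra_simps)
  have "(\<Sum>k = 1..n. lm k * ((\<Sum>l\<in>{k<..n}. tA k l + tB k l) + 2 * tS k - (\<Sum>m\<in>{1..<k}. R m k)))
      = (\<Sum>k = 1..n. (\<Sum>l\<in>{k<..n}. lm k * (tA k l + tB k l)) + 2 * lm k * tS k) - (\<Sum>k = 1..n. \<Sum>m\<in>{1..<k}. lm k * R m k)"
    by (simp add: sum_distrib_left sum_subtractf[symmetric] algebra_simps)
  also have "(\<Sum>k = 1..n. \<Sum>m\<in>{1..<k}. lm k * R m k) = (\<Sum>k = 1..n. \<Sum>l\<in>{k<..n}. lm l * R k l)"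
    by (rule sum_pairs_swap[symmetric])
  finally have LT: "(\<Sum>k = 1..n. lm k * ((\<Sum>l\<in>{k<..n}. tA k l + tB k l) + 2 * tS k - (\<Sum>m\<in>{1..<k}. R m k)))
      = (\<Sum>k = 1..n. ?M k + 2 * lm k * tS k)"
    by (simp add: sum.distrib sum_subtractf)
  \<comment> \<open>After the exchanges of summation both sides involve, for each row index, only
    the variables of that row, so they can be compared row by row.\<close>
  show ?thesis
    unfolding total LT sum.distrib[symmetric] sum_negf[symmetric]
  proof (rule sum.cong[OF refl])
    fix k assume k: "k \<in> {1..n}"
    have "(ga k l - ga (Suc k) l) * tA k l + (de k l - de (Suc k) l) * tB k l + (lm k * (tA k l + tB k l) - lm l * R k l)
        = - (R k l * (gd (Suc k) (Suc l) - gd (Suc k) l + zB k l) + 2 * lm l * R k l - w k l * tA k l)" if "l \<in> {k<..n}" for l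
      using that by (simp add: w_def zB_def gd_def R_def algebra_simps)
    then have "(\<Sum>l\<in>{k<..n}. (ga k l - ga (Suc k) l) * tA k l + (de k l - de (Suc k) l) * tB k l + (lm k * (tA k l + tB k l) - lm l * R k l))
        = - ?H k"
      unfolding sum_negf[symmetric] by (intro sum.cong refl)
    then have e: "?L k + ?M k
        = - ?H k"
      by (simp only: sum.distrib)
    have "a + b + (c + d) = - (e - f)" if "b + c = - e" "a + d = f" for a b c d e f :: 'a
    proof -
      have "a + b + (c + d) = (b + c) + (a + d)" by (simp add: algebra_simps)
      then show ?thesis using that by simp
    qed
    moreover have "(gs k - gs (Suc k)) * tS k + 2 * lm k * tS k = w k (Suc n) * tS k"
      by (simp add: w_def gd_def algebra_simps)
    ultimately show "(gs k - gs (Suc k)) * tS k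
        + ?L k
        + (?M k + 2 * lm k * tS k)
        = - (?H k - w k (Suc n) * tS k)"
      using e by blast
  qed
qed

section \<open>The linear changes of variables and the Gamma arguments\<close>

lemma measurable_coord [measurable]: "a \<in> coords n \<Longrightarrow> (\<lambda>y. y a) \<in> borel_measurable (coord_measure n)"
  unfolding coord_measure_def by measurable

lemma measurable_lratio: "1 \<le> m \<Longrightarrow> m < l \<Longrightarrow> (\<lambda>\<tau>. lratio n \<tau> m l) \<in> borel_measurable (coord_measure n)"
  by (cases "l \<le> n") (auto simp: lratio_def intro!: borel_measurable_diff measurable_coord)

lemma measurable_lpot:
  assumes "1 \<le> k" "k < l" "l \<le> Suc n"
  shows "(\<lambda>\<tau>. lpot n \<tau> k l) \<in> borel_measurable (coord_measure n)"
  using assms unfolding lpot_def lcol_def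
  by (cases "l \<le> n") (auto intro!: borel_measurable_diff borel_measurable_sum measurable_lratio measurable_coord)

lemma measurable_shift:
  assumes "a \<in> coords n"
  shows "shift n a \<in> borel_measurable (coord_measure n)"
proof (cases a)
  case (DblA k l)
  have "shift n a = (\<lambda>\<tau>. \<Sum>m\<in>{1..<k}. lratio n \<tau> m (l - 1) - lratio n \<tau> m l)" using DblA by auto
  then show ?thesis using assms DblA by (auto intro!: borel_measurable_diff borel_measurable_sum measurable_lratio)
next
  case (DblB k l)
  have "shift n a = (\<lambda>\<tau>. \<tau> (DblA k l) + lpot n \<tau> k (Suc l))" using DblB by auto
  then show ?thesis using assms DblB by (auto intro!: borel_measurable_add measurable_lpot measurable_coord)
next
  case (Sgl k)
  have "shift n a = (\<lambda>\<tau>. \<Sum>m\<in>{1..<k}. lratio n \<tau> m n)" using Sgl by auto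
  then show ?thesis using assms Sgl by (auto intro!: borel_measurable_sum measurable_lratio)
qed

text \<open>The shifts of \<open>DblA k l\<close> and \<open>Sgl k\<close> involve earlier rows
  only, whereas that of \<open>DblB k l\<close> also involves \<open>DblA\<close> and
  \<open>Sgl\<close> coordinates of row k; it must therefore come after these.\<close>

fun rank :: "coord \<Rightarrow> nat" where
  "rank (DblA k l) = 2 * k" | "rank (Sgl k) = 2 * k" | "rank (DblB k l) = 2 * k + 1"

lemma shift_update:
  assumes "rank a \<le> rank b"
  shows "shift n a (y(b := v)) = shift n a y"
proof -
  have r: "lratio n (y(b := v)) m l = lratio n y m l" if "m < row_of b" for m l
    using that by (cases b) (auto simp: lratio_def)
  show ?thesis
  proof (cases a)
    case (DblA k l)
    then have "k \<le> row_of b" using assms by (cases b) auto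
    then show ?thesis using DblA by (auto intro!: sum.cong simp: r)
  next
    case (DblB k l)
    then have "k \<le> row_of b" "DblA k m \<noteq> b" "Sgl k \<noteq> b" for m using assms by (cases b; auto)+
    then show ?thesis using DblB by (auto intro!: sum.cong simp: r lpot_def lcol_def)
  next
    case (Sgl k)
    then have "k \<le> row_of b" using assms by (cases b) auto
    then show ?thesis using Sgl by (auto intro!: sum.cong simp: r)
  qed
qed

text \<open>The off-diagonal part of the map from the Mellin-Barnes variables to the differences
  \<open>udiff\<close>. It is triangular as well, with later rows coming first.\<close>

fun snext :: "nat \<Rightarrow> coord \<Rightarrow> (coord \<Rightarrow> real) \<Rightarrow> real" where
  "snext n (DblA k l) y = (if Suc k < l then - y (DblA (Suc k) l) else 0)"
| "snext n (DblB k l) y = (if Suc k < l then - y (DblB (Suc k) l) else 0)"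
| "snext n (Sgl k) y = (if k < n then - y (Sgl (Suc k)) else 0)"

fun udiff :: "nat \<Rightarrow> (coord \<Rightarrow> complex) \<Rightarrow> coord \<Rightarrow> complex" where
  "udiff n \<gamma> (DblA k l) = gam2 n \<gamma> k l - gam2 n \<gamma> (Suc k) l"
| "udiff n \<gamma> (DblB k l) = del2 n \<gamma> k l - del2 n \<gamma> (Suc k) l"
| "udiff n \<gamma> (Sgl k) = gam1 n \<gamma> k - gam1 n \<gamma> (Suc k)"

text \<open>The Gamma arguments produced by the integral over t. The exceptional cases are those
  where \<open>eta\<close> would be needed on the diagonal; there the two lambda terms coincide,
  which is the origin of 2 i lambda_k.\<close>

fun zarg :: "nat \<Rightarrow> (nat \<Rightarrow> real) \<Rightarrow> (coord \<Rightarrow> complex) \<Rightarrow> coord \<Rightarrow> complex" where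
  "zarg n lam \<gamma> (DblA k l) = (if l = Suc k then gam2 n \<gamma> k l + del2 n \<gamma> k l else eta n \<gamma> k (l - 1))
     + \<i> * of_real (lam k + lam (l - 1))"
| "zarg n lam \<gamma> (Sgl k) = (if k = n then gam1 n \<gamma> n else eta n \<gamma> k n) + \<i> * of_real (lam k + lam n)"
| "zarg n lam \<gamma> (DblB k l) = xi n \<gamma> k l + \<i> * of_real (lam k - lam l)"

lemma measurable_snext:
  assumes "a \<in> coords n"
  shows "snext n a \<in> borel_measurable (coord_measure n)"
proof (cases a)
  case (DblA k l)
  have "snext n a = (\<lambda>y. if Suc k < l then - y (DblA (Suc k) l) else 0)" using DblA by auto
  then show ?thesis using assms DblA by (cases "Suc k < l") (auto intro!: borel_measurable_uminus measurable_coord)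
next
  case (DblB k l)
  have "snext n a = (\<lambda>y. if Suc k < l then - y (DblB (Suc k) l) else 0)" using DblB by auto
  then show ?thesis using assms DblB by (cases "Suc k < l") (auto intro!: borel_measurable_uminus measurable_coord)
next
  case (Sgl k)
  have "snext n a = (\<lambda>y. if k < n then - y (Sgl (Suc k)) else 0)" using Sgl by auto
  then show ?thesis using assms Sgl by (cases "k < n") (auto intro!: borel_measurable_uminus measurable_coord)
qed

lemma snext_update: "b \<in> coords n \<Longrightarrow> a \<in> coords n \<Longrightarrow> n - row_of a \<le> n - row_of b \<Longrightarrow> snext n a (y(b := v)) = snext n a y"
  by (cases a; cases b) auto

lemma udiff_vertical:
  "a \<in> coords n \<Longrightarrow> udiff n (vertical c y) a = Complex (c a + snext n a c) (y a + snext n a y)"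
  by (cases a) (auto simp: gam2_def del2_def gam1_def pairs_def vertical_def complex_eq_iff)

lemma measurable_vertical: "a \<in> coords n \<Longrightarrow> (\<lambda>y. vertical c y a) \<in> borel_measurable (coord_measure n)"
  unfolding vertical_def by measurable

lemma measurable_gam [measurable]:
  "(\<lambda>y. gam2 n (vertical c y) k l) \<in> borel_measurable (coord_measure n)"
  "(\<lambda>y. del2 n (vertical c y) k l) \<in> borel_measurable (coord_measure n)"
  "(\<lambda>y. gam1 n (vertical c y) k) \<in> borel_measurable (coord_measure n)"
proof -
  have c: "(k, l) \<in> pairs n \<Longrightarrow> DblA k l \<in> coords n \<and> DblB k l \<in> coords n" by (simp add: pairs_def)
  show "(\<lambda>y. gam2 n (vertical c y) k l) \<in> borel_measurable (coord_measure n)"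
    "(\<lambda>y. del2 n (vertical c y) k l) \<in> borel_measurable (coord_measure n)"
    using c measurable_vertical[of _ n c] by (cases "(k, l) \<in> pairs n"; simp add: gam2_def del2_def)+
  show "(\<lambda>y. gam1 n (vertical c y) k) \<in> borel_measurable (coord_measure n)"
    using measurable_vertical[of "Sgl k" n c] by (cases "1 \<le> k"; cases "k \<le> n"; simp add: gam1_def)
qed

lemma measurable_xi_eta [measurable]:
  "(\<lambda>y. xi n (vertical c y) k l) \<in> borel_measurable (coord_measure n)"
  "(\<lambda>y. eta n (vertical c y) k l) \<in> borel_measurable (coord_measure n)"
  by (cases "l < n"; simp add: xi_def eta_def)+

lemma measurable_zarg: "(\<lambda>y. zarg n lam (vertical c y) b) \<in> borel_measurable (coord_measure n)"
proof (cases b)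
  case (DblA k l)
  then show ?thesis by (cases "l = Suc k") simp_all
next
  case (Sgl k)
  then show ?thesis by (cases "k = n") simp_all
qed simp

text \<open>Supplies the constants \<open>\<theta>\<close> of \<open>Mellin_Parseval\<close>: moving
  along the plane changes only imaginary parts.\<close>

lemma Re_zarg_vertical: "Re (zarg n lam (vertical c y) b) = Re (zarg n lam (\<lambda>a. of_real (c a)) b)"
proof -
  have "Re (gam2 n (vertical c y) k l) = Re (gam2 n (\<lambda>a. of_real (c a)) k l)"
    "Re (del2 n (vertical c y) k l) = Re (del2 n (\<lambda>a. of_real (c a)) k l)"
    "Re (gam1 n (vertical c y) k) = Re (gam1 n (\<lambda>a. of_real (c a)) k)" for k l
    by (simp_all add: gam2_def del2_def gam1_def vertical_def)
  then show ?thesis by (cases b) (simp_all add: xi_def eta_def)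
qed

lemma mb_domain_pos:
  assumes g: "g \<in> mb_domain n" and a: "a \<in> coords n"
  shows "0 < Re (udiff n g a)" and "0 < Re (zarg n lam g a)"
proof -
  have D: "0 < Re (gam2 n g k l)" "0 < Re (del2 n g k l)" "0 < Re (xi n g k l)" "0 < Re (eta n g k l)"
    "0 < Re (gam2 n g k l - gam2 n g (k + 1) l)" "0 < Re (del2 n g k l - del2 n g (k + 1) l)"
    if "1 \<le> k" "k < l" "l \<le> n" for k l
    using g that unfolding mb_domain_def pairs_def by fastforce+
  have G: "0 < Re (gam1 n g k)" if "1 \<le> k" "k \<le> n" for k
    using g that unfolding mb_domain_def by fastforce
  show "0 < Re (udiff n g a)"
  proof (cases a)
    case (Sgl k)
    show ?thesis
    proof (cases "k = n")
      case True
      then show ?thesis using Sgl a G[of k] by (simp add: gam1_def)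
    next
      case False
      \<comment> \<open>The sum xi + eta at (k, n) is gamma_k - gamma_(k+1), so the positivity of
        this difference follows from the other inequalities.\<close>
      then have "0 < Re (xi n g k n) + Re (eta n g k n)" using D(3,4)[of k n] Sgl a by (intro add_pos_pos) auto
      then show ?thesis using Sgl by (simp add: xi_def eta_def)
    qed
  qed (use a D(5,6) in auto)
  show "0 < Re (zarg n lam g a)"
  proof (cases a)
    case (DblA k l)
    show ?thesis
    proof (cases "l = Suc k")
      case True
      then show ?thesis using DblA a D(1,2)[of k l] by simp
    next
      case False
      then obtain m where "l = Suc m" "k < m" using DblA a by (cases l) auto
      then show ?thesis using False DblA a D(4)[of k m] by simp
    qed
  next
    case (Sgl k)
    then show ?thesis using a D(4)[of k n] G[of k] by (cases "k = n") auto
  qed (use a D(3) in auto)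
qed

lemma mb_domain_real_point: "\<exists>c. (\<lambda>a. complex_of_real (c a)) \<in> mb_domain n"
proof -
  \<comment> \<open>Put q = 3^(n-k-1). The double variables are 6q in row k and 2q in row k + 1, the
    single ones 9q and 3q. The tightest inequality is then eta_(k,n) >= 9q - 6q - 2q = q; missing
    variables are 0 and only help there.\<close>
  define c :: "coord \<Rightarrow> real" where
    "c = (\<lambda>a. case a of Sgl k \<Rightarrow> 3 * 3 ^ (n - k) | _ \<Rightarrow> 2 * 3 ^ (n - row_of a))"
  have p: "(3 :: real) ^ (n - k) = 3 * 3 ^ (n - Suc k)" if "k < n" for k
  proof -
    have "n - k = Suc (n - Suc k)" using that by simp
    then show ?thesis by simp
  qed
  have p0: "(0 :: real) < 3 ^ (n - Suc k)" for k by simp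
  have "(\<lambda>a. complex_of_real (c a)) \<in> mb_domain n"
    unfolding mb_domain_def
    using p p0 by (auto simp: c_def gam2_def del2_def gam1_def xi_def eta_def pairs_def)
  then show ?thesis by blast
qed

text \<open>The hypothesis \<open>dual\<close> of \<open>Mellin_Parseval\<close>. It is
  \<open>exponent_duality\<close> with lm = i lambda, where the out-of-range conventions for gamma
  and delta provide the boundary values.\<close>

lemma dual_identity:
  fixes \<gamma> :: "coord \<Rightarrow> complex" and \<tau> :: "coord \<Rightarrow> real"
  shows "(\<Sum>a\<in>coords n. udiff n \<gamma> a * of_real (\<tau> a)) + \<i> * of_real (\<Sum>k = 1..n. lam k * ltorus n \<tau> k)
    = - (\<Sum>b\<in>coords n. zarg n lam \<gamma> b * of_real (lexp n \<tau> b))"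
proof -
  let ?tA = "\<lambda>k l. complex_of_real (\<tau> (DblA k l))" and ?tB = "\<lambda>k l. complex_of_real (\<tau> (DblB k l))"
    and ?tS = "\<lambda>k. complex_of_real (\<tau> (Sgl k))" and ?lm = "\<lambda>k. \<i> * complex_of_real (lam k)"
  let ?R = "\<lambda>m l. if l \<le> n then ?tA m l - ?tB m l else 0"
  let ?cl = "\<lambda>k l. if l \<le> n then ?tA k l else ?tS k"
  let ?gd = "\<lambda>k l. if l \<le> n then gam2 n \<gamma> k l + del2 n \<gamma> k l else gam1 n \<gamma> k"
  let ?pot = "\<lambda>k l. (\<Sum>m\<in>{1..<k}. ?R m (l - 1) - ?R m l) - ?cl k l"
  let ?zA = "\<lambda>k l. ?gd k l - gam2 n \<gamma> (Suc k) (l - 1) - del2 n \<gamma> k (l - 1) + (?lm k + ?lm (l - 1))"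
  let ?zB = "\<lambda>k l. gam2 n \<gamma> (Suc k) l + del2 n \<gamma> k l - ?gd (Suc k) (Suc l) + (?lm k - ?lm l)"
  have pot: "complex_of_real (lpot n \<tau> k l) = ?pot k l" for k l
    by (auto simp: lpot_def lratio_def lcol_def intro!: sum.cong)
  have R: "complex_of_real (lratio n \<tau> m l) = ?R m l" for m l
    by (simp add: lratio_def)
  have D: "(\<Sum>k = 1..n. (gam1 n \<gamma> k - gam1 n \<gamma> (Suc k)) * ?tS k
      + (\<Sum>l\<in>{k<..n}. (gam2 n \<gamma> k l - gam2 n \<gamma> (Suc k) l) * ?tA k l + (del2 n \<gamma> k l - del2 n \<gamma> (Suc k) l) * ?tB k l))
    + (\<Sum>k = 1..n. ?lm k * ((\<Sum>l\<in>{k<..n}. ?tA k l + ?tB k l) + 2 * ?tS k - (\<Sum>m\<in>{1..<k}. ?R m k)))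
    = - (\<Sum>k = 1..n. ?zA k (Suc n) * ?pot k (Suc n)
      + (\<Sum>l\<in>{k<..n}. ?zA k l * ?pot k l + ?zB k l * (?R k l + ?pot k (Suc l))))"
    by (rule exponent_duality) (auto simp: gam2_def del2_def gam1_def pairs_def)
  have "\<i> * of_real (\<Sum>k = 1..n. lam k * ltorus n \<tau> k)
      = (\<Sum>k = 1..n. ?lm k * ((\<Sum>l\<in>{k<..n}. ?tA k l + ?tB k l) + 2 * ?tS k - (\<Sum>m\<in>{1..<k}. ?R m k)))"
    by (simp add: ltorus_def R sum_distrib_left mult.assoc)
  moreover have "(\<Sum>a\<in>coords n. udiff n \<gamma> a * of_real (\<tau> a)) = (\<Sum>k = 1..n. (gam1 n \<gamma> k - gam1 n \<gamma> (Suc k)) * ?tS k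
      + (\<Sum>l\<in>{k<..n}. (gam2 n \<gamma> k l - gam2 n \<gamma> (Suc k) l) * ?tA k l + (del2 n \<gamma> k l - del2 n \<gamma> (Suc k) l) * ?tB k l))"
    by (simp add: sum.coords_split)
  moreover have "(\<Sum>b\<in>coords n. zarg n lam \<gamma> b * of_real (lexp n \<tau> b))
      = (\<Sum>k = 1..n. ?zA k (Suc n) * ?pot k (Suc n)
      + (\<Sum>l\<in>{k<..n}. ?zA k l * ?pot k l + ?zB k l * (?R k l + ?pot k (Suc l))))"
    unfolding sum.coords_split
  proof (rule sum.cong[OF refl])
    fix k assume k: "k \<in> {1..n}"
    have "zarg n lam \<gamma> (Sgl k) = ?zA k (Suc n)"
      using k by (auto simp: eta_def gam2_def del2_def pairs_def algebra_simps)
    moreover have "zarg n lam \<gamma> (DblA k l) = ?zA k l" "zarg n lam \<gamma> (DblB k l) = ?zB k l" if "l \<in> {k<..n}" for l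
      using that k by (auto simp: eta_def xi_def gam2_def del2_def pairs_def algebra_simps)
    ultimately show "zarg n lam \<gamma> (Sgl k) * of_real (lexp n \<tau> (Sgl k))
      + (\<Sum>l\<in>{k<..n}. zarg n lam \<gamma> (DblA k l) * of_real (lexp n \<tau> (DblA k l)) + zarg n lam \<gamma> (DblB k l) * of_real (lexp n \<tau> (DblB k l)))
      = ?zA k (Suc n) * ?pot k (Suc n) + (\<Sum>l\<in>{k<..n}. ?zA k l * ?pot k l + ?zB k l * (?R k l + ?pot k (Suc l)))"
      by (intro arg_cong2[where f = "(+)"] sum.cong refl) (simp_all only: lexp_simps pot R of_real_add greaterThanAtMost_iff)
  qed
  ultimately show ?thesis using D by (simp only:)
qed

text \<open>Roots depend only on the column, so the differences telescope over the rows. This is why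
  \<open>mb_H\<close> involves only variables of the first row.\<close>

lemma weight_sum:
  assumes "1 \<le> n"
  shows "(\<Sum>a\<in>coords n. udiff n \<gamma> a * complex_of_real (weight n x a)) = - mb_H n x \<gamma>"
proof -
  define G where "G k l = gam2 n \<gamma> k l + del2 n \<gamma> k l" for k l
  have "(\<Sum>a\<in>coords n. udiff n \<gamma> a * complex_of_real (weight n x a))
      = (\<Sum>k = 1..n. (gam1 n \<gamma> k - gam1 n \<gamma> (Suc k)) * complex_of_real (x n))
        + (\<Sum>k = 1..n. \<Sum>l\<in>{k<..n}. (G k l - G (Suc k) l) * complex_of_real (x (l - 1) - x l))"
    unfolding sum.coords_split sum.distrib[symmetric]
    by (intro sum.cong refl arg_cong2[where f = "(+)"]) (simp_all add: G_def algebra_simps)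
  also have "(\<Sum>k = 1..n. (gam1 n \<gamma> k - gam1 n \<gamma> (Suc k)) * complex_of_real (x n)) = gam1 n \<gamma> 1 * complex_of_real (x n)"
  proof -
    have "{1..n} = {1..<Suc n}" by auto
    then have "(\<Sum>k = 1..n. gam1 n \<gamma> k - gam1 n \<gamma> (Suc k)) = gam1 n \<gamma> 1 - gam1 n \<gamma> (Suc n)"
      by (simp only:) (rule sum_telescope_nat, simp)
    moreover have "gam1 n \<gamma> (Suc n) = 0" by (simp add: gam1_def)
    ultimately show ?thesis by (simp only: sum_distrib_right[symmetric] diff_zero)
  qed
  also have "(\<Sum>k = 1..n. \<Sum>l\<in>{k<..n}. (G k l - G (Suc k) l) * complex_of_real (x (l - 1) - x l))
      = (\<Sum>l = 1..n. \<Sum>k\<in>{1..<l}. (G k l - G (Suc k) l) * complex_of_real (x (l - 1) - x l))"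
    by (rule sum_pairs_swap)
  also have "\<dots> = (\<Sum>l = 1..n. G 1 l * complex_of_real (x (l - 1) - x l))"
  proof (rule sum.cong[OF refl])
    fix l assume l: "l \<in> {1..n}"
    have "(\<Sum>k\<in>{1..<l}. G k l - G (Suc k) l) = G 1 l - G l l"
      using l by (intro sum_telescope_nat) auto
    then show "(\<Sum>k\<in>{1..<l}. (G k l - G (Suc k) l) * complex_of_real (x (l - 1) - x l)) = G 1 l * complex_of_real (x (l - 1) - x l)"
      by (simp add: G_def gam2_def del2_def pairs_def flip: sum_distrib_right)
  qed
  also have "\<dots> = (\<Sum>l = 2..n. G 1 l * complex_of_real (x (l - 1) - x l))"
  proof -
    have "{1..n} = insert 1 {2..n}" using assms by auto
    then show ?thesis by (simp add: G_def gam2_def del2_def pairs_def)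
  qed
  also have "\<dots> = - (\<Sum>l = 2..n. G 1 l * complex_of_real (x l - x (l - 1)))"
    by (simp add: algebra_simps flip: sum_negf)
  finally show ?thesis by (simp add: mb_H_def G_def)
qed

text \<open>At \<open>DblA k l\<close> the argument carries \<open>eta\<close> of the preceding
  column, and for k < n the coordinate \<open>Sgl k\<close> supplies column n. The columns are thus
  shifted by one, and each row has one factor left over, the one with 2 i lambda_k; in row n this is
  the factor of \<open>Sgl n\<close> itself.\<close>

lemma mb_integrand_eq:
  assumes n: "1 \<le> n"
  shows "(\<Prod>a\<in>coords n. exp (- (udiff n \<gamma> a * of_real (weight n x a))) * Gamma (udiff n \<gamma> a)) * (\<Prod>b\<in>coords n. Gamma (zarg n lam \<gamma> b))
    = mb_integrand n lam x \<gamma>"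
proof -
  define first where "first k = (if k = n then gam1 n \<gamma> n else gam2 n \<gamma> k (k + 1) + del2 n \<gamma> k (k + 1)) + 2 * \<i> * complex_of_real (lam k)" for k
  define GX where "GX k l = Gamma (xi n \<gamma> k l + \<i> * complex_of_real (lam k - lam l))" for k l
  define GE where "GE k l = Gamma (eta n \<gamma> k l + \<i> * complex_of_real (lam k + lam l))" for k l
  define GA where "GA k l = Gamma (gam2 n \<gamma> k l - gam2 n \<gamma> (k + 1) l)" for k l
  define GD where "GD k l = Gamma (del2 n \<gamma> k l - del2 n \<gamma> (k + 1) l)" for k l
  define GS where "GS k = Gamma (gam1 n \<gamma> k - gam1 n \<gamma> (k + 1))" for k
  have row: "Gamma (zarg n lam \<gamma> (Sgl k)) * (\<Prod>l\<in>{k<..n}. Gamma (zarg n lam \<gamma> (DblA k l))) = Gamma (first k) * (\<Prod>l\<in>{k<..n}. GE k l)"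
    if k: "k \<in> {1..n}" for k
  proof (cases "k = n")
    case True
    then show ?thesis by (simp add: first_def algebra_simps)
  next
    case False
    then have kn: "k < n" using k by simp
    have "(\<Prod>l\<in>{k<..n}. Gamma (zarg n lam \<gamma> (DblA k l))) = Gamma (zarg n lam \<gamma> (DblA k (Suc k))) * (\<Prod>l\<in>{Suc k<..n}. Gamma (zarg n lam \<gamma> (DblA k l)))"
    proof -
      have "{k<..n} = insert (Suc k) {Suc k<..n}" using kn by auto
      then show ?thesis by simp
    qed
    also have "Gamma (zarg n lam \<gamma> (DblA k (Suc k))) = Gamma (first k)"
      using False by (simp add: first_def algebra_simps)
    also have "(\<Prod>l\<in>{Suc k<..n}. Gamma (zarg n lam \<gamma> (DblA k l))) = (\<Prod>l\<in>{k<..<n}. GE k l)"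
      by (rule prod.reindex_bij_witness[of _ Suc "\<lambda>l. l - 1"]) (auto simp: GE_def)
    finally have "Gamma (zarg n lam \<gamma> (Sgl k)) * (\<Prod>l\<in>{k<..n}. Gamma (zarg n lam \<gamma> (DblA k l)))
        = Gamma (first k) * (GE k n * (\<Prod>l\<in>{k<..<n}. GE k l))"
      using False by (simp add: GE_def)
    also have "GE k n * (\<Prod>l\<in>{k<..<n}. GE k l) = (\<Prod>l\<in>{k<..n}. GE k l)"
    proof -
      have "{k<..n} = insert n {k<..<n}" using kn by auto
      then show ?thesis by simp
    qed
    finally show ?thesis .
  qed
  have ins: "{1..n} = insert n {1..<n}" using n by auto
  have "(\<Prod>a\<in>coords n. exp (- (udiff n \<gamma> a * of_real (weight n x a))) * Gamma (udiff n \<gamma> a))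
      = exp (mb_H n x \<gamma>) * (\<Prod>a\<in>coords n. Gamma (udiff n \<gamma> a))"
  proof -
    have "(\<Prod>a\<in>coords n. exp (- (udiff n \<gamma> a * of_real (weight n x a)))) = exp (- (\<Sum>a\<in>coords n. udiff n \<gamma> a * of_real (weight n x a)))"
      by (simp add: exp_sum flip: sum_negf)
    then show ?thesis by (simp add: prod.distrib weight_sum[OF n])
  qed
  also have "(\<Prod>a\<in>coords n. Gamma (udiff n \<gamma> a)) = (\<Prod>k = 1..n. GS k * (\<Prod>l\<in>{k<..n}. GA k l * GD k l))"
    by (simp add: prod.coords_split GS_def GA_def GD_def)
  finally have A: "(\<Prod>a\<in>coords n. exp (- (udiff n \<gamma> a * of_real (weight n x a))) * Gamma (udiff n \<gamma> a))
      = exp (mb_H n x \<gamma>) * (\<Prod>k = 1..n. GS k * (\<Prod>l\<in>{k<..n}. GA k l * GD k l))" .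
  have B: "(\<Prod>b\<in>coords n. Gamma (zarg n lam \<gamma> b)) = (\<Prod>k = 1..n. Gamma (first k) * (\<Prod>l\<in>{k<..n}. GE k l * GX k l))"
    unfolding prod.coords_split
  proof (rule prod.cong[OF refl])
    fix k assume k: "k \<in> {1..n}"
    have "(\<Prod>l\<in>{k<..n}. Gamma (zarg n lam \<gamma> (DblB k l))) = (\<Prod>l\<in>{k<..n}. GX k l)"
      by (simp add: GX_def)
    then show "Gamma (zarg n lam \<gamma> (Sgl k)) * (\<Prod>l\<in>{k<..n}. Gamma (zarg n lam \<gamma> (DblA k l)) * Gamma (zarg n lam \<gamma> (DblB k l)))
      = Gamma (first k) * (\<Prod>l\<in>{k<..n}. GE k l * GX k l)"
      by (simp only: prod.distrib mult.assoc[symmetric] row[OF k])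
  qed
  have "(\<Prod>a\<in>coords n. exp (- (udiff n \<gamma> a * of_real (weight n x a))) * Gamma (udiff n \<gamma> a)) * (\<Prod>b\<in>coords n. Gamma (zarg n lam \<gamma> b))
      = exp (mb_H n x \<gamma>) * (\<Prod>k = 1..n. GS k * (\<Prod>l\<in>{k<..n}. GA k l * GD k l)) * (\<Prod>k = 1..n. Gamma (first k) * (\<Prod>l\<in>{k<..n}. GE k l * GX k l))"
    by (simp only: A B)
  also have "exp (mb_H n x \<gamma>) * (\<Prod>k = 1..n. GS k * (\<Prod>l\<in>{k<..n}. GA k l * GD k l)) * (\<Prod>k = 1..n. Gamma (first k) * (\<Prod>l\<in>{k<..n}. GE k l * GX k l))
      = exp (mb_H n x \<gamma>) * Gamma (first n) * GS n * (\<Prod>k = 1..<n. Gamma (first k) * GS k) * (\<Prod>k = 1..n. \<Prod>l\<in>{k<..n}. GX k l * GE k l * GA k l * GD k l)"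
  proof -
    have "(\<Prod>k = 1..n. GS k) = GS n * (\<Prod>k = 1..<n. GS k)" "(\<Prod>k = 1..n. Gamma (first k)) = Gamma (first n) * (\<Prod>k = 1..<n. Gamma (first k))"
      unfolding ins by simp_all
    then show ?thesis by (simp only: prod.distrib mult_ac)
  qed
  also have "(\<Prod>k = 1..n. \<Prod>l\<in>{k<..n}. GX k l * GE k l * GA k l * GD k l) = (\<Prod>(k, l)\<in>pairs n. GX k l * GE k l * GA k l * GD k l)"
    by (rule prod_pairs[symmetric])
  also have "GS n = Gamma (gam1 n \<gamma> n)" by (simp add: GS_def gam1_def)
  also have "(\<Prod>k = 1..<n. Gamma (first k) * GS k) = (\<Prod>k = 1..<n.
          Gamma (gam2 n \<gamma> k (k + 1) + del2 n \<gamma> k (k + 1) + 2 * \<i> * complex_of_real (lam k)) * Gamma (gam1 n \<gamma> k - gam1 n \<gamma> (k + 1)))"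
    by (intro prod.cong) (auto simp: first_def GS_def)
  also have "first n = gam1 n \<gamma> n + 2 * \<i> * complex_of_real (lam n)" by (simp add: first_def)
  finally show ?thesis unfolding mb_integrand_def GX_def GE_def GA_def GD_def .
qed

section \<open>Assembly of the Mellin-Barnes formula\<close>

lemma card_coords: "card (coords n) = n\<^sup>2"
proof -
  have "card (coords n) = (\<Sum>k = 1..n. 1 + (\<Sum>l\<in>{k<..n}. 1 + 1))"
    by (simp only: card_eq_sum sum.coords_split)
  \<comment> \<open>Row n - j has 2 j + 1 coordinates, so the count is a sum of consecutive odd
    numbers.\<close>
  also have "\<dots> = (\<Sum>j<n. 1 + 2 * j)"
    by (rule sum.reindex_bij_witness[of _ "\<lambda>j. n - j" "\<lambda>k. n - k"]) auto
  also have "\<dots> = n\<^sup>2"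
    by (induction n) (simp_all add: power2_eq_square)
  finally show ?thesis .
qed

lemma chi_exp:
  assumes "\<And>k. k \<in> {1..n} \<Longrightarrow> T k = exp (r k)"
  shows "chi n \<nu> T = exp (\<Sum>k = 1..n. \<nu> k * of_real (r k))"
proof -
  have "chi n \<nu> T = (\<Prod>k = 1..n. exp (\<nu> k * of_real (r k)))"
    unfolding chi_def
  proof (rule prod.cong[OF refl])
    fix k assume "k \<in> {1..n}"
    then show "complex_of_real (T k) powr \<nu> k = exp (\<nu> k * of_real (r k))"
      using assms by (simp add: powr_def Ln_of_real)
  qed
  then show ?thesis by (simp add: exp_sum)
qed

text \<open>Conjugation turns T^(i lambda - rho) into T^(- i lambda - rho), and the density T^rho of
  \<open>jacobian_log\<close> cancels the real part. The product of all coordinates stands on the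
  left because \<open>positive_orthant_substitution\<close> asks for the integrand in this
  form.\<close>

lemma psi_integrand_log:
  assumes t: "\<And>a. a \<in> coords n \<Longrightarrow> 0 < t a"
  defines "\<tau> \<equiv> \<lambda>a\<in>coords n. ln (t a)"
  shows "of_real (\<Prod>a\<in>coords n. t a) * psi_integrand n lam x t
    = exp (of_real (\<Sum>k = 1..n. rho n k * x k)) * exp (- \<i> * of_real (\<Sum>k = 1..n. lam k * x k))
      * (exp (- \<i> * of_real (\<Sum>k = 1..n. lam k * ltorus n \<tau> k))
        * of_real ((\<Prod>a\<in>coords n. exp (- exp (lexp n \<tau> a))) * (\<Prod>a\<in>coords n. exp (- exp (\<tau> a + weight n x a)))))"
proof -
  have p: "positive n t" using t by (simp add: positive_def)
  have \<tau>: "\<tau> a = ln (t a)" if "a \<in> coords n" for a using that by (simp add: \<tau>_def)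
  define S where "S = (\<Sum>k = 1..n. complex_of_real (lam k * ltorus n \<tau> k))"
  define P where "P = (\<Sum>k = 1..n. complex_of_real (rho n k * ltorus n \<tau> k))"
  define SX where "SX = (\<Sum>k = 1..n. complex_of_real (lam k * x k))"
  define PX where "PX = (\<Sum>k = 1..n. complex_of_real (rho n k * x k))"
  define J where "J = (\<Prod>(i, j)\<in>pairs n. t (DblA i j) ^ (j - i) * t (DblB i j) ^ (2 * n + 1 - i - j) / (t (DblA i j) * t (DblB i j)))
     * (\<Prod>i = 1..n. t (Sgl i) ^ (2 * n + 1 - 2 * i) / t (Sgl i))"
  have J: "complex_of_real (\<Prod>a\<in>coords n. t a) * complex_of_real J = exp P"
  proof -
    have "(\<Prod>a\<in>coords n. t a) * J = exp (\<Sum>k = 1..n. rho n k * ltorus n \<tau> k)"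
      using jacobian_log[OF p \<tau>] by (simp add: J_def mult.commute)
    then have "complex_of_real ((\<Prod>a\<in>coords n. t a) * J) = of_real (exp (\<Sum>k = 1..n. rho n k * ltorus n \<tau> k))" by (simp only:)
    then show ?thesis by (simp add: P_def exp_of_real[symmetric] del: of_real_prod)
  qed
  have L: "cnj (whittaker_L n (mu n lam) (X_mat n t)) = exp (- \<i> * S - P) * of_real (\<Prod>a\<in>coords n. exp (- exp (lexp n \<tau> a)))"
  proof -
    have "chi n (mu n lam) (torus_part n 1 t) = exp (\<Sum>k = 1..n. mu n lam k * of_real (ltorus n \<tau> k))"
      by (rule chi_exp) (rule torus_part_log[OF p \<tau>])
    moreover have "cnj (exp (\<Sum>k = 1..n. mu n lam k * of_real (ltorus n \<tau> k))) = exp (- \<i> * S - P)"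
      by (simp add: exp_cnj mu_def S_def P_def sum_distrib_left algebra_simps sum.distrib sum_subtractf sum_negf)
    moreover have "exp (- potential n 1 t) = (\<Prod>a\<in>coords n. exp (- exp (lexp n \<tau> a)))"
      by (simp only: potential_log[OF p \<tau>] sum_negf[symmetric] exp_sum[OF finite_coords])
    ultimately show ?thesis by (simp only: whittaker_L_eq[OF p] complex_cnj_mult complex_cnj_complex_of_real)
  qed
  have R: "whittaker_R n (mu n lam) (X_mat n t * mat_exp (- cartan n x))
      = exp (- \<i> * SX + PX) * of_real (\<Prod>a\<in>coords n. exp (- exp (\<tau> a + weight n x a)))"
  proof -
    have "chi n (mu n lam) (\<lambda>k. exp (- x k)) = exp (\<Sum>k = 1..n. mu n lam k * of_real (- x k))"
      by (rule chi_exp) simp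
    also have "(\<Sum>k = 1..n. mu n lam k * of_real (- x k)) = - \<i> * SX + PX"
      by (simp add: mu_def SX_def PX_def sum_distrib_left algebra_simps sum.distrib sum_subtractf sum_negf)
    finally have c: "chi n (mu n lam) (\<lambda>k. exp (- x k)) = exp (- \<i> * SX + PX)" .
    have "(\<Sum>k = 1..n. row_sum n (\<lambda>a. t a * exp (weight n x a)) k) = (\<Sum>a\<in>coords n. t a * exp (weight n x a))"
      by (simp add: sum.coords_split row_sum_def add.commute)
    also have "\<dots> = (\<Sum>a\<in>coords n. exp (\<tau> a + weight n x a))"
      by (intro sum.cong refl) (simp add: exp_add exp_log[OF p \<tau>])
    finally have "char_exp n (\<lambda>a. t a * exp (weight n x a)) = of_real (\<Prod>a\<in>coords n. exp (- exp (\<tau> a + weight n x a)))"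
      by (simp only: char_exp_row_sum sum_negf[symmetric] exp_sum[OF finite_coords])
    then show ?thesis by (simp only: whittaker_R_eq[OF p] c)
  qed
  have "of_real (\<Prod>a\<in>coords n. t a) * psi_integrand n lam x t
      = exp (- \<i> * S - P) * exp (- \<i> * SX + PX) * exp P
        * of_real ((\<Prod>a\<in>coords n. exp (- exp (lexp n \<tau> a))) * (\<Prod>a\<in>coords n. exp (- exp (\<tau> a + weight n x a))))"
    unfolding psi_integrand_def J_def[symmetric] L R J[symmetric] by (simp add: mult_ac del: of_real_prod)
  also have "exp (- \<i> * S - P) * exp (- \<i> * SX + PX) * exp P = exp PX * exp (- \<i> * SX) * exp (- \<i> * S)"
    by (simp add: algebra_simps flip: exp_add)
  finally show ?thesis by (simp add: S_def SX_def PX_def mult.assoc del: of_real_prod)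
qed

text \<open>The deformed cycle is represented by any vertical plane through a real point of the
  domain. Since \<open>Psi\<close> does not involve \<open>c\<close>, equality for every admissible
  \<open>c\<close> contains the independence of the cycle integral of the plane, and no contour has
  to be moved.\<close>

theorem theorem5p2:
  fixes n :: nat and lam x :: "nat \<Rightarrow> real"
  assumes "1 \<le> n"
  shows "mb_domain n \<noteq> {} \<and>
    set_integrable (coord_measure n) {t. positive n t} (psi_integrand n lam x) \<and>
    (\<forall>c :: coord \<Rightarrow> real. (\<lambda>a. complex_of_real (c a)) \<in> mb_domain n \<longrightarrow>
       cycle_integrable n c (mb_integrand n lam x) \<and>
       Psi n lam x =
         exp (- \<i> * complex_of_real (\<Sum>k = 1..n. lam k * x k))
           / (2 * complex_of_real pi * \<i>) ^ (n\<^sup>2)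
         * cycle_integral n c (mb_integrand n lam x))"
proof -
  let ?N = "coord_measure n"
  define P where "P \<tau> = exp (- \<i> * of_real (\<Sum>k = 1..n. lam k * ltorus n \<tau> k))
      * of_real ((\<Prod>a\<in>coords n. exp (- exp (lexp n \<tau> a))) * (\<Prod>a\<in>coords n. exp (- exp (\<tau> a + weight n x a))))" for \<tau>
  define K where "K = exp (complex_of_real (\<Sum>k = 1..n. rho n k * x k)) * exp (- \<i> * of_real (\<Sum>k = 1..n. lam k * x k))"
  \<comment> \<open>Here \<open>\<kappa>\<close> is the real part of the differences
    \<open>udiff\<close>, \<open>\<theta>\<close> that of the arguments \<open>zarg\<close>, and the
    roots evaluated at x enter as the shifts \<open>\<epsilon>\<close>.\<close>
  have main: "integrable ?N P" "cycle_integrable n c (mb_integrand n lam x)"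
    "(2 * pi) ^ (n\<^sup>2) * (LINT \<tau>|?N. P \<tau>) = (LINT y|?N. mb_integrand n lam x (vertical c y))"
    if c: "(\<lambda>a. complex_of_real (c a)) \<in> mb_domain n" for c
  proof -
    define S where "S y = (\<lambda>a\<in>coords n. 1 * y a + snext n a y)" for y
    define B where "B \<tau> = (\<lambda>a\<in>coords n. - 1 * \<tau> a + shift n a \<tau>)" for \<tau>
    define u0 where "u0 a = c a + snext n a c" for a
    define \<theta> where "\<theta> b = Re (zarg n lam (\<lambda>a. of_real (c a)) b)" for b
    have Sm: "S \<in> measurable ?N ?N"
      unfolding S_def coord_measure_def
      using measurable_snext[unfolded coord_measure_def] measurable_coord[unfolded coord_measure_def]
      by (auto intro!: measurable_restrict borel_measurable_add)
    have Bm: "B \<in> measurable ?N ?N"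
      unfolding B_def coord_measure_def
      using measurable_shift[unfolded coord_measure_def] measurable_coord[unfolded coord_measure_def]
      by (auto intro!: measurable_restrict borel_measurable_add borel_measurable_uminus)
    have Sd: "distr ?N ?N S = ?N"
      unfolding S_def coord_measure_def
    proof (rule distr_triangular_shear[where r = "\<lambda>a. n - row_of a"])
      show "snext n a \<in> borel_measurable (Pi\<^sub>M (coords n) (\<lambda>_. lborel))" if "a \<in> coords n" for a
        using measurable_snext[OF that] by (simp add: coord_measure_def)
    qed (auto intro: snext_update)
    have Bd: "distr ?N ?N B = ?N"
      unfolding B_def coord_measure_def
    proof (rule distr_triangular_shear[where r = rank])
      show "shift n a \<in> borel_measurable (Pi\<^sub>M (coords n) (\<lambda>_. lborel))" if "a \<in> coords n" for a
        using measurable_shift[OF that] by (simp add: coord_measure_def)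
    qed (auto intro: shift_update)
    have Bl: "B \<tau> a = lexp n \<tau> a" if "a \<in> coords n" for \<tau> a using that by (simp add: B_def lexp_def)
    have U: "Complex (u0 a) (S y a) = udiff n (vertical c y) a" if "a \<in> coords n" for y a
      using that by (simp add: u0_def S_def udiff_vertical)
    have u0: "0 < u0 a" if "a \<in> coords n" for a
    proof -
      have "vertical c (\<lambda>_. 0) = (\<lambda>a. complex_of_real (c a))" by (simp add: vertical_def)
      then show ?thesis
        using mb_domain_pos(1)[OF c that] udiff_vertical[OF that, of c "\<lambda>_. 0"] by (simp add: u0_def)
    qed
    have Lm: "(\<lambda>\<tau>. \<Sum>k = 1..n. lam k * ltorus n \<tau> k) \<in> borel_measurable ?N"
      unfolding ltorus_def
      by (auto intro!: borel_measurable_sum borel_measurable_times borel_measurable_diff borel_measurable_add measurable_coord measurable_lratio)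
    have dual: "(\<Sum>a\<in>coords n. Complex (u0 a) (S y a) * of_real (\<tau> a)) + \<i> * of_real (\<Sum>k = 1..n. lam k * ltorus n \<tau> k)
        = - (\<Sum>b\<in>coords n. zarg n lam (vertical c y) b * of_real (B \<tau> b))" for \<tau> y
      using dual_identity[of n "vertical c y" \<tau> lam] by (simp add: U Bl cong: sum.cong)
    have \<theta>: "0 < \<theta> b" if "b \<in> coords n" for b
      using mb_domain_pos(2)[OF c that] by (simp add: \<theta>_def)
    have Rez: "Re (zarg n lam (vertical c y) b) = \<theta> b" for y b
      by (simp only: \<theta>_def Re_zarg_vertical)
    note MP = Mellin_Parseval[where I = "coords n" and \<kappa> = u0 and \<theta> = \<theta> and \<epsilon> = "weight n x" and S = S and B = B
        and L = "\<lambda>\<tau>. \<Sum>k = 1..n. lam k * ltorus n \<tau> k" and z = "\<lambda>b y. zarg n lam (vertical c y) b",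
        folded coord_measure_def, OF finite_coords Sm Sd Bm Bd Lm measurable_zarg u0 \<theta> Rez dual]
    have PB: "P \<tau> = exp (- \<i> * of_real (\<Sum>k = 1..n. lam k * ltorus n \<tau> k))
      * of_real ((\<Prod>a\<in>coords n. exp (- exp (B \<tau> a))) * (\<Prod>a\<in>coords n. exp (- exp (\<tau> a + weight n x a))))" for \<tau>
      by (simp add: P_def Bl cong: prod.cong)
    have QB: "mb_integrand n lam x (vertical c y)
      = (\<Prod>a\<in>coords n. exp (- (Complex (u0 a) (S y a) * of_real (weight n x a))) * Gamma (Complex (u0 a) (S y a)))
        * (\<Prod>b\<in>coords n. Gamma (zarg n lam (vertical c y) b))" for y
      unfolding mb_integrand_eq[OF assms, symmetric] by (simp add: U cong: prod.cong)
    show "integrable ?N P" unfolding PB using MP(1) .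
    show "cycle_integrable n c (mb_integrand n lam x)" unfolding cycle_integrable_def QB using MP(2) .
    show "(2 * pi) ^ (n\<^sup>2) * (LINT \<tau>|?N. P \<tau>) = (LINT y|?N. mb_integrand n lam x (vertical c y))"
      unfolding PB QB using MP(3) by (simp only: card_coords)
  qed
  \<comment> \<open>One admissible point is needed to know that \<open>P\<close> is integrable, a
    fact that no longer refers to the plane.\<close>
  obtain c0 where c0: "(\<lambda>a. complex_of_real (c0 a)) \<in> mb_domain n" using mb_domain_real_point by blast
  have iP: "integrable ?N (\<lambda>\<tau>. K * P \<tau>)" using main(1)[OF c0] by simp
  have KP: "of_real (\<Prod>a\<in>coords n. t a) * psi_integrand n lam x t = K * P (\<lambda>a\<in>coords n. ln (t a))"
    if "\<And>a. a \<in> coords n \<Longrightarrow> 0 < t a" for t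
    unfolding K_def P_def by (rule psi_integrand_log[OF that])
  note sub = positive_orthant_substitution[OF finite_coords iP[unfolded coord_measure_def] KP,
      folded coord_measure_def]
  have psi: "set_integrable ?N {t. positive n t} (psi_integrand n lam x)"
    "set_lebesgue_integral ?N {t. positive n t} (psi_integrand n lam x) = K * (LINT \<tau>|?N. P \<tau>)"
    using sub unfolding positive_def integral_mult_right_zero by blast+
  have Psi: "Psi n lam x = exp (- \<i> * of_real (\<Sum>k = 1..n. lam k * x k)) * (LINT \<tau>|?N. P \<tau>)"
  proof -
    \<comment> \<open>The factor exp (- (rho, x)) in \<open>Psi\<close> removes the real part
      contributed by the torus character of the right Whittaker vector.\<close>
    have "complex_of_real (exp (- (\<Sum>k = 1..n. rho n k * x k))) * K = exp (- \<i> * of_real (\<Sum>k = 1..n. lam k * x k))"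
      unfolding K_def by (simp add: mult.assoc[symmetric] exp_of_real[symmetric] flip: exp_add)
    then show ?thesis
      unfolding Psi_def psi(2) by (simp only: mult.assoc[symmetric])
  qed
  have cycle: "(LINT \<tau>|?N. P \<tau>) = cycle_integral n c (mb_integrand n lam x) / (2 * complex_of_real pi * \<i>) ^ (n\<^sup>2)"
    if "(\<lambda>a. complex_of_real (c a)) \<in> mb_domain n" for c
  proof -
    \<comment> \<open>Each of the n^2 differentials contributes a factor i, which completes the
      power of 2 pi to that of 2 pi i.\<close>
    have "cycle_integral n c (mb_integrand n lam x) = \<i> ^ (n\<^sup>2) * ((2 * pi) ^ (n\<^sup>2) * (LINT \<tau>|?N. P \<tau>))"
      unfolding cycle_integral_def main(3)[OF that] card_coords ..
    also have "\<dots> = (2 * complex_of_real pi * \<i>) ^ (n\<^sup>2) * (LINT \<tau>|?N. P \<tau>)"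
      by (simp add: power_mult_distrib mult_ac)
    finally show ?thesis by simp
  qed
  show ?thesis
  proof (intro conjI allI impI)
    show "mb_domain n \<noteq> {}" using c0 by blast
    show "set_integrable ?N {t. positive n t} (psi_integrand n lam x)" by (fact psi(1))
    fix c :: "coord \<Rightarrow> real" assume c: "(\<lambda>a. complex_of_real (c a)) \<in> mb_domain n"
    show "cycle_integrable n c (mb_integrand n lam x)" by (rule main(2)[OF c])
    show "Psi n lam x = exp (- \<i> * complex_of_real (\<Sum>k = 1..n. lam k * x k))
        / (2 * complex_of_real pi * \<i>) ^ (n\<^sup>2) * cycle_integral n c (mb_integrand n lam x)"
      unfolding Psi cycle[OF c] by (simp only: times_divide_eq_left times_divide_eq_right)
  qed
qed

end
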